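(* Let $(X,\nu)$ be a continuous (non-atomic) Lebesgue space with finite measure $\nu$. Let $\alpha$ be the Gaussian white noise on $(X,\nu)$ and $\pi$ the Poisson process on $(X,\nu)$, and equip $L^2(\alpha)$ and $L^2(\pi)$ with the Hilbert factorizations over $(X,\nu)$ generated by these processes. Then there exists a unique unity-preserving (i.e. $1\mapsto 1$) special real isomorphism of the Hilbert factorizations in the spaces $L^2(\alpha)$ and $L^2(\pi)$. The corresponding isometry $\Phi: L^2(\alpha)\to L^2(\pi)$ of the Hilbert spaces is given by the following formula on the set of multiplicative functionals: for each real-valued $h\in L^2(X,\nu)\cap L^1(X,\nu)$, $$\Phi:\quad e^{\langle h,\cdot\rangle-\frac{\|h\|^2}{2}}\ \mapsto\ \prod_{x\in\omega}(1+h(x))\cdot e^{-\int_X h(x)\,d\nu(x)},\qquad \omega\in\mathcal E(X).$$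
   Context: Gaussian white noise $\alpha$ on $(X,\nu)$: the generalized random process on the real Hilbert space $L^2(X,\nu)$, i.e. a linear map $h\mapsto\langle h,\cdot\rangle$ to random variables, with $\mathbb E e^{i\langle h,\cdot\rangle}=e^{-\|h\|^2/2}$, where $\|h\|$ is the norm of $L^2(X,\nu)$. Poisson process $\pi$ on $(X,\nu)$: a random point configuration $\omega$ in the space $\mathcal E(X)$ of point configurations (at most countable sets of points with multiplicities) on $X$ such that $\#(\omega\cap A)$ has the Poisson distribution with parameter $\nu(A)$ for each measurable $A\subset X$, and these numbers are independent for disjoint sets. $L^2(\alpha)$, $L^2(\pi)$: complex Hilbert spaces of square integrable functionals, measurable with respect to the $\sigma$-field generated by the process. Hilbert factorization: for a Hilbert space $\mathcal H$ and a Boolean algebra $\mathcal A$, a map $\xi$ from $\mathcal A$ to the von Neumann algebras on $\mathcal H$ such that each $\xi(A)$ is a type I factor, $\xi(A_1\wedge A_2)=\xi(A_1)\cap\xi(A_2)$, $\xi(A_1\vee A_2)=(\xi(A_1)\cup\xi(A_2))''$, $\xi(A')=\xi(A)'$ (complement goes to commutant), $\xi(0)=\mathbb C\cdot\mathrm{Id}$, $\xi(1)=\mathcal B(\mathcal H)$. "Over $(X,\nu)$" means that $\mathcal A$ is the Boolean algebra of mod 0 classes of measurable subsets of $X$. Factorization generated by a process $\eta$ with independent values on $(X,\nu)$: for measurable $A\subset X$ let $H_A\subset L^2(\eta)$ be the subspace of functionals measurable with respect to the $\sigma$-field generated by the restriction of $\eta$ to $A$; then $L^2(\eta)=H_A\otimes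 H_{X\setminus A}$ and $\xi_\eta(A)=\mathcal B(H_A)\otimes 1_{H_{X\setminus A}}$, where $1_H$ denotes the algebra of scalar operators on $H$. Special isomorphism of Hilbert factorizations $(\mathcal H_1,\xi_1)$, $(\mathcal H_2,\xi_2)$ over the same Boolean algebra: a surjective linear isometry $T:\mathcal H_1\to\mathcal H_2$ with $T\xi_1(A)T^{-1}=\xi_2(A)$ for all $A$. Such an isomorphism of spaces of functionals is called real if it sends the real subspace of real-valued functionals of one process to the similar subspace for the other process. A functional $F$ is multiplicative if for every finite measurable partition $X=A_1\cup\dots\cup A_n$ it is a product $F_{A_1}\cdots F_{A_n}$, where $F_{A_k}$ is measurable with respect to the $\sigma$-field generated by the restriction of the process to $A_k$.
   Formalization: Uniqueness as stated fails (compose with F(α)↦F(−α)); proved instead: the isomorphism is unique among those given by the formula, and every unity-preserving special real isomorphism is given by the formula with h replaced by εh on the Poisson side, for a measurable sign function ε. *)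

theory Defs
  imports "HOL-Probability.Probability"
begin

definition mod0_isomorphic :: "'a measure \<Rightarrow> 'b measure \<Rightarrow> bool" where
  "mod0_isomorphic M N \<longleftrightarrow>
     (\<exists>A\<in>null_sets M. \<exists>B\<in>null_sets N. \<exists>f.
        let M' = restrict_space M (space M - A); N' = restrict_space N (space N - B) in
          bij_betw f (space M') (space N') \<and>
          f \<in> measurable M' N' \<and>
          inv_into (space M') f \<in> measurable N' M' \<and>
          distr M' N' f = N')"

text \<open>Finite Lebesgue spaces in the sense of Rokhlin: complete measure spaces isomorphic mod 0 to
  the completion of a finite Borel measure on the line. Atoms are not excluded here.\<close>

definition finite_lebesgue_space :: "'a measure \<Rightarrow> bool" where
  "finite_lebesgue_space M \<longleftrightarrow> complete_measure M \<and> finite_measure M \<and>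
     (\<exists>\<mu> :: real measure. sets \<mu> = sets borel \<and> finite_measure \<mu> \<and>
        mod0_isomorphic M (completion \<mu>))"

definition nonatomic :: "'a measure \<Rightarrow> bool" where
  "nonatomic M \<longleftrightarrow> (\<forall>A\<in>sets M. 0 < emeasure M A \<longrightarrow>
     (\<exists>B\<in>sets M. B \<subseteq> A \<and> 0 < emeasure M B \<and> emeasure M B < emeasure M A))"

definition real_L1 :: "'a measure \<Rightarrow> ('a \<Rightarrow> real) set" where
  "real_L1 M = {h. integrable M h}"

definition real_L2 :: "'a measure \<Rightarrow> ('a \<Rightarrow> real) set" where
  "real_L2 M = {h \<in> borel_measurable M. integrable M (\<lambda>x. (h x)\<^sup>2)}"

text \<open>Hilbert spaces are given by an explicit carrier, because the spaces of functionals below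
  depend on a measure. Operators are extensional functions on the carrier, so that equality of
  operators, and of sets of operators, is equality in HOL. The inner product is linear in the
  first argument.\<close>

record 'h hilb =
  hcarrier :: "'h set"
  hadd :: "'h \<Rightarrow> 'h \<Rightarrow> 'h"
  hscale :: "complex \<Rightarrow> 'h \<Rightarrow> 'h"
  hinner :: "'h \<Rightarrow> 'h \<Rightarrow> complex"

definition hnorm :: "'h hilb \<Rightarrow> 'h \<Rightarrow> real" where
  "hnorm H u = sqrt (Re (hinner H u u))"

definition linear_ops :: "'h hilb \<Rightarrow> 'k hilb \<Rightarrow> ('h \<Rightarrow> 'k) set" where
  "linear_ops H K =
     {T \<in> hcarrier H \<rightarrow>\<^sub>E hcarrier K.
        (\<forall>u\<in>hcarrier H. \<forall>v\<in>hcarrier H. T (hadd H u v) = hadd K (T u) (T v)) \<and>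
        (\<forall>c. \<forall>u\<in>hcarrier H. T (hscale H c u) = hscale K c (T u))}"

definition bounded_ops :: "'h hilb \<Rightarrow> ('h \<Rightarrow> 'h) set" where
  "bounded_ops H =
     {T \<in> linear_ops H H. \<exists>C. \<forall>u\<in>hcarrier H. hnorm H (T u) \<le> C * hnorm H u}"

definition conjugate_op :: "'h hilb \<Rightarrow> 'k hilb \<Rightarrow> ('h \<Rightarrow> 'k) \<Rightarrow> ('h \<Rightarrow> 'h) \<Rightarrow> 'k \<Rightarrow> 'k" where
  "conjugate_op H K T S = restrict (\<lambda>v. T (S (inv_into (hcarrier H) T v))) (hcarrier K)"

text \<open>A factorization over a measure space \<open>M\<close> is a family of operator algebras indexed by the
  measurable sets of \<open>M\<close>; the families used below depend only on the mod 0 class of the set.\<close>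

definition special_isomorphism ::
  "'a measure \<Rightarrow> 'h hilb \<Rightarrow> ('a set \<Rightarrow> ('h \<Rightarrow> 'h) set) \<Rightarrow>
   'k hilb \<Rightarrow> ('a set \<Rightarrow> ('k \<Rightarrow> 'k) set) \<Rightarrow> ('h \<Rightarrow> 'k) \<Rightarrow> bool" where
  "special_isomorphism M H \<xi> K \<zeta> T \<longleftrightarrow>
     T \<in> linear_ops H K \<and>
     (\<forall>u\<in>hcarrier H. hnorm K (T u) = hnorm H u) \<and>
     T ` hcarrier H = hcarrier K \<and>
     (\<forall>A\<in>sets M. conjugate_op H K T ` \<xi> A = \<zeta> A)"

text \<open>Functionals are classes of random variables modulo equality almost everywhere.\<close>

definition ae_class :: "'s measure \<Rightarrow> ('s \<Rightarrow> complex) \<Rightarrow> ('s \<Rightarrow> complex) set" where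
  "ae_class P f = {g \<in> borel_measurable P. AE x in P. g x = f x}"

definition rep :: "('s \<Rightarrow> complex) set \<Rightarrow> 's \<Rightarrow> complex" where
  "rep u = (SOME f. f \<in> u)"

definition class_mult ::
  "'s measure \<Rightarrow> ('s \<Rightarrow> complex) set \<Rightarrow> ('s \<Rightarrow> complex) set \<Rightarrow> ('s \<Rightarrow> complex) set" where
  "class_mult P u v = ae_class P (\<lambda>x. rep u x * rep v x)"

text \<open>\<open>L2 P G\<close>, for a sub-\<open>\<sigma>\<close>-field \<open>G\<close> of \<open>P\<close>, is the space of those classes on \<open>P\<close> that contain a
  square integrable \<open>G\<close>-measurable function; only the \<open>\<sigma>\<close>-field of \<open>G\<close> matters, all integrals are
  taken over \<open>P\<close>.\<close>

definition L2 :: "'s measure \<Rightarrow> 's measure \<Rightarrow> ('s \<Rightarrow> complex) set hilb" where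
  "L2 P G =
     \<lparr> hcarrier = {ae_class P f | f. f \<in> borel_measurable G \<and> integrable P (\<lambda>x. (cmod (f x))\<^sup>2)},
       hadd = (\<lambda>u v. ae_class P (\<lambda>x. rep u x + rep v x)),
       hscale = (\<lambda>c u. ae_class P (\<lambda>x. c * rep u x)),
       hinner = (\<lambda>u v. \<integral>x. rep u x * cnj (rep v x) \<partial>P) \<rparr>"

definition real_subspace :: "'s measure \<Rightarrow> 's measure \<Rightarrow> ('s \<Rightarrow> complex) set set" where
  "real_subspace P G = {u \<in> hcarrier (L2 P G). \<exists>f\<in>u. \<forall>x\<in>space P. f x \<in> \<real>}"

text \<open>From here on, a process on \<open>M\<close> defined on the probability space \<open>P\<close> enters through the family
  \<open>F\<close>, where \<open>F A\<close> is the \<open>\<sigma>\<close>-field generated by its restriction to \<open>A\<close>. The space of its functionals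
  is \<open>L2 P (F (space M))\<close> and \<open>H\<^sub>A\<close> is \<open>L2 P (F A)\<close>. The identification of \<open>L2 P (F (space M))\<close> with
  \<open>H\<^sub>A \<otimes> H\<^sub>X\<^sub>\<setminus>\<^sub>A\<close> sends \<open>u \<otimes> v\<close> to the product \<open>u v\<close>, so \<open>R \<otimes> 1\<close> is the bounded operator that maps
  \<open>u v\<close> to \<open>(R u) v\<close>.\<close>

definition factorization ::
  "'a measure \<Rightarrow> 's measure \<Rightarrow> ('a set \<Rightarrow> 's measure) \<Rightarrow> 'a set \<Rightarrow>
   (('s \<Rightarrow> complex) set \<Rightarrow> ('s \<Rightarrow> complex) set) set" where
  "factorization M P F A =
     {S \<in> bounded_ops (L2 P (F (space M))).
        \<exists>R \<in> bounded_ops (L2 P (F A)).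
          \<forall>u \<in> hcarrier (L2 P (F A)). \<forall>v \<in> hcarrier (L2 P (F (space M - A))).
            S (class_mult P u v) = class_mult P (R u) v}"

definition multiplicative ::
  "'a measure \<Rightarrow> 's measure \<Rightarrow> ('a set \<Rightarrow> 's measure) \<Rightarrow> ('s \<Rightarrow> complex) set \<Rightarrow> bool" where
  "multiplicative M P F u \<longleftrightarrow> u \<in> hcarrier (L2 P (F (space M))) \<and>
     (\<forall>(n::nat) A. (\<forall>k<n. A k \<in> sets M) \<and> disjoint_family_on A {..<n} \<and>
        (\<Union>k<n. A k) = space M \<longrightarrow>
        (\<exists>f. (\<forall>k<n. f k \<in> borel_measurable (F (A k))) \<and>
             u = ae_class P (\<lambda>x. \<Prod>k<n. f k x)))"

text \<open>If the process \<open>W\<close> behind \<open>F\<close> is the white noise and \<open>\<epsilon>\<close> is a measurable function with values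
  in \<open>{-1, 1}\<close>, then replacing \<open>W h\<close> by \<open>W (\<epsilon> h)\<close> defines a unital special real automorphism.
  Hence isomorphisms of the following kind starting from the white noise can be unique at best up to
  such a choice of signs.\<close>

definition unital_special_real_isomorphism ::
  "'a measure \<Rightarrow> 's measure \<Rightarrow> ('a set \<Rightarrow> 's measure) \<Rightarrow>
   't measure \<Rightarrow> ('a set \<Rightarrow> 't measure) \<Rightarrow>
   (('s \<Rightarrow> complex) set \<Rightarrow> ('t \<Rightarrow> complex) set) \<Rightarrow> bool" where
  "unital_special_real_isomorphism M P F Q G T \<longleftrightarrow>
     special_isomorphism M
       (L2 P (F (space M))) (factorization M P F)
       (L2 Q (G (space M))) (factorization M Q G) T \<and>
     T ` real_subspace P (F (space M)) = real_subspace Q (G (space M)) \<and>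
     T (ae_class P (\<lambda>_. 1)) = ae_class Q (\<lambda>_. 1)"

text \<open>\<open>W h\<close> is the random variable \<open>\<langle>h,\<cdot>\<rangle>\<close>. Linearity holds modulo null sets; together with the
  characteristic function it makes \<open>W h\<close> depend, almost surely, only on the class of \<open>h\<close>.\<close>

definition gaussian_white_noise ::
  "'a measure \<Rightarrow> 's measure \<Rightarrow> (('a \<Rightarrow> real) \<Rightarrow> 's \<Rightarrow> real) \<Rightarrow> bool" where
  "gaussian_white_noise M P W \<longleftrightarrow> prob_space P \<and>
     (\<forall>h\<in>real_L2 M. W h \<in> borel_measurable P) \<and>
     (\<forall>h\<in>real_L2 M. \<forall>k\<in>real_L2 M. \<forall>a b.
        AE \<omega> in P. W (\<lambda>x. a * h x + b * k x) \<omega> = a * W h \<omega> + b * W k \<omega>) \<and>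
     (\<forall>h\<in>real_L2 M.
        (\<integral>\<omega>. iexp (W h \<omega>) \<partial>P) = complex_of_real (exp (- (\<integral>x. (h x)\<^sup>2 \<partial>M) / 2)))"

definition gaussian_field ::
  "'a measure \<Rightarrow> 's measure \<Rightarrow> (('a \<Rightarrow> real) \<Rightarrow> 's \<Rightarrow> real) \<Rightarrow> 'a set \<Rightarrow> 's measure" where
  "gaussian_field M P W A = sigma (space P)
     {W h -` B \<inter> space P | h B.
        h \<in> real_L2 M \<and> (\<forall>x\<in>space M - A. h x = 0) \<and> B \<in> sets borel}"

definition gaussian_exponential ::
  "'a measure \<Rightarrow> 's measure \<Rightarrow> (('a \<Rightarrow> real) \<Rightarrow> 's \<Rightarrow> real) \<Rightarrow> ('a \<Rightarrow> real) \<Rightarrow>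
   ('s \<Rightarrow> complex) set" where
  "gaussian_exponential M P W h =
     ae_class P (\<lambda>\<omega>. complex_of_real (exp (W h \<omega> - (\<integral>x. (h x)\<^sup>2 \<partial>M) / 2)))"

text \<open>A configuration is given by the multiplicities of its points.\<close>

definition configurations :: "'a measure \<Rightarrow> ('a \<Rightarrow> nat) set" where
  "configurations M = {c. {x. c x \<noteq> 0} \<subseteq> space M \<and> countable {x. c x \<noteq> 0}}"

definition num_points :: "('a \<Rightarrow> nat) \<Rightarrow> 'a set \<Rightarrow> ennreal" where
  "num_points c A = (\<integral>\<^sup>+x. of_nat (c x) \<partial>count_space A)"

text \<open>The formula for the Poisson distribution is spelled out since \<^const>\<open>poisson_pmf\<close> is specified
  only for positive parameters.\<close>

definition poisson_process ::
  "'a measure \<Rightarrow> 't measure \<Rightarrow> ('t \<Rightarrow> 'a \<Rightarrow> nat) \<Rightarrow> bool" where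
  "poisson_process M Q N \<longleftrightarrow> prob_space Q \<and>
     (\<forall>\<omega>\<in>space Q. N \<omega> \<in> configurations M) \<and>
     (\<forall>A\<in>sets M.
        (\<lambda>\<omega>. num_points (N \<omega>) A) \<in> borel_measurable Q \<and>
        (\<forall>k. measure Q {\<omega>\<in>space Q. num_points (N \<omega>) A = of_nat k} =
           measure M A ^ k / fact k * exp (- measure M A))) \<and>
     (\<forall>(n::nat) A. (\<forall>i<n. A i \<in> sets M) \<and> disjoint_family_on A {..<n} \<longrightarrow>
        prob_space.indep_vars Q (\<lambda>_. borel) (\<lambda>i \<omega>. num_points (N \<omega>) (A i)) {..<n})"

definition poisson_field ::
  "'a measure \<Rightarrow> 't measure \<Rightarrow> ('t \<Rightarrow> 'a \<Rightarrow> nat) \<Rightarrow> 'a set \<Rightarrow> 't measure" where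
  "poisson_field M Q N A = sigma (space Q)
     {(\<lambda>\<omega>. num_points (N \<omega>) B) -` C \<inter> space Q | B C.
        B \<in> sets M \<and> B \<subseteq> A \<and> C \<in> sets borel}"

text \<open>For finite \<open>M\<close> the configuration \<open>N \<omega>\<close> is almost surely finite, so the product below is almost
  surely a finite one.\<close>

definition poisson_exponential ::
  "'a measure \<Rightarrow> 't measure \<Rightarrow> ('t \<Rightarrow> 'a \<Rightarrow> nat) \<Rightarrow> ('a \<Rightarrow> real) \<Rightarrow> ('t \<Rightarrow> complex) set" where
  "poisson_exponential M Q N h =
     ae_class Q (\<lambda>\<omega>. complex_of_real
       ((\<Prod>x\<in>{x. N \<omega> x \<noteq> 0}. (1 + h x) ^ N \<omega> x) * exp (- (\<integral>x. h x \<partial>M))))"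

end

theory Submission
  imports Defs
begin

text \<open>
  Both processes carry exponentials \<open>e h\<close>, for \<open>h\<close> in real \<open>L\<^sup>2\<close>: the Gaussian one
  \<open>exp (\<langle>h,\<cdot>\<rangle> - \<parallel>h\<parallel>\<^sup>2/2)\<close> and the Poisson one \<open>\<Prod>(1 + h(x)) exp (-\<integral>h)\<close>. They have the same inner products
  \<open>\<langle>e h, e k\<rangle> = exp (\<integral>h k)\<close>, those with \<open>h\<close> supported in \<open>A\<close> are total in \<open>H\<^sub>A\<close>, and \<open>e (h + k) = e h e k\<close>
  for disjoint supports. So a functional \<open>u\<close> is determined by its transform \<open>h \<mapsto> \<langle>u, e h\<rangle>\<close>, and membership
  in \<open>H\<^sub>A\<close>, reality, and products \<open>u v\<close> with \<open>u \<in> H\<^sub>A\<close>, \<open>v \<in> H\<^sub>X\<^sub>\<setminus>\<^sub>A\<close> can be read off from transforms. The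
  unitary map that preserves transforms is therefore the required isomorphism.

  Conversely a unital isomorphism \<open>\<Psi>\<close> of the factorizations respects such products, hence
  \<open>K(h,k) = \<langle>\<Psi> (e h), e k\<rangle>\<close> is multiplicative over partitions of \<open>X\<close>. For constants \<open>s\<close>, \<open>t\<close> on a set \<open>A\<close> the
  number \<open>K(s 1\<^sub>A, t 1\<^sub>A) - 1\<close> is bilinear in \<open>s\<close>, \<open>t\<close> up to \<open>O(\<nu>(A)\<^sup>3\<^sup>/\<^sup>2)\<close>. Since \<open>\<nu>\<close> has no atoms, subdividing
  \<open>A\<close> gives \<open>K(s 1\<^sub>A, t 1\<^sub>A) = exp (s t \<mu>(A))\<close> with a real measure \<open>\<bar>\<mu>\<bar> \<le> \<nu>\<close>. Its density \<open>\<epsilon>\<close> satisfies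
  \<open>\<Psi> (e h) = e (\<epsilon> h)\<close>, and \<open>\<epsilon>\<^sup>2 = 1\<close> because \<open>\<Psi>\<close> is isometric.
\<close>

text \<open>The locale \<open>fock_space\<close> collects what the two processes share, so that
  everything except its two instances is proved once. Totality is the analytic part: orthogonality
  to the real exponentials e^{tY} says that an entire function of t vanishes on the real line; it
  then vanishes on the imaginary axis too, where uniqueness of characteristic functions applies.
  Independence of the fields over complementary sets is derived from totality and the kernel instead
  of being checked for each process. An isomorphism of factorizations only maps operator algebras;
  it is made to see products of functionals through rank one operators acting in one tensor factor.
  The exponent 3/2 is the product of two sizes: e(s 1_A) - 1 has norm of order \<nu>(A)^{1/2}, and
  its deviation from linearity in s has norm of order \<nu>(A). Since 3/2 exceeds 1, the total error
  over a fine partition tends to 0. The bound on \<mu> is the Cauchy-Schwarz inequality for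
  exponentials of the constants 1 and -1.\<close>

section \<open>Hilbert spaces on a carrier set\<close>

text \<open>The vector space laws and definiteness are not axioms: they follow from
  \<open>inner_ext\<close>, so identities between vectors are proved by testing against all
  \<open>w\<close>. Subtraction is spelled as \<open>hadd\<close> with \<open>hscale\<close> by -1,
  since the record has no operation of its own for it.\<close>

locale hilbert =
  fixes H :: "'h hilb"
  assumes carrier_nonempty: "hcarrier H \<noteq> {}"
    and add_closed [simp]: "\<lbrakk>u \<in> hcarrier H; v \<in> hcarrier H\<rbrakk> \<Longrightarrow> hadd H u v \<in> hcarrier H"
    and scale_closed [simp]: "u \<in> hcarrier H \<Longrightarrow> hscale H c u \<in> hcarrier H"
    and inner_add_left [simp]: "\<lbrakk>u \<in> hcarrier H; v \<in> hcarrier H; w \<in> hcarrier H\<rbrakk> \<Longrightarrow>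
      hinner H (hadd H u v) w = hinner H u w + hinner H v w"
    and inner_scale_left [simp]: "\<lbrakk>u \<in> hcarrier H; w \<in> hcarrier H\<rbrakk> \<Longrightarrow>
      hinner H (hscale H c u) w = c * hinner H u w"
    and inner_commute: "\<lbrakk>u \<in> hcarrier H; v \<in> hcarrier H\<rbrakk> \<Longrightarrow> hinner H v u = cnj (hinner H u v)"
    and inner_nonneg: "u \<in> hcarrier H \<Longrightarrow> 0 \<le> Re (hinner H u u)"
    and inner_ext: "\<lbrakk>u \<in> hcarrier H; v \<in> hcarrier H;
      \<And>w. w \<in> hcarrier H \<Longrightarrow> hinner H u w = hinner H v w\<rbrakk> \<Longrightarrow> u = v"
    and complete: "\<lbrakk>\<And>n::nat. s n \<in> hcarrier H;
      \<And>e::real. e > 0 \<Longrightarrow> \<exists>N. \<forall>m\<ge>N. \<forall>n\<ge>N. hnorm H (hadd H (s m) (hscale H (-1) (s n))) < e\<rbrakk> \<Longrightarrow>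
      \<exists>l\<in>hcarrier H. (\<lambda>n. hnorm H (hadd H (s n) (hscale H (-1) l))) \<longlonglongrightarrow> 0"
begin

abbreviation "ip \<equiv> hinner H"
abbreviation diff where "diff u v \<equiv> hadd H u (hscale H (-1) v)"

lemma inner_add_right [simp]: "\<lbrakk>u \<in> hcarrier H; v \<in> hcarrier H; w \<in> hcarrier H\<rbrakk> \<Longrightarrow>
    ip w (hadd H u v) = ip w u + ip w v"
  by (metis add_closed complex_cnj_add inner_add_left inner_commute)

lemma inner_scale_right [simp]: "\<lbrakk>u \<in> hcarrier H; w \<in> hcarrier H\<rbrakk> \<Longrightarrow>
    ip w (hscale H c u) = cnj c * ip w u"
  by (metis scale_closed complex_cnj_mult inner_scale_left inner_commute)

lemma inner_self: "u \<in> hcarrier H \<Longrightarrow> ip u u = complex_of_real ((hnorm H u)\<^sup>2)"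
  using inner_commute[of u u] inner_nonneg[of u]
  by (auto simp: hnorm_def complex_eq_iff)

lemma norm_sq: "u \<in> hcarrier H \<Longrightarrow> (hnorm H u)\<^sup>2 = Re (ip u u)"
  by (simp add: inner_self)

lemma norm_nonneg [simp]: "0 \<le> hnorm H u" if "u \<in> hcarrier H"
  using inner_nonneg[OF that] by (simp add: hnorm_def)

lemma norm_sq_add: "\<lbrakk>u \<in> hcarrier H; v \<in> hcarrier H\<rbrakk> \<Longrightarrow>
    (hnorm H (hadd H u v))\<^sup>2 = (hnorm H u)\<^sup>2 + 2 * Re (ip u v) + (hnorm H v)\<^sup>2"
  using inner_commute[of u v] by (simp add: norm_sq)

lemma norm_scale: "u \<in> hcarrier H \<Longrightarrow> hnorm H (hscale H c u) = cmod c * hnorm H u"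
proof -
  assume u: "u \<in> hcarrier H"
  have "(hnorm H (hscale H c u))\<^sup>2 = (cmod c * hnorm H u)\<^sup>2"
    unfolding power_mult_distrib cmod_power2
    using u inner_self[OF u] by (simp add: norm_sq) (simp add: power2_eq_square algebra_simps)
  then show ?thesis using u by (simp add: power2_eq_iff_nonneg)
qed

lemma Cauchy_Schwarz:
  assumes u: "u \<in> hcarrier H" and v: "v \<in> hcarrier H"
  shows "cmod (ip u v) \<le> hnorm H u * hnorm H v"
proof -
  define a where "a = ip u v"
  define b where "b = (hnorm H v)\<^sup>2"
  \<comment> \<open>The scalar -t a carries the phase of \<open>a\<close>, so that a real quadratic
    in \<open>t\<close> remains.\<close>
  have *: "0 \<le> (hnorm H u)\<^sup>2 - 2 * t * (cmod a)\<^sup>2 + t\<^sup>2 * (cmod a)\<^sup>2 * b" for t :: real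
  proof -
    let ?c = "- complex_of_real t * a"
    have "0 \<le> (hnorm H (hadd H u (hscale H ?c v)))\<^sup>2" by simp
    also have "\<dots> = (hnorm H u)\<^sup>2 + 2 * Re (cnj ?c * a) + (cmod ?c * hnorm H v)\<^sup>2"
      using u v by (simp add: norm_sq_add norm_scale a_def)
    also have "Re (cnj ?c * a) = - t * (cmod a)\<^sup>2"
      by (subst cmod_power2) (simp add: power2_eq_square algebra_simps)
    also have "(cmod ?c * hnorm H v)\<^sup>2 = t\<^sup>2 * (cmod a)\<^sup>2 * b"
      by (simp add: norm_mult power_mult_distrib b_def)
    finally show ?thesis by simp
  qed
  have "(cmod a)\<^sup>2 \<le> (hnorm H u)\<^sup>2 * b"
  proof (cases "b = 0")
    case True
    have "a = 0"
    proof (rule ccontr)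
      assume "a \<noteq> 0"
      \<comment> \<open>For b = 0 the inequality is linear in t; at this t it reads 0 \<le> n - 2 (n
        + 1) with n the squared norm of u.\<close>
      then show False using *[of "((hnorm H u)\<^sup>2 + 1) / (cmod a)\<^sup>2"] True by simp
          (smt (verit) zero_le_power2)
    qed
    then show ?thesis using True by simp
  next
    case False
    then have "b > 0" by (simp add: b_def)
    then show ?thesis using *[of "1 / b"]
      by (simp add: field_simps power2_eq_square)
  qed
  then have "(cmod a)\<^sup>2 \<le> (hnorm H u * hnorm H v)\<^sup>2" by (simp add: b_def power_mult_distrib)
  then show ?thesis unfolding a_def using u v by (simp add: power2_le_iff_abs_le)
qed

lemma norm_triangle:
  assumes "u \<in> hcarrier H" "v \<in> hcarrier H"
  shows "hnorm H (hadd H u v) \<le> hnorm H u + hnorm H v"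
proof (rule power2_le_imp_le)
  have "Re (ip u v) \<le> hnorm H u * hnorm H v"
    using Cauchy_Schwarz[OF assms] complex_Re_le_cmod order_trans by blast
  then show "(hnorm H (hadd H u v))\<^sup>2 \<le> (hnorm H u + hnorm H v)\<^sup>2"
    using assms by (simp add: norm_sq_add power2_sum)
qed (use assms in auto)

lemma norm_diff_commute: "\<lbrakk>u \<in> hcarrier H; v \<in> hcarrier H\<rbrakk> \<Longrightarrow> hnorm H (diff u v) = hnorm H (diff v u)"
  unfolding hnorm_def by (simp add: algebra_simps)

lemma norm_diff_triangle:
  assumes "u \<in> hcarrier H" "v \<in> hcarrier H" "w \<in> hcarrier H"
  shows "hnorm H (diff u w) \<le> hnorm H (diff u v) + hnorm H (diff v w)"
proof -
  have "diff u w = hadd H (diff u v) (diff v w)"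
    by (rule inner_ext) (use assms in auto)
  then show ?thesis using norm_triangle[of "diff u v" "diff v w"] assms by simp
qed

lemma inner_tendsto:
  assumes "\<And>n. s n \<in> hcarrier H" "l \<in> hcarrier H" "(\<lambda>n. hnorm H (diff (s n) l)) \<longlonglongrightarrow> 0"
    and w: "w \<in> hcarrier H"
  shows "(\<lambda>n. ip (s n) w) \<longlonglongrightarrow> ip l w"
proof -
  have "(\<lambda>n. ip (s n) w - ip l w) \<longlonglongrightarrow> 0"
  proof (rule Lim_null_comparison)
    show "\<forall>\<^sub>F n in sequentially. norm (ip (s n) w - ip l w) \<le> hnorm H (diff (s n) l) * hnorm H w"
      using Cauchy_Schwarz[of "diff (s _) l" w] assms by (intro always_eventually) simp
    show "(\<lambda>n. hnorm H (diff (s n) l) * hnorm H w) \<longlonglongrightarrow> 0"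
      using tendsto_mult_right[OF assms(3), of "hnorm H w"] by simp
  qed
  then show ?thesis by (simp add: LIM_zero_iff)
qed

lemma limit_unique:
  assumes "\<And>n. s n \<in> hcarrier H" "l \<in> hcarrier H" "(\<lambda>n. hnorm H (diff (s n) l)) \<longlonglongrightarrow> 0"
    and "l' \<in> hcarrier H" "(\<lambda>n. hnorm H (diff (s n) l')) \<longlonglongrightarrow> 0"
  shows "l = l'"
  using assms by (intro inner_ext) (auto intro: LIMSEQ_unique inner_tendsto)

text \<open>V need not be closed, so \<open>p\<close> is only a limit of vectors of V, and the
  approximating sequence is returned along with it. It is a minimising sequence for the distance to
  u, Cauchy by the parallelogram law.\<close>

lemma projection:
  assumes V: "V \<subseteq> hcarrier H" "V \<noteq> {}"
    and Vadd: "\<And>u v. \<lbrakk>u \<in> V; v \<in> V\<rbrakk> \<Longrightarrow> hadd H u v \<in> V"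
    and Vscale: "\<And>c u. u \<in> V \<Longrightarrow> hscale H c u \<in> V"
    and u: "u \<in> hcarrier H"
  obtains p s where "p \<in> hcarrier H" "\<And>n::nat. s n \<in> V" "(\<lambda>n. hnorm H (diff (s n) p)) \<longlonglongrightarrow> 0"
    "\<And>v. v \<in> V \<Longrightarrow> ip u v = ip p v"
proof -
  define d where "d = (INF v\<in>V. (hnorm H (diff u v))\<^sup>2)"
  have bdd: "bdd_below ((\<lambda>v. (hnorm H (diff u v))\<^sup>2) ` V)" by (rule bdd_belowI[of _ 0]) auto
  have d_le: "d \<le> (hnorm H (diff u v))\<^sup>2" if "v \<in> V" for v
    unfolding d_def using that bdd by (rule cINF_lower[rotated])
  have "\<exists>v\<in>V. (hnorm H (diff u v))\<^sup>2 < d + 1 / real (Suc n)" for n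
    using cInf_lessD[of "(\<lambda>v. (hnorm H (diff u v))\<^sup>2) ` V" "d + 1 / real (Suc n)"] V(2)
    unfolding d_def by auto
  then obtain s where sV: "\<And>n. s n \<in> V" and s: "\<And>n. (hnorm H (diff u (s n)))\<^sup>2 < d + 1 / real (Suc n)"
    by metis
  have sH [simp]: "s n \<in> hcarrier H" for n using sV V by auto
  have par: "(hnorm H (diff (s m) (s n)))\<^sup>2 \<le> 2 / real (Suc m) + 2 / real (Suc n)" for m n
  proof -
    let ?w = "hscale H (1/2) (hadd H (s m) (s n))"
    have "?w \<in> V" using sV Vadd Vscale by simp
    then have "d \<le> (hnorm H (diff u ?w))\<^sup>2" by (rule d_le)
    moreover have "(hnorm H (diff (s m) (s n)))\<^sup>2 + 4 * (hnorm H (diff u ?w))\<^sup>2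
        = 2 * (hnorm H (diff u (s m)))\<^sup>2 + 2 * (hnorm H (diff u (s n)))\<^sup>2"
      using u by (simp add: norm_sq algebra_simps)
    ultimately show ?thesis using s[of m] s[of n] by simp
  qed
  have "\<exists>p\<in>hcarrier H. (\<lambda>n. hnorm H (diff (s n) p)) \<longlonglongrightarrow> 0"
  proof (rule complete)
    fix e :: real assume "e > 0"
    then obtain N :: nat where N: "4 / e\<^sup>2 < real N" using reals_Archimedean2 by blast
    have "hnorm H (diff (s m) (s n)) < e" if "m \<ge> N" "n \<ge> N" for m n
    proof (rule power2_less_imp_less)
      have N0: "0 < real (Suc N)" "4 / e\<^sup>2 < real (Suc N)" using N by auto
      have "2 / real (Suc k) \<le> 2 / real (Suc N)" if "k \<ge> N" for k
        using that by (simp add: frac_le)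
      then have "(hnorm H (diff (s m) (s n)))\<^sup>2 \<le> 4 / real (Suc N)"
        using par[of m n] that(1) that(2) by (smt (verit) add_divide_distrib)
      also have "\<dots> < e\<^sup>2" using N0 \<open>e > 0\<close>
        by (simp add: pos_divide_less_eq mult.commute del: of_nat_Suc)
      finally show "(hnorm H (diff (s m) (s n)))\<^sup>2 < e\<^sup>2" .
    qed (use \<open>e > 0\<close> in auto)
    then show "\<exists>N. \<forall>m\<ge>N. \<forall>n\<ge>N. hnorm H (diff (s m) (s n)) < e" by blast
  qed simp
  then obtain p where p: "p \<in> hcarrier H" and lim: "(\<lambda>n. hnorm H (diff (s n) p)) \<longlonglongrightarrow> 0" by blast
  have "ip u v = ip p v" if v: "v \<in> V" for v
  proof -
    have vH [simp]: "v \<in> hcarrier H" using v V by auto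
    \<comment> \<open>The step a/b is the optimal one along v. It lowers the squared distance by
      |a|^2/b, and the minimising sequence leaves room for at most 1/(n+1).\<close>
    have "(cmod (ip (diff u (s n)) v))\<^sup>2 \<le> (hnorm H v)\<^sup>2 * (1 / real (Suc n))" for n
    proof (cases "hnorm H v = 0")
      case True
      then show ?thesis using Cauchy_Schwarz[of "diff u (s n)" v] u by simp
    next
      case False
      define b where "b = (hnorm H v)\<^sup>2"
      define a where "a = ip (diff u (s n)) v"
      have b: "b > 0" using False by (simp add: b_def)
      let ?c = "a / complex_of_real b"
      have "d \<le> (hnorm H (diff u (hadd H (s n) (hscale H ?c v))))\<^sup>2"
        using v sV by (intro d_le Vadd Vscale)
      also have "diff u (hadd H (s n) (hscale H ?c v)) = hadd H (diff u (s n)) (hscale H (-?c) v)"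
        by (rule inner_ext) (use u in \<open>auto simp: algebra_simps\<close>)
      also have "(hnorm H \<dots>)\<^sup>2 = (hnorm H (diff u (s n)))\<^sup>2 + 2 * Re (cnj (-?c) * a) + (cmod (-?c))\<^sup>2 * b"
        using u by (subst norm_sq_add) (auto simp: norm_scale a_def b_def power_mult_distrib)
      also have "cnj (-?c) * a = complex_of_real (- (cmod a)\<^sup>2 / b)"
        using complex_norm_square[of a] by (simp add: mult.commute)
      also have "(cmod (-?c))\<^sup>2 * b = (cmod a)\<^sup>2 / b"
        using b by (simp add: norm_divide power_divide power2_eq_square)
      finally have "d \<le> (hnorm H (diff u (s n)))\<^sup>2 + 2 * (- (cmod a)\<^sup>2 / b) + (cmod a)\<^sup>2 / b"
        by (simp only: Re_complex_of_real)
      then have "(cmod a)\<^sup>2 / b \<le> 1 / real (Suc n)" using s[of n] by linarith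
      then have "(cmod a)\<^sup>2 \<le> 1 / real (Suc n) * b" using b by (simp only: pos_divide_le_eq)
      then show ?thesis unfolding a_def b_def by (simp only: mult.commute)
    qed
    then have bound: "norm ((cmod (ip (diff u (s n)) v))\<^sup>2) \<le> (hnorm H v)\<^sup>2 * (1 / real (Suc n))" for n
      by (simp only: real_norm_def abs_power2)
    have "(\<lambda>n. (hnorm H v)\<^sup>2 * (1 / real (Suc n))) \<longlonglongrightarrow> 0"
      using LIMSEQ_Suc[OF lim_1_over_n] by (rule tendsto_mult_right_zero)
    from Lim_null_comparison[OF always_eventually[OF allI[OF bound]] this]
    have "(\<lambda>n. (cmod (ip (diff u (s n)) v))\<^sup>2) \<longlonglongrightarrow> 0" .
    then have "(\<lambda>n. sqrt ((cmod (ip (diff u (s n)) v))\<^sup>2)) \<longlonglongrightarrow> sqrt 0" by (rule tendsto_real_sqrt)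
    then have "(\<lambda>n. ip u v - ip (s n) v) \<longlonglongrightarrow> 0"
      using u by - (rule tendsto_norm_zero_cancel, simp)
    moreover have "(\<lambda>n. ip u v - ip (s n) v) \<longlonglongrightarrow> ip u v - ip p v"
      by (intro tendsto_intros inner_tendsto p lim) auto
    ultimately show ?thesis using LIMSEQ_unique by fastforce
  qed
  with p sV lim show ?thesis by (rule that)
qed

section \<open>Limits and complete subspaces\<close>

lemma convergent_imp_Cauchy:
  assumes s: "\<And>n::nat. s n \<in> hcarrier H" and p: "p \<in> hcarrier H" "(\<lambda>n. hnorm H (diff (s n) p)) \<longlonglongrightarrow> 0"
    and "e > 0"
  shows "\<exists>N. \<forall>m\<ge>N. \<forall>n\<ge>N. hnorm H (diff (s m) (s n)) < e"
proof -
  obtain N where N: "\<And>n. n \<ge> N \<Longrightarrow> \<bar>hnorm H (diff (s n) p)\<bar> < e / 2"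
    using LIMSEQ_D[OF p(2), of "e / 2"] \<open>e > 0\<close> by auto
  have "hnorm H (diff (s m) (s n)) < e" if "m \<ge> N" "n \<ge> N" for m n
    using norm_diff_triangle[OF s p(1) s, of m n] norm_diff_commute[OF p(1) s, of n] N[OF that(1)] N[OF that(2)]
    by linarith
  then show ?thesis by blast
qed

text \<open>Complete subspaces are closed: the sequence is Cauchy, so it has a limit inside K, and
  limits are unique. It is applied to the functionals over A inside those over the whole
  space.\<close>

lemma limit_in_complete_subspace:
  assumes K: "hilbert K" "hcarrier K \<subseteq> hcarrier H"
    and ops: "hadd K = hadd H" "hscale K = hscale H" "hinner K = hinner H"
    and s: "\<And>n::nat. s n \<in> hcarrier K" and p: "p \<in> hcarrier H" "(\<lambda>n. hnorm H (diff (s n) p)) \<longlonglongrightarrow> 0"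
  shows "p \<in> hcarrier K"
proof -
  have norm: "hnorm K = hnorm H" by (rule ext) (simp add: hnorm_def ops)
  have sH: "s n \<in> hcarrier H" for n using s K by blast
  have "\<exists>l\<in>hcarrier K. (\<lambda>n. hnorm K (hadd K (s n) (hscale K (-1) l))) \<longlonglongrightarrow> 0"
    using convergent_imp_Cauchy[OF sH p] by (intro hilbert.complete[OF K(1) s]) (simp add: ops norm)
  then obtain l where l: "l \<in> hcarrier K" "(\<lambda>n. hnorm H (diff (s n) l)) \<longlonglongrightarrow> 0"
    by (auto simp: ops norm)
  have "p = l" by (rule limit_unique[OF sH p(1) p(2)]) (use l K in auto)
  then show ?thesis using l by simp
qed

lemma norm_tendsto:
  assumes s: "\<And>n::nat. s n \<in> hcarrier H" and p: "p \<in> hcarrier H" "(\<lambda>n. hnorm H (diff (s n) p)) \<longlonglongrightarrow> 0"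
  shows "(\<lambda>n. hnorm H (s n)) \<longlonglongrightarrow> hnorm H p"
proof -
  have *: "hnorm H u - hnorm H v \<le> hnorm H (diff u v)" if uv: "u \<in> hcarrier H" "v \<in> hcarrier H" for u v
  proof -
    have "u = hadd H (diff u v) v" by (rule inner_ext) (use uv in auto)
    then have "hnorm H u = hnorm H (hadd H (diff u v) v)" by simp
    also have "\<dots> \<le> hnorm H (diff u v) + hnorm H v" using uv by (intro norm_triangle) auto
    finally show ?thesis by simp
  qed
  have "norm (hnorm H (s n) - hnorm H p) \<le> hnorm H (diff (s n) p)" for n
    using *[OF s p(1), of n] *[OF p(1) s, of n] norm_diff_commute[OF p(1) s, of n] by simp
  from Lim_null_comparison[OF always_eventually[OF allI[OF this]] p(2)]
  show ?thesis by (simp add: LIM_zero_iff)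
qed

end

section \<open>Spaces of square integrable functionals\<close>

definition sq_int :: "'s measure \<Rightarrow> ('s \<Rightarrow> complex) set" where
  "sq_int P = {f \<in> borel_measurable P. integrable P (\<lambda>x. (cmod (f x))\<^sup>2)}"

lemma borel_measurable_cnj [measurable (raw)]:
  "f \<in> borel_measurable P \<Longrightarrow> (\<lambda>x. cnj (f x)) \<in> borel_measurable P"
  by (rule borel_measurable_continuous_on[OF continuous_on_cnj[OF continuous_on_id]])

lemma sq_int_measurable [measurable_dest]: "f \<in> sq_int P \<Longrightarrow> f \<in> borel_measurable P"
  by (simp add: sq_int_def)

lemma sq_int_integrable: "f \<in> sq_int P \<Longrightarrow> integrable P (\<lambda>x. (cmod (f x))\<^sup>2)"
  by (simp add: sq_int_def)

lemma sq_int_add: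
  assumes "f \<in> sq_int P" "g \<in> sq_int P" shows "(\<lambda>x. f x + g x) \<in> sq_int P"
proof -
  note [measurable] = sq_int_measurable[OF assms(1)] sq_int_measurable[OF assms(2)]
  have "integrable P (\<lambda>x. (cmod (f x + g x))\<^sup>2)"
  proof (rule Bochner_Integration.integrable_bound)
    show "integrable P (\<lambda>x. 2 * (cmod (f x))\<^sup>2 + 2 * (cmod (g x))\<^sup>2)"
      using assms by (simp add: sq_int_def)
    have "(cmod (a + b))\<^sup>2 \<le> 2 * (cmod a)\<^sup>2 + 2 * (cmod b)\<^sup>2" for a b :: complex
    proof -
      have "(cmod (a + b))\<^sup>2 \<le> (cmod a + cmod b)\<^sup>2" by (intro power_mono norm_triangle_ineq) auto
      also have "\<dots> \<le> 2 * (cmod a)\<^sup>2 + 2 * (cmod b)\<^sup>2"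
        using sum_squares_bound[of "cmod a" "cmod b"] by (simp add: power2_sum)
      finally show ?thesis .
    qed
    then show "AE x in P. norm ((cmod (f x + g x))\<^sup>2) \<le> norm (2 * (cmod (f x))\<^sup>2 + 2 * (cmod (g x))\<^sup>2)"
      by simp
  qed measurable
  then show ?thesis by (simp add: sq_int_def)
qed

lemma sq_int_scale: "f \<in> sq_int P \<Longrightarrow> (\<lambda>x. c * f x) \<in> sq_int P"
  by (auto simp: sq_int_def norm_mult power_mult_distrib)

lemma sq_int_diff:
  "f \<in> sq_int P \<Longrightarrow> g \<in> sq_int P \<Longrightarrow> (\<lambda>x. f x - g x) \<in> sq_int P"
  using sq_int_add[of f P "\<lambda>x. (-1) * g x"] sq_int_scale[of g P "-1"] by simp

lemma sq_int_mult_integrable: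
  assumes "f \<in> sq_int P" "g \<in> sq_int P" shows "integrable P (\<lambda>x. f x * g x)"
proof (rule Bochner_Integration.integrable_bound)
  note [measurable] = sq_int_measurable[OF assms(1)] sq_int_measurable[OF assms(2)]
  show "integrable P (\<lambda>x. (cmod (f x))\<^sup>2 + (cmod (g x))\<^sup>2)"
    using assms by (simp add: sq_int_def)
  have "cmod a * cmod b \<le> (cmod a)\<^sup>2 + (cmod b)\<^sup>2" for a b :: complex
    using sum_squares_bound[of "cmod a" "cmod b"] mult_nonneg_nonneg[OF norm_ge_zero[of a] norm_ge_zero[of b]]
    by linarith
  then show "AE x in P. norm (f x * g x) \<le> norm ((cmod (f x))\<^sup>2 + (cmod (g x))\<^sup>2)"
    by (simp add: norm_mult)
  show "(\<lambda>x. f x * g x) \<in> borel_measurable P" by measurable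
qed

lemma sq_int_cnj: "f \<in> sq_int P \<Longrightarrow> (\<lambda>x. cnj (f x)) \<in> sq_int P"
  by (auto simp: sq_int_def)

lemma sq_int_AE_cong:
  assumes "f \<in> sq_int P" "g \<in> borel_measurable P" "AE x in P. g x = f x"
  shows "g \<in> sq_int P"
proof -
  note [measurable] = sq_int_measurable[OF assms(1)] assms(2)
  have "integrable P (\<lambda>x. (cmod (g x))\<^sup>2)"
    using sq_int_integrable[OF assms(1)]
    by (rule integrable_cong_AE_imp) (use assms(3) in auto)
  then show ?thesis using assms(2) by (simp add: sq_int_def)
qed

lemma ae_class_eq_iff:
  assumes "f \<in> borel_measurable P" "g \<in> borel_measurable P"
  shows "ae_class P f = ae_class P g \<longleftrightarrow> (AE x in P. f x = g x)"
proof
  assume "ae_class P f = ae_class P g"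
  then have "f \<in> ae_class P g" using assms(1) by (auto simp: ae_class_def)
  then show "AE x in P. f x = g x" by (simp add: ae_class_def)
next
  assume eq: "AE x in P. f x = g x"
  have "(AE x in P. h x = f x) \<longleftrightarrow> (AE x in P. h x = g x)" for h
    using eq by (intro iffI) (elim AE_mp, auto)+
  then show "ae_class P f = ae_class P g" by (auto simp: ae_class_def)
qed

lemma ae_class_cong: "AE x in P. f x = g x \<Longrightarrow> ae_class P f = ae_class P g"
proof -
  assume eq: "AE x in P. f x = g x"
  have "(AE x in P. h x = f x) \<longleftrightarrow> (AE x in P. h x = g x)" for h
    using eq by (intro iffI) (elim AE_mp, auto)+
  then show "ae_class P f = ae_class P g" by (auto simp: ae_class_def)
qed

lemma rep_ae_class:
  assumes "f \<in> borel_measurable P"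
  shows "rep (ae_class P f) \<in> borel_measurable P" "AE x in P. rep (ae_class P f) x = f x"
proof -
  have "f \<in> ae_class P f" using assms by (simp add: ae_class_def)
  then have "rep (ae_class P f) \<in> ae_class P f" unfolding rep_def by (rule someI[where P = "\<lambda>g. g \<in> ae_class P f"])
  then show "rep (ae_class P f) \<in> borel_measurable P" "AE x in P. rep (ae_class P f) x = f x"
    by (auto simp: ae_class_def)
qed

lemma class_mult_ae_class:
  assumes "f \<in> borel_measurable P" "g \<in> borel_measurable P"
  shows "class_mult P (ae_class P f) (ae_class P g) = ae_class P (\<lambda>x. f x * g x)"
  unfolding class_mult_def
  by (rule ae_class_cong) (use rep_ae_class(2)[OF assms(1)] rep_ae_class(2)[OF assms(2)] in eventually_elim, simp)

lemma hadd_ae_class: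
  assumes "f \<in> borel_measurable P" "g \<in> borel_measurable P"
  shows "hadd (L2 P G) (ae_class P f) (ae_class P g) = ae_class P (\<lambda>x. f x + g x)"
  unfolding L2_def hilb.simps
  by (rule ae_class_cong) (use rep_ae_class(2)[OF assms(1)] rep_ae_class(2)[OF assms(2)] in eventually_elim, simp)

lemma hscale_ae_class:
  assumes "f \<in> borel_measurable P"
  shows "hscale (L2 P G) c (ae_class P f) = ae_class P (\<lambda>x. c * f x)"
  unfolding L2_def hilb.simps
  by (rule ae_class_cong) (use rep_ae_class(2)[OF assms(1)] in eventually_elim, simp)

lemma hinner_ae_class:
  assumes [measurable]: "f \<in> borel_measurable P" "g \<in> borel_measurable P"
  shows "hinner (L2 P G) (ae_class P f) (ae_class P g) = (\<integral>x. f x * cnj (g x) \<partial>P)"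
proof -
  note [measurable] = rep_ae_class(1)[OF assms(1)] rep_ae_class(1)[OF assms(2)]
  show ?thesis unfolding L2_def hilb.simps
    by (rule integral_cong_AE)
      (measurable, measurable, use rep_ae_class(2)[OF assms(1)] rep_ae_class(2)[OF assms(2)] in eventually_elim, simp)
qed

lemma hnorm_ae_class:
  assumes "f \<in> borel_measurable P"
  shows "hnorm (L2 P G) (ae_class P f) = sqrt (\<integral>x. (cmod (f x))\<^sup>2 \<partial>P)"
  unfolding hnorm_def hinner_ae_class[OF assms assms]
  by (simp add: complex_norm_square[symmetric] del: of_real_power)

lemma carrier_L2: "subalgebra P G \<Longrightarrow>
    hcarrier (L2 P G) = {ae_class P f | f. f \<in> borel_measurable G \<and> f \<in> sq_int P}"
  unfolding L2_def sq_int_def hilb.simps using measurable_from_subalg by blast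

lemma L2_cases:
  assumes "u \<in> hcarrier (L2 P G)" "subalgebra P G"
  obtains f where "u = ae_class P f" "f \<in> borel_measurable G" "f \<in> sq_int P"
  using assms by (auto simp: carrier_L2)

lemma L2_memI: "\<lbrakk>subalgebra P G; f \<in> borel_measurable G; f \<in> sq_int P\<rbrakk> \<Longrightarrow> ae_class P f \<in> hcarrier (L2 P G)"
  by (auto simp: carrier_L2)

text \<open>Riesz-Fischer with control of measurability: the limit function is defined at every
  point by \<open>lim\<close> along a subsequence, so it is measurable for the smaller field
  \<open>G\<close> without any completion by null sets.\<close>

lemma complete_L2_functions:
  fixes f :: "nat \<Rightarrow> 's \<Rightarrow> complex"
  assumes "finite_measure P" "subalgebra P G"
    and fG: "\<And>n. f n \<in> borel_measurable G" and f2: "\<And>n. f n \<in> sq_int P"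
    and Cauchy: "\<And>e. e > 0 \<Longrightarrow> \<exists>N. \<forall>m\<ge>N. \<forall>n\<ge>N. (\<integral>x. (cmod (f m x - f n x))\<^sup>2 \<partial>P) < e"
  obtains g where "g \<in> borel_measurable G" "g \<in> sq_int P"
    "(\<lambda>n. \<integral>x. (cmod (f n x - g x))\<^sup>2 \<partial>P) \<longlonglongrightarrow> 0"
proof -
  interpret finite_measure P by fact
  have fm [measurable]: "f n \<in> borel_measurable P" for n using f2 by (rule sq_int_measurable)
  have dint: "integrable P (\<lambda>x. (cmod (f m x - f n x))\<^sup>2)" for m n
    using sq_int_diff[OF f2 f2] by (rule sq_int_integrable)
  have "\<exists>N\<ge>k. \<forall>m\<ge>N. \<forall>n\<ge>N. (\<integral>x. (cmod (f m x - f n x))\<^sup>2 \<partial>P) < (1/4)^k" for k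
  proof -
    obtain N where N: "\<forall>m\<ge>N. \<forall>n\<ge>N. (\<integral>x. (cmod (f m x - f n x))\<^sup>2 \<partial>P) < (1/4)^k"
      using Cauchy[of "(1/4)^k"] by auto
    then show ?thesis by (intro exI[of _ "max N k"]) auto
  qed
  then obtain N where Nk: "\<And>k. N k \<ge> k"
    and N: "\<And>k m n. m \<ge> N k \<Longrightarrow> n \<ge> N k \<Longrightarrow> (\<integral>x. (cmod (f m x - f n x))\<^sup>2 \<partial>P) < (1/4)^k"
    by metis
  \<comment> \<open>Partial sums give both \<open>N k \<le> r k\<close> and
    \<open>N k \<le> r (Suc k)\<close> whether or not N is monotone, so consecutive terms of the
    subsequence are within 4^-k in squared norm.\<close>
  define r where "r k = sum N {..k}" for k
  have rN: "N k \<le> r k" for k unfolding r_def by (rule member_le_sum) auto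
  have rNS: "N k \<le> r (Suc k)" for k unfolding r_def by (rule member_le_sum) auto
  define d where "d k x = f (r (Suc k)) x - f (r k) x" for k x
  have [measurable]: "d k \<in> borel_measurable P" for k unfolding d_def by measurable
  have dk: "(\<integral>\<^sup>+x. ennreal (cmod (d k x)) \<partial>P) \<le> ennreal ((1 + measure P (space P)) * (1/2)^k)" for k
  proof -
    have i2: "integrable P (\<lambda>x. 2^k * (cmod (d k x))\<^sup>2 + (1/2)^k)"
      using dint unfolding d_def by simp
    \<comment> \<open>The weights 2^k and 2^-k turn the bound 4^-k on the squared norm into a bound
      of order 2^-k on the L1 norm, which is summable.\<close>
    have pt: "t \<le> 2^k * t\<^sup>2 + (1/2)^k" for t :: real
    proof -
      have "0 \<le> 2^k * (t - (1/2)^k)\<^sup>2" by simp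
      also have "\<dots> = 2^k * t\<^sup>2 - 2 * t * (2^k * (1/2)^k) + (2^k * (1/2)^k) * (1/2)^k"
        by (simp add: power2_eq_square algebra_simps)
      also have "(2::real)^k * (1/2)^k = 1" by (simp add: power_mult_distrib[symmetric])
      finally have "2 * t \<le> 2^k * t\<^sup>2 + (1/2)^k" by simp
      moreover have "0 \<le> 2^k * t\<^sup>2 + (1/2::real)^k" by simp
      ultimately show ?thesis by linarith
    qed
    have "(\<integral>\<^sup>+x. ennreal (cmod (d k x)) \<partial>P) \<le> (\<integral>\<^sup>+x. ennreal (2^k * (cmod (d k x))\<^sup>2 + (1/2)^k) \<partial>P)"
      by (intro nn_integral_mono ennreal_leI pt)
    also have "\<dots> = ennreal (\<integral>x. (2^k * (cmod (d k x))\<^sup>2 + (1/2)^k) \<partial>P)"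
      by (rule nn_integral_eq_integral[OF i2]) simp
    also have "(\<integral>x. (2^k * (cmod (d k x))\<^sup>2 + (1/2)^k) \<partial>P)
        = 2^k * (\<integral>x. (cmod (d k x))\<^sup>2 \<partial>P) + measure P (space P) * (1/2)^k"
      using dint by (simp add: d_def)
    also have "\<dots> \<le> 2^k * (1/4)^k + measure P (space P) * (1/2)^k"
      using N[OF rNS rN, of k] by (intro add_mono mult_left_mono) (auto simp: d_def)
    also have "(2::real)^k * (1/4)^k = (1/2)^k" by (simp add: power_mult_distrib[symmetric])
    also have "(1/2)^k + measure P (space P) * (1/2)^k = (1 + measure P (space P)) * (1/2)^k"
      by (simp add: algebra_simps)
    finally show ?thesis by (simp add: ennreal_leI)
  qed
  have "(\<integral>\<^sup>+x. (\<Sum>k. ennreal (cmod (d k x))) \<partial>P) = (\<Sum>k. \<integral>\<^sup>+x. ennreal (cmod (d k x)) \<partial>P)"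
    by (rule nn_integral_suminf) measurable
  also have "\<dots> \<le> (\<Sum>k. ennreal ((1 + measure P (space P)) * (1/2)^k))"
    by (intro suminf_le dk summableI)
  also have "\<dots> = ennreal (\<Sum>k. (1 + measure P (space P)) * (1/2)^k)"
    by (rule suminf_ennreal2) (auto intro!: summable_mult)
  also have "\<dots> < \<infinity>" by simp
  finally have fin: "(\<integral>\<^sup>+x. (\<Sum>k. ennreal (cmod (d k x))) \<partial>P) \<noteq> \<infinity>" by simp
  have "AE x in P. (\<Sum>k. ennreal (cmod (d k x))) \<noteq> \<infinity>"
    by (rule nn_integral_PInf_AE[OF _ fin]) measurable
  then have conv: "AE x in P. convergent (\<lambda>k. f (r k) x)"
  proof eventually_elim
    case (elim x)
    then have "summable (\<lambda>k. cmod (d k x))"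
      by (intro summable_suminf_not_top) auto
    then have "summable (\<lambda>k. d k x)" by (rule summable_norm_cancel)
    then have "convergent (\<lambda>n. \<Sum>k<n. d k x)" by (simp add: summable_iff_convergent)
    also have "(\<lambda>n. \<Sum>k<n. d k x) = (\<lambda>n. f (r n) x - f (r 0) x)"
      unfolding d_def by (intro ext) (rule sum_lessThan_telescope)
    finally show ?case
      by (auto simp: convergent_diff_const_right_iff)
  qed
  define g where "g x = lim (\<lambda>k. f (r k) x)" for x
  have gG: "g \<in> borel_measurable G" unfolding g_def using fG by (intro borel_measurable_lim_metric) auto
  then have [measurable]: "g \<in> borel_measurable P" using measurable_from_subalg[OF assms(2)] by blast
  have glim: "AE x in P. (\<lambda>k. f (r k) x) \<longlonglongrightarrow> g x"
    using conv unfolding g_def by eventually_elim (simp add: convergent_LIMSEQ_iff)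
  \<comment> \<open>Fatou along the subsequence. The bound is for every late \<open>f n\<close>, not
    only for members of the subsequence, so the whole sequence converges.\<close>
  have bound: "(\<integral>\<^sup>+x. ennreal ((cmod (f n x - g x))\<^sup>2) \<partial>P) \<le> ennreal ((1/4)^k)" if "n \<ge> N k" for n k
  proof -
    have "(\<integral>\<^sup>+x. ennreal ((cmod (f n x - g x))\<^sup>2) \<partial>P)
        = (\<integral>\<^sup>+x. liminf (\<lambda>j. ennreal ((cmod (f n x - f (r j) x))\<^sup>2)) \<partial>P)"
    proof (rule nn_integral_cong_AE, use glim in eventually_elim)
      case (elim x)
      have "(\<lambda>j. ennreal ((cmod (f n x - f (r j) x))\<^sup>2)) \<longlonglongrightarrow> ennreal ((cmod (f n x - g x))\<^sup>2)"
        by (intro tendsto_intros elim)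
      from lim_imp_Liminf[OF _ this] show ?case by simp
    qed
    also have "\<dots> \<le> liminf (\<lambda>j. \<integral>\<^sup>+x. ennreal ((cmod (f n x - f (r j) x))\<^sup>2) \<partial>P)"
      by (rule nn_integral_liminf) measurable
    also have "\<dots> \<le> liminf (\<lambda>j. ennreal ((1/4)^k))"
    proof (rule Liminf_mono, rule eventually_sequentiallyI[of "N k"])
      fix j assume "N k \<le> j"
      then have "N k \<le> r j" using Nk[of j] rN[of j] by linarith
      then show "(\<integral>\<^sup>+x. ennreal ((cmod (f n x - f (r j) x))\<^sup>2) \<partial>P) \<le> ennreal ((1/4)^k)"
        using N[OF that, of "r j"] by (subst nn_integral_eq_integral[OF dint]) (auto intro!: ennreal_leI)
    qed
    finally show ?thesis by (simp add: Liminf_const)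
  qed
  have int: "integrable P (\<lambda>x. (cmod (f n x - g x))\<^sup>2)" if "n \<ge> N k" for n k
    using bound[OF that] by (intro integrableI_bounded) (auto simp: less_top[symmetric] top_unique)
  have "(\<lambda>x. f (N 0) x - g x) \<in> sq_int P" using int[of 0 "N 0"] by (simp add: sq_int_def)
  from sq_int_diff[OF f2[of "N 0"] this] have g2: "g \<in> sq_int P" by simp
  have "(\<lambda>n. \<integral>x. (cmod (f n x - g x))\<^sup>2 \<partial>P) \<longlonglongrightarrow> 0"
  proof (rule LIMSEQ_I)
    fix e :: real assume "e > 0"
    obtain k where k: "(1/4::real)^k < e" using real_arch_pow_inv[OF \<open>e > 0\<close>, of "1/4"] by auto
    have "norm ((\<integral>x. (cmod (f n x - g x))\<^sup>2 \<partial>P) - 0) < e" if "n \<ge> N k" for n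
    proof -
      have "ennreal (\<integral>x. (cmod (f n x - g x))\<^sup>2 \<partial>P) \<le> ennreal ((1/4)^k)"
        using bound[OF that] by (subst (asm) nn_integral_eq_integral[OF int[OF that]]) auto
      then show ?thesis using k by simp
    qed
    then show "\<exists>no. \<forall>n\<ge>no. norm ((\<integral>x. (cmod (f n x - g x))\<^sup>2 \<partial>P) - 0) < e" by blast
  qed
  with gG g2 show ?thesis by (rule that)
qed

lemma hilbert_L2:
  assumes "finite_measure P" and sub: "subalgebra P G"
  shows "hilbert (L2 P G)"
proof -
  interpret finite_measure P by fact
  note cases = L2_cases[OF _ sub]
  let ?H = "L2 P G"
  have add: "hadd ?H u v \<in> hcarrier ?H" if "u \<in> hcarrier ?H" "v \<in> hcarrier ?H" for u v
    using that by (elim cases) (auto simp: hadd_ae_class sq_int_measurable intro!: L2_memI[OF sub] sq_int_add)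
  have scale: "hscale ?H c u \<in> hcarrier ?H" if "u \<in> hcarrier ?H" for u c
    using that by (elim cases) (auto simp: hscale_ae_class sq_int_measurable intro!: L2_memI[OF sub] sq_int_scale)
  have inner: "hinner ?H (ae_class P f) (ae_class P g) = (\<integral>x. f x * cnj (g x) \<partial>P)"
    if "f \<in> sq_int P" "g \<in> sq_int P" for f g
    using that by (intro hinner_ae_class sq_int_measurable)
  show ?thesis
  proof
    have "ae_class P (\<lambda>_. 0) \<in> hcarrier ?H" by (rule L2_memI[OF sub]) (auto simp: sq_int_def)
    then show "hcarrier ?H \<noteq> {}" by blast
  next
    fix u v w assume "u \<in> hcarrier ?H" "v \<in> hcarrier ?H" "w \<in> hcarrier ?H"
    then show "hinner ?H (hadd ?H u v) w = hinner ?H u w + hinner ?H v w"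
    proof (elim cases, goal_cases)
      case (1 f g h)
      then show ?case
        using sq_int_mult_integrable[OF 1(3) sq_int_cnj[OF 1(9)]] sq_int_mult_integrable[OF 1(6) sq_int_cnj[OF 1(9)]]
        by (simp add: hadd_ae_class sq_int_measurable inner sq_int_add distrib_right)
    qed
  next
    fix u w c assume "u \<in> hcarrier ?H" "w \<in> hcarrier ?H"
    then show "hinner ?H (hscale ?H c u) w = c * hinner ?H u w"
      by (elim cases) (simp add: hscale_ae_class sq_int_measurable inner sq_int_scale mult.assoc)
  next
    fix u v assume "u \<in> hcarrier ?H" "v \<in> hcarrier ?H"
    then show "hinner ?H v u = cnj (hinner ?H u v)"
    proof (elim cases)
      fix f g assume "u = ae_class P f" "f \<in> sq_int P" "v = ae_class P g" "g \<in> sq_int P"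
      then show ?thesis using Bochner_Integration.integral_cnj[of P "\<lambda>x. f x * cnj (g x)"] by (simp add: inner mult.commute)
    qed
  next
    fix u assume "u \<in> hcarrier ?H"
    then show "0 \<le> Re (hinner ?H u u)"
      by (elim cases) (simp add: inner complex_norm_square[symmetric] del: of_real_power)
  next
    fix u v assume uv: "u \<in> hcarrier ?H" "v \<in> hcarrier ?H"
      and eq: "\<And>w. w \<in> hcarrier ?H \<Longrightarrow> hinner ?H u w = hinner ?H v w"
    from uv show "u = v"
    proof (elim cases)
      fix f g assume u: "u = ae_class P f" "f \<in> borel_measurable G" "f \<in> sq_int P"
        and v: "v = ae_class P g" "g \<in> borel_measurable G" "g \<in> sq_int P"
      define d where "d x = f x - g x" for x
      have d: "d \<in> sq_int P" "d \<in> borel_measurable G"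
        using u v unfolding d_def by (auto intro: sq_int_diff)
      have "ae_class P d \<in> hcarrier ?H" using d by (intro L2_memI[OF sub])
      from eq[OF this] have "(\<integral>x. f x * cnj (d x) \<partial>P) = (\<integral>x. g x * cnj (d x) \<partial>P)"
        using u v d by (simp only: inner)
      moreover have "(\<integral>x. f x * cnj (d x) - g x * cnj (d x) \<partial>P)
          = (\<integral>x. f x * cnj (d x) \<partial>P) - (\<integral>x. g x * cnj (d x) \<partial>P)"
        by (intro Bochner_Integration.integral_diff sq_int_mult_integrable u v sq_int_cnj d)
      moreover have "f x * cnj (d x) - g x * cnj (d x) = complex_of_real ((cmod (d x))\<^sup>2)" for x
        unfolding complex_norm_square by (simp add: d_def algebra_simps)
      ultimately have "(\<integral>x. (cmod (d x))\<^sup>2 \<partial>P) = 0" by (simp del: of_real_power)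
      then have "AE x in P. (cmod (d x))\<^sup>2 = 0"
        using integral_nonneg_eq_0_iff_AE[OF sq_int_integrable[OF d(1)]] by simp
      then have "AE x in P. f x = g x" by (simp add: d_def)
      then show "u = v" unfolding u v by (intro ae_class_cong) simp
    qed
  next
    fix s :: "nat \<Rightarrow> ('a \<Rightarrow> complex) set" assume s: "\<And>n. s n \<in> hcarrier ?H"
      and C: "\<And>e::real. e > 0 \<Longrightarrow> \<exists>N. \<forall>m\<ge>N. \<forall>n\<ge>N. hnorm ?H (hadd ?H (s m) (hscale ?H (-1) (s n))) < e"
    have "\<exists>f. s n = ae_class P f \<and> f \<in> borel_measurable G \<and> f \<in> sq_int P" for n
      using s[of n] by (elim cases) auto
    then obtain f where f: "\<And>n. s n = ae_class P (f n)" "\<And>n. f n \<in> borel_measurable G" "\<And>n. f n \<in> sq_int P"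
      by metis
    have hd: "hnorm ?H (hadd ?H (ae_class P a) (hscale ?H (-1) (ae_class P b))) = sqrt (\<integral>x. (cmod (a x - b x))\<^sup>2 \<partial>P)"
      if "a \<in> sq_int P" "b \<in> sq_int P" for a b
      using that by (simp add: hscale_ae_class hadd_ae_class hnorm_ae_class sq_int_measurable sq_int_scale)
    obtain g where g: "g \<in> borel_measurable G" "g \<in> sq_int P"
      and lim: "(\<lambda>n. \<integral>x. (cmod (f n x - g x))\<^sup>2 \<partial>P) \<longlonglongrightarrow> 0"
    proof (rule complete_L2_functions[OF assms, of f])
      fix e :: real assume "e > 0"
      then have "sqrt e > 0" by simp
      from C[OF this] show "\<exists>N. \<forall>m\<ge>N. \<forall>n\<ge>N. (\<integral>x. (cmod (f m x - f n x))\<^sup>2 \<partial>P) < e"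
        by (simp add: f hd)
    qed (use f in auto)
    from tendsto_real_sqrt[OF lim]
    show "\<exists>l\<in>hcarrier ?H. (\<lambda>n. hnorm ?H (hadd ?H (s n) (hscale ?H (-1) l))) \<longlonglongrightarrow> 0"
      using g by (intro bexI[of _ "ae_class P g"] L2_memI[OF sub]) (auto simp: f hd)
  qed (fact add scale)+
qed

section \<open>Totality of exponentials\<close>

text \<open>Leaving out x = 0 makes the hypothesis stable under the induction: after division by x,
  nothing is known about the shifted series at 0.\<close>

lemma powser_zero_coeff:
  fixes a :: "nat \<Rightarrow> real"
  assumes "\<And>x. x \<noteq> 0 \<Longrightarrow> (\<lambda>n. a n * x ^ n) sums 0"
  shows "a n = 0"
  using assms
proof (induction n arbitrary: a)
  case 0
  have "((\<lambda>_. 0) \<longlongrightarrow> a 0) (at (0::real))"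
    by (rule powser_limit_0_strong[where s = 1 and a = a]) (use 0 in auto)
  then show ?case by (simp add: tendsto_const_iff)
next
  case (Suc n)
  have a0: "a 0 = 0"
  proof -
    have "((\<lambda>_. 0) \<longlongrightarrow> a 0) (at (0::real))"
      by (rule powser_limit_0_strong[where s = 1 and a = a]) (use Suc.prems in auto)
    then show ?thesis by (simp add: tendsto_const_iff)
  qed
  show ?case
  proof (rule Suc.IH)
    fix x :: real assume x: "x \<noteq> 0"
    have "(\<lambda>n. a (Suc n) * x ^ Suc n) sums 0"
      using Suc.prems[OF x] a0 by (subst sums_Suc_iff) simp
    then have "(\<lambda>n. (1 / x) * (a (Suc n) * x ^ Suc n)) sums (1 / x * 0)" by (rule sums_mult)
    then show "(\<lambda>n. a (Suc n) * x ^ n) sums 0" using x by simp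
  qed
qed

text \<open>Expresses the law of Y under the probability measure with density g/m through integrals
  over P, the form in which Levy uniqueness can be applied to a weight.\<close>

lemma density_distr_facts:
  fixes g :: "'s \<Rightarrow> real"
  assumes "finite_measure P" and g: "integrable P g" "\<And>x. 0 \<le> g x" and m: "(\<integral>x. g x \<partial>P) = m" "m > 0"
    and Y [measurable]: "Y \<in> borel_measurable P"
  defines "D \<equiv> distr (density P (\<lambda>x. ennreal (g x / m))) borel Y"
  shows "real_distribution D"
    and "char D t = (\<integral>x. complex_of_real (g x) * iexp (t * Y x) \<partial>P) / m"
    and "B \<in> sets borel \<Longrightarrow> measure D B = (\<integral>x. g x * indicator B (Y x) \<partial>P) / m"
proof -
  have [measurable]: "g \<in> borel_measurable P" using g by auto
  define \<mu> where "\<mu> = density P (\<lambda>x. ennreal (g x / m))"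
  have Y\<mu> [measurable]: "Y \<in> borel_measurable \<mu>" by (simp add: \<mu>_def)
  have gi: "integrable P (\<lambda>x. g x / m)" using g by simp
  have "emeasure \<mu> (space \<mu>) = (\<integral>\<^sup>+x. ennreal (g x / m) \<partial>P)"
    unfolding \<mu>_def by (subst emeasure_density) (auto intro!: nn_integral_cong)
  also have "\<dots> = ennreal (\<integral>x. g x / m \<partial>P)"
    using g m by (intro nn_integral_eq_integral gi) auto
  also have "\<dots> = 1" using m by simp
  finally have "prob_space \<mu>" by (rule prob_spaceI)
  then interpret \<mu>: prob_space \<mu> .
  show "real_distribution D" unfolding D_def \<mu>_def[symmetric] by (rule \<mu>.real_distribution_distr) (rule Y\<mu>)
  have "char D t = (\<integral>x. iexp (t * Y x) \<partial>\<mu>)"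
    unfolding D_def \<mu>_def[symmetric] char_def by (subst integral_distr) auto
  also have "\<dots> = (\<integral>x. (g x / m) *\<^sub>R iexp (t * Y x) \<partial>P)"
    unfolding \<mu>_def using g m by (subst integral_density) auto
  also have "\<dots> = (\<integral>x. complex_of_real (g x) * iexp (t * Y x) / m \<partial>P)"
    by (rule Bochner_Integration.integral_cong) (auto simp: scaleR_conv_of_real)
  finally show "char D t = (\<integral>x. complex_of_real (g x) * iexp (t * Y x) \<partial>P) / m" by simp
  assume [measurable]: "B \<in> sets borel"
  have "measure D B = measure \<mu> (Y -` B \<inter> space \<mu>)"
    unfolding D_def \<mu>_def[symmetric] by (subst measure_distr) auto
  also have "\<dots> = (\<integral>x. indicator (Y -` B \<inter> space \<mu>) x \<partial>\<mu>)" by simp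
  also have "\<dots> = (\<integral>x. (g x / m) *\<^sub>R indicator (Y -` B \<inter> space \<mu>) x \<partial>P)"
    unfolding \<mu>_def using g m by (subst integral_density) auto
  also have "\<dots> = (\<integral>x. g x * indicator B (Y x) / m \<partial>P)"
    by (rule Bochner_Integration.integral_cong) (auto simp: \<mu>_def indicator_def)
  finally show "measure D B = (\<integral>x. g x * indicator B (Y x) \<partial>P) / m" by simp
qed

text \<open>The positive and the negative part of g, divided by their common mass, give Y the same
  characteristic function, hence the same law. That the masses agree is the case t = 0 of
  \<open>c\<close>.\<close>

lemma Fourier_zero_imp_zero:
  fixes g :: "'s \<Rightarrow> real"
  assumes fin: "finite_measure P" and g: "integrable P g" and Y [measurable]: "Y \<in> borel_measurable P"
    and c: "\<And>t. (\<integral>x. g x * cos (t * Y x) \<partial>P) = 0" and s: "\<And>t. (\<integral>x. g x * sin (t * Y x) \<partial>P) = 0"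
    and B [measurable]: "B \<in> sets borel"
  shows "(\<integral>x. g x * indicator B (Y x) \<partial>P) = 0"
proof -
  have [measurable]: "g \<in> borel_measurable P" using g by auto
  define p q where "p x = max 0 (g x)" and "q x = max 0 (- g x)" for x
  have gpq: "g x = p x - q x" for x by (auto simp: p_def q_def)
  have [measurable]: "p \<in> borel_measurable P" "q \<in> borel_measurable P" unfolding p_def q_def by measurable
  have pi: "integrable P p" and qi: "integrable P q"
    unfolding p_def q_def using g by (auto intro: integrable_max)
  have p0: "0 \<le> p x" and q0: "0 \<le> q x" for x by (auto simp: p_def q_def)
  define m where "m = (\<integral>x. p x \<partial>P)"
  have mq: "m = (\<integral>x. q x \<partial>P)" using c[of 0] pi qi by (simp add: m_def gpq)
  have m0: "m \<ge> 0" unfolding m_def using p0 by (intro integral_nonneg_AE) auto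
  show ?thesis
  proof (cases "m = 0")
    case True
    then have "AE x in P. p x = 0" "AE x in P. q x = 0"
      using integral_nonneg_eq_0_iff_AE[OF pi] integral_nonneg_eq_0_iff_AE[OF qi] p0 q0 m_def mq by auto
    then have "AE x in P. g x * indicator B (Y x) = 0" by eventually_elim (simp add: gpq)
    then show ?thesis by (rule integral_eq_zero_AE)
  next
    case False
    then have m: "m > 0" using m0 by simp
    note fp = density_distr_facts[OF fin pi p0 m_def[symmetric] m Y]
    note fq = density_distr_facts[OF fin qi q0 mq[symmetric] m Y]
    have int: "integrable P (\<lambda>x. complex_of_real (f x) * iexp (t * Y x))" if "integrable P f" for f t
    proof (rule Bochner_Integration.integrable_bound[OF that])
      note [measurable] = borel_measurable_integrable[OF that]
      show "(\<lambda>x. complex_of_real (f x) * iexp (t * Y x)) \<in> borel_measurable P" by measurable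
    qed (simp add: norm_mult del: of_real_mult)
    have "(\<integral>x. complex_of_real (p x) * iexp (t * Y x) \<partial>P) = (\<integral>x. complex_of_real (q x) * iexp (t * Y x) \<partial>P)" for t
    proof -
      have "(\<integral>x. complex_of_real (p x) * iexp (t * Y x) \<partial>P) - (\<integral>x. complex_of_real (q x) * iexp (t * Y x) \<partial>P)
          = (\<integral>x. complex_of_real (g x) * iexp (t * Y x) \<partial>P)"
        by (subst Bochner_Integration.integral_diff[symmetric, OF int[OF pi] int[OF qi]])
          (simp add: gpq algebra_simps)
      also have "\<dots> = 0"
      proof (rule complex_eqI)
        have eq: "Re (complex_of_real (g x) * iexp (t * Y x)) = g x * cos (t * Y x)" for x by (simp add: Re_exp)
        show "Re (\<integral>x. complex_of_real (g x) * iexp (t * Y x) \<partial>P) = Re 0"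
          using c[of t] by (subst integral_Re[OF int[OF g], symmetric]) (simp only: eq zero_complex.sel)
        have eq: "Im (complex_of_real (g x) * iexp (t * Y x)) = g x * sin (t * Y x)" for x by (simp add: Im_exp)
        show "Im (\<integral>x. complex_of_real (g x) * iexp (t * Y x) \<partial>P) = Im 0"
          using s[of t] by (subst integral_Im[OF int[OF g], symmetric]) (simp only: eq zero_complex.sel)
      qed
      finally show ?thesis by simp
    qed
    then have "distr (density P (\<lambda>x. ennreal (p x / m))) borel Y = distr (density P (\<lambda>x. ennreal (q x / m))) borel Y"
      by (intro Levy_uniqueness fp(1) fq(1) ext) (simp add: fp(2) fq(2))
    then have "(\<integral>x. p x * indicator B (Y x) \<partial>P) = (\<integral>x. q x * indicator B (Y x) \<partial>P)"
      using fp(3)[OF B] fq(3)[OF B] m by simp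
    moreover have "integrable P (\<lambda>x. f x * indicator B (Y x))" if "integrable P f" for f :: "'s \<Rightarrow> real"
      using that by (rule Bochner_Integration.integrable_bound)
        (auto simp: indicator_def intro!: borel_measurable_times borel_measurable_integrable[OF that] measurable_compose[OF Y])
    ultimately show ?thesis using pi qi by (simp add: gpq left_diff_distrib)
  qed
qed

text \<open>Closure under linear combinations is demanded only up to null sets, because white noise
  is linear only almost surely, and the Poisson integrals are linear only on finite
  configurations.\<close>

locale exponential_family =
  fixes P :: "'s measure" and \<Y> :: "('s \<Rightarrow> real) set"
  assumes fin: "finite_measure P" and ne: "\<Y> \<noteq> {}"
    and meas: "Y \<in> \<Y> \<Longrightarrow> Y \<in> borel_measurable P"
    and exp_int: "Y \<in> \<Y> \<Longrightarrow> integrable P (\<lambda>x. exp (Y x))"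
    and comb: "\<lbrakk>Y \<in> \<Y>; Z \<in> \<Y>\<rbrakk> \<Longrightarrow> \<exists>X\<in>\<Y>. AE x in P. X x = a * Y x + b * Z x"
begin

lemma exp_mult_int:
  assumes "Y \<in> \<Y>" shows "integrable P (\<lambda>x. exp (c * Y x))"
proof -
  obtain X where X: "X \<in> \<Y>" "AE x in P. X x = c * Y x + 0 * Y x" using comb[OF assms assms] by blast
  note [measurable] = meas[OF X(1)] meas[OF assms]
  show ?thesis using exp_int[OF X(1)] by (rule integrable_cong_AE_imp) (use X(2) in auto)
qed

text \<open>Provides the dominating function for the exponential series: |a| b \<le> a^2 + b^2 uses
  the square integrability of u, and e^{2c|y|} \<le> e^{2cy} + e^{-2cy} uses that both signs of Y
  have exponential moments.\<close>

lemma abs_exp_int: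
  assumes Y: "Y \<in> \<Y>" and u [measurable]: "u \<in> borel_measurable P" "integrable P (\<lambda>x. (u x)\<^sup>2)"
  shows "integrable P (\<lambda>x. \<bar>u x\<bar> * exp (c * \<bar>Y x\<bar>))"
proof -
  note [measurable] = meas[OF Y]
  have int: "integrable P (\<lambda>x. (u x)\<^sup>2 + (exp (2 * c * Y x) + exp (- 2 * c * Y x)))"
    using u exp_mult_int[OF Y, of "2 * c"] exp_mult_int[OF Y, of "- 2 * c"] by simp
  have "\<bar>a\<bar> * exp (c * \<bar>y\<bar>) \<le> a\<^sup>2 + (exp (2 * c * y) + exp (- 2 * c * y))" for a y :: real
  proof -
    have "0 \<le> (\<bar>a\<bar> - exp (c * \<bar>y\<bar>))\<^sup>2" by simp
    then have "2 * (\<bar>a\<bar> * exp (c * \<bar>y\<bar>)) \<le> a\<^sup>2 + exp (2 * (c * \<bar>y\<bar>))"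
      by (simp add: power2_eq_square algebra_simps flip: exp_add)
    moreover have "exp (2 * (c * \<bar>y\<bar>)) \<le> exp (2 * c * y) + exp (- 2 * c * y)"
      by (cases "y \<ge> 0") (auto simp: less_imp_le add_increasing add_increasing2)
    moreover have "0 \<le> \<bar>a\<bar> * exp (c * \<bar>y\<bar>)" by simp
    ultimately show ?thesis by linarith
  qed
  then have "AE x in P. norm (\<bar>u x\<bar> * exp (c * \<bar>Y x\<bar>)) \<le> norm ((u x)\<^sup>2 + (exp (2 * c * Y x) + exp (- 2 * c * Y x)))"
    by (intro AE_I2) (simp add: add_nonneg_nonneg)
  then show ?thesis by (rule Bochner_Integration.integrable_bound[OF int, rotated]) measurable
qed

text \<open>E(u e^{zY}) is an entire function of the complex variable z with the moments of Y
  weighted by u as coefficients; its partial sums are dominated by |u| e^{|z||Y|}.\<close>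

lemma exp_power_series:
  assumes Y: "Y \<in> \<Y>" and u [measurable]: "u \<in> borel_measurable P" "integrable P (\<lambda>x. (u x)\<^sup>2)"
  shows "(\<lambda>n. complex_of_real ((\<integral>x. u x * Y x ^ n \<partial>P) / fact n) * z ^ n) sums
    (\<integral>x. complex_of_real (u x) * exp (z * complex_of_real (Y x)) \<partial>P)"
proof -
  note [measurable] = meas[OF Y]
  define c where "c = cmod z + 1"
  let ?t = "\<lambda>n x. complex_of_real (u x) * ((z * complex_of_real (Y x)) ^ n /\<^sub>R fact n)"
  have bound: "(\<Sum>n<N. cmod (w ^ n /\<^sub>R fact n)) \<le> exp (cmod w)" for w :: complex and N
  proof -
    have "(\<Sum>n<N. cmod w ^ n /\<^sub>R fact n) \<le> exp (cmod w)"
      using exp_converges[of "cmod w"] by (intro sum_le_suminf[OF sums_summable, THEN order_trans])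
        (auto simp: sums_iff exp_def)
    then show ?thesis by (simp add: norm_power)
  qed
  have powint: "integrable P (\<lambda>x. u x * Y x ^ n)" for n
  proof (rule Bochner_Integration.integrable_bound)
    show "integrable P (\<lambda>x. fact n * (\<bar>u x\<bar> * exp (1 * \<bar>Y x\<bar>)))"
      using abs_exp_int[OF Y u] by (intro integrable_mult_right)
    have "\<bar>y\<bar> ^ n \<le> fact n * exp \<bar>y\<bar>" for y :: real
    proof -
      have "cmod (complex_of_real y ^ n /\<^sub>R fact n) \<le> (\<Sum>k<Suc n. cmod (complex_of_real y ^ k /\<^sub>R fact k))"
        by (intro member_le_sum) auto
      also have "\<dots> \<le> exp \<bar>y\<bar>" using bound[where N = "Suc n" and w = "complex_of_real y"] by (simp only: norm_of_real)
      finally show ?thesis by (simp add: norm_power field_simps)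
    qed
    then have "\<bar>a\<bar> * \<bar>y\<bar> ^ n \<le> fact n * (\<bar>a\<bar> * exp \<bar>y\<bar>)" for a y :: real
      using mult_left_mono[of "\<bar>y\<bar> ^ n" "fact n * exp \<bar>y\<bar>" "\<bar>a\<bar>"] by (simp add: algebra_simps)
    then show "AE x in P. norm (u x * Y x ^ n) \<le> norm (fact n * (\<bar>u x\<bar> * exp (1 * \<bar>Y x\<bar>)))"
      by (simp add: abs_mult power_abs)
  qed measurable
  have tint: "integrable P (?t n)" for n
  proof -
    have "?t n = (\<lambda>x. (z ^ n / fact n) * complex_of_real (u x * Y x ^ n))"
      by (rule ext) (simp add: scaleR_conv_of_real power_mult_distrib field_simps)
    then show ?thesis by (simp only: integrable_mult_right[OF integrable_of_real[OF powint[of n]]])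
  qed
  have "(\<lambda>N. \<integral>x. (\<Sum>n<N. ?t n x) \<partial>P) \<longlonglongrightarrow> (\<integral>x. complex_of_real (u x) * exp (z * complex_of_real (Y x)) \<partial>P)"
  proof (rule integral_dominated_convergence)
    show "integrable P (\<lambda>x. \<bar>u x\<bar> * exp (cmod z * \<bar>Y x\<bar>))" by (rule abs_exp_int[OF Y u])
    show "AE x in P. (\<lambda>N. \<Sum>n<N. ?t n x) \<longlonglongrightarrow> complex_of_real (u x) * exp (z * complex_of_real (Y x))"
      unfolding sums_def[symmetric] by (intro AE_I2 sums_mult exp_converges)
    fix N
    show "AE x in P. norm (\<Sum>n<N. ?t n x) \<le> \<bar>u x\<bar> * exp (cmod z * \<bar>Y x\<bar>)"
    proof (rule AE_I2)
      fix x
      have "norm (\<Sum>n<N. ?t n x) \<le> (\<Sum>n<N. norm (?t n x))" by (rule norm_sum)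
      also have "\<dots> = \<bar>u x\<bar> * (\<Sum>n<N. cmod ((z * complex_of_real (Y x)) ^ n /\<^sub>R fact n))"
        by (simp only: norm_mult norm_of_real sum_distrib_left)
      also have "\<dots> \<le> \<bar>u x\<bar> * exp (cmod (z * complex_of_real (Y x)))"
        by (intro mult_left_mono bound) auto
      finally show "norm (\<Sum>n<N. ?t n x) \<le> \<bar>u x\<bar> * exp (cmod z * \<bar>Y x\<bar>)" by (simp add: norm_mult)
    qed
  qed measurable
  moreover have "(\<integral>x. (\<Sum>n<N. ?t n x) \<partial>P) = (\<Sum>n<N. complex_of_real ((\<integral>x. u x * Y x ^ n \<partial>P) / fact n) * z ^ n)" for N
  proof -
    have "(\<integral>x. ?t n x \<partial>P) = complex_of_real ((\<integral>x. u x * Y x ^ n \<partial>P) / fact n) * z ^ n" for n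
    proof -
      have "?t n = (\<lambda>x. (z ^ n / fact n) * complex_of_real (u x * Y x ^ n))"
        by (rule ext) (simp add: scaleR_conv_of_real power_mult_distrib field_simps)
      then have "(\<integral>x. ?t n x \<partial>P) = (z ^ n / fact n) * complex_of_real (\<integral>x. u x * Y x ^ n \<partial>P)"
        by (simp del: of_real_mult of_real_power)
      then show ?thesis by simp
    qed
    then show ?thesis by (subst Bochner_Integration.integral_sum[OF tint]) simp
  qed
  ultimately show ?thesis by (simp add: sums_def)
qed

text \<open>Analytic continuation: each tY is again in the family up to a null set, so E(u e^{tY}) =
  0 for all real t. All weighted moments vanish, and the same power series is then 0 at z =
  \<i>.\<close>

lemma exp_zero_imp_trig_zero:
  assumes Y: "Y \<in> \<Y>" and u [measurable]: "u \<in> borel_measurable P" "integrable P (\<lambda>x. (u x)\<^sup>2)"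
    and z: "\<And>Y. Y \<in> \<Y> \<Longrightarrow> (\<integral>x. u x * exp (Y x) \<partial>P) = 0"
  shows "(\<integral>x. u x * cos (Y x) \<partial>P) = 0" "(\<integral>x. u x * sin (Y x) \<partial>P) = 0"
proof -
  note [measurable] = meas[OF Y]
  have "(\<lambda>n. (\<integral>x. u x * Y x ^ n \<partial>P) / fact n * t ^ n) sums 0" for t
  proof -
    obtain X where X: "X \<in> \<Y>" "AE x in P. X x = t * Y x + 0 * Y x" using comb[OF Y Y] by blast
    note [measurable] = meas[OF X(1)]
    have "(\<integral>x. complex_of_real (u x) * exp (complex_of_real t * complex_of_real (Y x)) \<partial>P)
        = (\<integral>x. complex_of_real (u x * exp (X x)) \<partial>P)"
      by (rule integral_cong_AE) (measurable, use X(2) in eventually_elim, simp flip: exp_of_real)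
    also have "\<dots> = 0" using z[OF X(1)] by (simp del: of_real_mult)
    finally have "(\<lambda>n. complex_of_real ((\<integral>x. u x * Y x ^ n \<partial>P) / fact n) * complex_of_real t ^ n) sums 0"
      using exp_power_series[OF Y u, of "complex_of_real t"] by simp
    then have "(\<lambda>n. complex_of_real ((\<integral>x. u x * Y x ^ n \<partial>P) / fact n * t ^ n)) sums complex_of_real 0"
      by (simp only: of_real_mult of_real_power of_real_0)
    then show ?thesis by (simp only: sums_of_real_iff)
  qed
  then have c0: "(\<integral>x. u x * Y x ^ n \<partial>P) / fact n = 0" for n by (rule powser_zero_coeff)
  have "(\<lambda>n::nat. 0) sums (\<integral>x. complex_of_real (u x) * exp (\<i> * complex_of_real (Y x)) \<partial>P)"
    using exp_power_series[OF Y u, of \<i>] by (simp only: c0 of_real_0 mult_zero_left)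
  then have 0: "(\<integral>x. complex_of_real (u x) * exp (\<i> * complex_of_real (Y x)) \<partial>P) = 0"
    using sums_unique2 sums_zero by blast
  interpret finite_measure P by (rule fin)
  have ui: "integrable P u" using u by (rule square_integrable_imp_integrable)
  have int: "integrable P (\<lambda>x. complex_of_real (u x) * exp (\<i> * complex_of_real (Y x)))"
    using ui by (rule Bochner_Integration.integrable_bound) (auto simp: norm_mult)
  have "Re (complex_of_real (u x) * exp (\<i> * complex_of_real (Y x))) = u x * cos (Y x)" for x by (simp add: Re_exp)
  from this integral_Re[OF int] show "(\<integral>x. u x * cos (Y x) \<partial>P) = 0" by (simp only: 0 zero_complex.sel)
  have "Im (complex_of_real (u x) * exp (\<i> * complex_of_real (Y x))) = u x * sin (Y x)" for x by (simp add: Im_exp)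
  from this integral_Im[OF int] show "(\<integral>x. u x * sin (Y x) \<partial>P) = 0" by (simp only: 0 zero_complex.sel)
qed

text \<open>The sets that act as multipliers on the class of bounded functions \<open>\<phi>\<close> with
  \<open>E(u \<phi> e\<^sup>i\<^sup>Y) = 0\<close> for all \<open>Y\<close> form a \<open>\<sigma>\<close>-algebra, so no \<open>\<pi>\<close>-system of generators is needed.\<close>

theorem exp_zero_imp_zero_on_generated:
  assumes u [measurable]: "u \<in> borel_measurable P" "integrable P (\<lambda>x. (u x)\<^sup>2)"
    and z: "\<And>Y. Y \<in> \<Y> \<Longrightarrow> (\<integral>x. u x * exp (Y x) \<partial>P) = 0"
    and gen: "\<And>E. E \<in> \<E> \<Longrightarrow> \<exists>Y\<in>\<Y>. \<exists>B\<in>sets borel. AE x in P. x \<in> E \<longleftrightarrow> Y x \<in> B"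
    and sub: "\<E> \<subseteq> sets P" and A: "A \<in> sigma_sets (space P) \<E>"
  shows "(\<integral>x. u x * indicator A x \<partial>P) = 0"
proof -
  interpret finite_measure P by (rule fin)
  have ui: "integrable P u" using u by (rule square_integrable_imp_integrable)
  define bdd where "bdd \<phi> \<longleftrightarrow> \<phi> \<in> borel_measurable P \<and> (\<forall>x. \<bar>\<phi> x\<bar> \<le> (1::real))" for \<phi>
  define C where "C = {\<phi>. bdd \<phi> \<and> (\<forall>Y\<in>\<Y>. (\<integral>x. u x * \<phi> x * cos (Y x) \<partial>P) = 0 \<and>
    (\<integral>x. u x * \<phi> x * sin (Y x) \<partial>P) = 0)}"
  have dom: "integrable P (\<lambda>x. u x * \<phi> x)" if "bdd \<phi>" for \<phi>
  proof (rule Bochner_Integration.integrable_bound[OF ui])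
    have [measurable]: "\<phi> \<in> borel_measurable P" using that by (simp add: bdd_def)
    show "(\<lambda>x. u x * \<phi> x) \<in> borel_measurable P" by measurable
    show "AE x in P. norm (u x * \<phi> x) \<le> norm (u x)"
      using that by (auto simp: bdd_def abs_mult intro!: mult_left_le)
  qed
  have trig: "bdd (\<lambda>x. \<phi> x * cos (Y x))" "bdd (\<lambda>x. \<phi> x * sin (Y x))"
    if "bdd \<phi>" "Y \<in> borel_measurable P" for \<phi> Y
    using that by (auto simp: bdd_def abs_mult intro!: mult_le_one)
  note tint = dom[OF trig(1)] dom[OF trig(2)]
  have bdd_ind: "bdd (\<lambda>x. \<phi> x * indicator A x)" if "bdd \<phi>" "A \<in> sets P" for \<phi> A
    using that by (auto simp: bdd_def indicator_def)
  have one: "(\<lambda>_. 1) \<in> C"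
    using exp_zero_imp_trig_zero[OF _ u z] by (auto simp: C_def bdd_def)
  have Cb: "bdd \<phi>" if "\<phi> \<in> C" for \<phi> using that by (simp add: C_def)
  define mult where "mult A \<longleftrightarrow> A \<in> sets P \<and> (\<forall>\<phi>\<in>C. (\<lambda>x. \<phi> x * indicator A x) \<in> C)" for A
  have mult_gen: "mult E" if E: "E \<in> \<E>" for E
    unfolding mult_def
  proof (intro conjI ballI)
    show EP: "E \<in> sets P" using sub E by blast
    fix \<phi> assume \<phi>: "\<phi> \<in> C"
    obtain Y B where Y: "Y \<in> \<Y>" and [measurable]: "B \<in> sets borel" and EY: "AE x in P. x \<in> E \<longleftrightarrow> Y x \<in> B"
      using gen[OF E] by blast
    have [measurable]: "\<phi> \<in> borel_measurable P" using Cb[OF \<phi>] by (simp add: bdd_def)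
    note [measurable] = meas[OF Y] EP
    \<comment> \<open>Product formulas express f(Z) cos(tY) and f(Z) sin(tY) through tY + Z and tY -
      Z, which are in the family up to null sets. So the weight u \<phi> f(Z) has zero Fourier
      transform along Y.\<close>
    have key: "(\<integral>x. u x * \<phi> x * f (Z x) * indicator B (Y x) \<partial>P) = 0"
      if Z: "Z \<in> \<Y>" and f: "f = cos \<or> f = (sin :: real \<Rightarrow> real)" for Z f
    proof (rule Fourier_zero_imp_zero[OF fin])
      note [measurable] = meas[OF Z]
      show "integrable P (\<lambda>x. u x * \<phi> x * f (Z x))"
        using tint[OF Cb[OF \<phi>] meas[OF Z]] f by (auto simp: mult.assoc)
      have *: "(\<integral>x. u x * \<phi> x * cos (a * Y x + b * Z x) \<partial>P) = 0 \<and>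
          (\<integral>x. u x * \<phi> x * sin (a * Y x + b * Z x) \<partial>P) = 0 \<and>
          integrable P (\<lambda>x. u x * \<phi> x * cos (a * Y x + b * Z x)) \<and>
          integrable P (\<lambda>x. u x * \<phi> x * sin (a * Y x + b * Z x))" for a b
      proof (intro conjI)
        obtain X where X: "X \<in> \<Y>" "AE x in P. X x = a * Y x + b * Z x" using comb[OF Y Z] by blast
        note [measurable] = meas[OF X(1)]
        have "(\<integral>x. u x * \<phi> x * cos (a * Y x + b * Z x) \<partial>P) = (\<integral>x. u x * \<phi> x * cos (X x) \<partial>P)"
          by (rule integral_cong_AE) (measurable, use X(2) in eventually_elim, simp)
        then show "(\<integral>x. u x * \<phi> x * cos (a * Y x + b * Z x) \<partial>P) = 0" using \<phi> X(1) by (simp add: C_def)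
        have "(\<integral>x. u x * \<phi> x * sin (a * Y x + b * Z x) \<partial>P) = (\<integral>x. u x * \<phi> x * sin (X x) \<partial>P)"
          by (rule integral_cong_AE) (measurable, use X(2) in eventually_elim, simp)
        then show "(\<integral>x. u x * \<phi> x * sin (a * Y x + b * Z x) \<partial>P) = 0" using \<phi> X(1) by (simp add: C_def)
        have "(\<lambda>x. a * Y x + b * Z x) \<in> borel_measurable P" by measurable
        from tint[OF Cb[OF \<phi>] this]
        show "integrable P (\<lambda>x. u x * \<phi> x * cos (a * Y x + b * Z x))"
          "integrable P (\<lambda>x. u x * \<phi> x * sin (a * Y x + b * Z x))" by (simp_all add: mult.assoc)
      qed
      fix t
      note p = *[of t 1] and n = *[of t "-1"]
      have eq: "u x * \<phi> x * cos (Z x) * cos (t * Y x)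
          = (u x * \<phi> x * cos (t * Y x + 1 * Z x) + u x * \<phi> x * cos (t * Y x + (-1) * Z x)) / 2"
        "u x * \<phi> x * cos (Z x) * sin (t * Y x)
          = (u x * \<phi> x * sin (t * Y x + 1 * Z x) + u x * \<phi> x * sin (t * Y x + (-1) * Z x)) / 2"
        "u x * \<phi> x * sin (Z x) * cos (t * Y x)
          = (u x * \<phi> x * sin (t * Y x + 1 * Z x) - u x * \<phi> x * sin (t * Y x + (-1) * Z x)) / 2"
        "u x * \<phi> x * sin (Z x) * sin (t * Y x)
          = (u x * \<phi> x * cos (t * Y x + (-1) * Z x) - u x * \<phi> x * cos (t * Y x + 1 * Z x)) / 2" for x
        by (simp_all add: cos_add sin_add cos_diff sin_diff algebra_simps)
      show "(\<integral>x. u x * \<phi> x * f (Z x) * cos (t * Y x) \<partial>P) = 0"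
        using f p n by (elim disjE) (simp_all only: eq, simp_all)
      show "(\<integral>x. u x * \<phi> x * f (Z x) * sin (t * Y x) \<partial>P) = 0"
        using f p n by (elim disjE) (simp_all only: eq, simp_all)
    qed measurable
    have [measurable]: "u \<in> borel_measurable P" by (rule u)
    show "(\<lambda>x. \<phi> x * indicator E x) \<in> C"
      unfolding C_def
    proof (intro CollectI conjI ballI bdd_ind Cb \<phi> EP)
      fix Z assume Z: "Z \<in> \<Y>"
      note [measurable] = meas[OF Z]
      have "(\<integral>x. u x * (\<phi> x * indicator E x) * cos (Z x) \<partial>P) = (\<integral>x. u x * \<phi> x * cos (Z x) * indicator B (Y x) \<partial>P)"
        by (rule integral_cong_AE) (measurable, use EY in eventually_elim, simp add: indicator_def)
      then show "(\<integral>x. u x * (\<phi> x * indicator E x) * cos (Z x) \<partial>P) = 0" using key[OF Z] by simp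
      have "(\<integral>x. u x * (\<phi> x * indicator E x) * sin (Z x) \<partial>P) = (\<integral>x. u x * \<phi> x * sin (Z x) * indicator B (Y x) \<partial>P)"
        by (rule integral_cong_AE) (measurable, use EY in eventually_elim, simp add: indicator_def)
      then show "(\<integral>x. u x * (\<phi> x * indicator E x) * sin (Z x) \<partial>P) = 0" using key[OF Z] by simp
    qed
  qed
  have diffC: "(\<lambda>x. \<phi> x * indicator (space P - A) x) \<in> C"
    if \<phi>: "\<phi> \<in> C" and A: "mult A" for \<phi> A
    unfolding C_def
  proof (intro CollectI conjI ballI)
    have \<phi>A: "(\<lambda>x. \<phi> x * indicator A x) \<in> C" and AP: "A \<in> sets P" using A \<phi> by (auto simp: mult_def)
    show "bdd (\<lambda>x. \<phi> x * indicator (space P - A) x)" using \<phi> AP by (intro bdd_ind Cb) auto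
    fix Y assume Y: "Y \<in> \<Y>"
    have *: "(\<integral>x. u x * (\<phi> x * indicator (space P - A) x) * f (Y x) \<partial>P)
        = (\<integral>x. u x * \<phi> x * f (Y x) \<partial>P) - (\<integral>x. u x * (\<phi> x * indicator A x) * f (Y x) \<partial>P)"
      if "f = cos \<or> f = (sin :: real \<Rightarrow> real)" for f
    proof -
      have "integrable P (\<lambda>x. u x * \<phi> x * f (Y x))" "integrable P (\<lambda>x. u x * (\<phi> x * indicator A x) * f (Y x))"
        using tint[OF Cb[OF \<phi>] meas[OF Y]] tint[OF Cb[OF \<phi>A] meas[OF Y]] that by (auto simp: mult.assoc)
      from Bochner_Integration.integral_diff[OF this, symmetric] show ?thesis
        by (rule trans[rotated, OF sym]) (auto intro!: Bochner_Integration.integral_cong simp: indicator_def)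
    qed
    show "(\<integral>x. u x * (\<phi> x * indicator (space P - A) x) * cos (Y x) \<partial>P) = 0"
      "(\<integral>x. u x * (\<phi> x * indicator (space P - A) x) * sin (Y x) \<partial>P) = 0"
      using *[of cos] *[of sin] \<phi> \<phi>A Y by (auto simp: C_def)
  qed
  have limC: "\<phi> \<in> C" if \<phi>: "\<And>n::nat. \<phi>s n \<in> C" and lim: "\<And>x. (\<lambda>n. \<phi>s n x) \<longlonglongrightarrow> \<phi> x" for \<phi>s \<phi>
    unfolding C_def
  proof (intro CollectI conjI ballI)
    have [measurable]: "\<phi>s n \<in> borel_measurable P" for n using Cb[OF \<phi>] by (simp add: bdd_def)
    have [measurable]: "\<phi> \<in> borel_measurable P" by (rule borel_measurable_LIMSEQ_real[OF lim]) measurable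
    have b1: "\<bar>\<phi>s n x\<bar> \<le> 1" for n x using Cb[OF \<phi>] by (simp add: bdd_def)
    have "\<bar>\<phi> x\<bar> \<le> 1" for x
      by (rule tendsto_upperbound[OF tendsto_rabs[OF lim]]) (auto simp: b1)
    then show "bdd \<phi>" by (simp add: bdd_def)
    fix Y assume Y: "Y \<in> \<Y>"
    note [measurable] = meas[OF Y] u(1)
    have *: "(\<lambda>n. \<integral>x. u x * \<phi>s n x * f (Y x) \<partial>P) \<longlonglongrightarrow> (\<integral>x. u x * \<phi> x * f (Y x) \<partial>P)"
      if f: "f = cos \<or> f = (sin :: real \<Rightarrow> real)" for f
    proof (rule integral_dominated_convergence)
      have [measurable]: "f \<in> borel_measurable borel" using f by auto
      show "(\<lambda>x. u x * \<phi> x * f (Y x)) \<in> borel_measurable P" "(\<lambda>x. u x * \<phi>s n x * f (Y x)) \<in> borel_measurable P" for n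
        by measurable
      show "integrable P (\<lambda>x. \<bar>u x\<bar>)" using ui by simp
      show "AE x in P. (\<lambda>n. u x * \<phi>s n x * f (Y x)) \<longlonglongrightarrow> u x * \<phi> x * f (Y x)"
        by (intro AE_I2 tendsto_intros lim)
      have "\<bar>\<phi>s n x\<bar> * \<bar>f y\<bar> \<le> 1" for n x y using b1[of n x] f by (auto intro!: mult_le_one)
      then show "AE x in P. norm (u x * \<phi>s n x * f (Y x)) \<le> \<bar>u x\<bar>" for n
        by (auto simp: abs_mult mult.assoc intro!: mult_left_le)
    qed
    show "(\<integral>x. u x * \<phi> x * cos (Y x) \<partial>P) = 0" "(\<integral>x. u x * \<phi> x * sin (Y x) \<partial>P) = 0"
      using *[of cos] *[of sin] \<phi> Y by (auto simp: C_def LIMSEQ_const_iff)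
  qed
  have "mult A" using A
  proof (induction rule: sigma_sets.induct)
    case (Basic E)
    then show ?case by (rule mult_gen)
  next
    case Empty
    have "bdd (\<lambda>_. 0)" by (simp add: bdd_def)
    then show ?case by (simp add: mult_def C_def)
  next
    case (Compl A)
    then show ?case using diffC by (auto simp: mult_def)
  next
    case (Union A)
    let ?U = "\<lambda>n. \<Union>i<n. A i"
    have fin_U: "mult (?U n)" for n
    proof (induction n)
      case 0
      have "bdd (\<lambda>_. 0)" by (simp add: bdd_def)
      then show ?case by (simp add: mult_def C_def)
    next
      case (Suc n)
      have mP: "?U n \<in> sets P" "A n \<in> sets P" using Suc Union.IH by (auto simp: mult_def)
      show ?case unfolding mult_def
      proof (intro conjI ballI)
        show "?U (Suc n) \<in> sets P" using mP by (auto simp: lessThan_Suc)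
        fix \<phi> assume \<phi>: "\<phi> \<in> C"
        have c: "mult (space P - B)" if "mult B" for B
          using that diffC by (auto simp: mult_def)
        have i: "mult (B \<inter> D)" if "mult B" "mult D" for B D
        proof -
          have "(\<lambda>x. \<psi> x * indicator (B \<inter> D) x) = (\<lambda>x. \<psi> x * indicator B x * indicator D x)" for \<psi> :: "'s \<Rightarrow> real"
            by (auto simp: indicator_def)
          then show ?thesis using that by (auto simp: mult_def)
        qed
        \<comment> \<open>Successive multiplication gives intersections of multipliers; unions come
          from them by complements.\<close>
        have "mult (space P - ((space P - ?U n) \<inter> (space P - A n)))"
          by (intro c i Suc Union.IH)
        also have "space P - ((space P - ?U n) \<inter> (space P - A n)) = ?U (Suc n)"
          using mP[THEN sets.sets_into_space] by (auto simp: lessThan_Suc)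
        finally show "(\<lambda>x. \<phi> x * indicator (?U (Suc n)) x) \<in> C" using \<phi> by (simp add: mult_def)
      qed
    qed
    show ?case unfolding mult_def
    proof (intro conjI ballI)
      show "(\<Union>i. A i) \<in> sets P" using Union.IH by (auto simp: mult_def)
      fix \<phi> assume \<phi>: "\<phi> \<in> C"
      show "(\<lambda>x. \<phi> x * indicator (\<Union>i. A i) x) \<in> C"
      proof (rule limC)
        show "(\<lambda>x. \<phi> x * indicator (?U n) x) \<in> C" for n using fin_U \<phi> by (simp add: mult_def)
        show "(\<lambda>n. \<phi> x * indicator (?U n) x) \<longlonglongrightarrow> \<phi> x * indicator (\<Union>i. A i) x" for x
          by (intro tendsto_mult tendsto_const LIMSEQ_indicator_UN)
      qed
    qed
  qed
  then have "\<forall>\<phi>\<in>C. (\<lambda>x. \<phi> x * indicator A x) \<in> C" by (simp add: mult_def)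
  from bspec[OF this one] have inC: "(\<lambda>x. 1 * indicator A x) \<in> C" .
  obtain Y where Y: "Y \<in> \<Y>" using ne by blast
  \<comment> \<open>A member of the family that is almost surely 0: its cosine is 1, which removes
    the trigonometric factor.\<close>
  obtain X where X: "X \<in> \<Y>" "AE x in P. X x = 0 * Y x + 0 * Y x" using comb[OF Y Y] by blast
  have AP: "A \<in> sets P" using \<open>mult A\<close> by (simp add: mult_def)
  note [measurable] = meas[OF X(1)] u(1) AP
  have "(\<integral>x. u x * indicator A x \<partial>P) = (\<integral>x. u x * (1 * indicator A x) * cos (X x) \<partial>P)"
    by (rule integral_cong_AE) (measurable, use X(2) in eventually_elim, simp)
  also have "\<dots> = 0" using inC X(1) by (simp add: C_def)
  finally show ?thesis .
qed

end

section \<open>Systems of exponentials\<close>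

definition cut :: "'a set \<Rightarrow> ('a \<Rightarrow> real) \<Rightarrow> 'a \<Rightarrow> real" where
  "cut A h = (\<lambda>x. if x \<in> A then h x else 0)"

lemma real_L2_measurable: "h \<in> real_L2 M \<Longrightarrow> h \<in> borel_measurable M"
  by (simp add: real_L2_def)

lemma real_L2_cut:
  assumes "A \<in> sets M" "h \<in> real_L2 M" shows "cut A h \<in> real_L2 M"
proof -
  note [measurable] = assms(1) real_L2_measurable[OF assms(2)]
  have "integrable M (\<lambda>x. (cut A h x)\<^sup>2)"
  proof (rule Bochner_Integration.integrable_bound)
    show "integrable M (\<lambda>x. (h x)\<^sup>2)" using assms by (simp add: real_L2_def)
  qed (auto simp: cut_def)
  then show ?thesis by (simp add: real_L2_def cut_def)
qed

lemma real_L2_scale: "h \<in> real_L2 M \<Longrightarrow> (\<lambda>x. c * h x) \<in> real_L2 M"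
  by (auto simp: real_L2_def power_mult_distrib)

lemma real_L2_mult_integrable:
  assumes "h \<in> real_L2 M" "k \<in> real_L2 M" shows "integrable M (\<lambda>x. h x * k x)"
proof -
  note [measurable] = real_L2_measurable[OF assms(1)] real_L2_measurable[OF assms(2)]
  have int: "integrable M (\<lambda>x. (h x)\<^sup>2 + (k x)\<^sup>2)" using assms by (simp add: real_L2_def)
  have "\<bar>a * b\<bar> \<le> a\<^sup>2 + b\<^sup>2" for a b :: real
    using sum_squares_bound[of "\<bar>a\<bar>" "\<bar>b\<bar>"] mult_nonneg_nonneg[OF abs_ge_zero[of a] abs_ge_zero[of b]]
    unfolding power2_abs abs_mult by linarith
  then show ?thesis
    by (intro Bochner_Integration.integrable_bound[OF int]) auto
qed

lemma real_L2_add: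
  assumes "h \<in> real_L2 M" "k \<in> real_L2 M" shows "(\<lambda>x. h x + k x) \<in> real_L2 M"
proof -
  have "integrable M (\<lambda>x. (h x)\<^sup>2 + 2 * (h x * k x) + (k x)\<^sup>2)"
    using assms real_L2_mult_integrable[OF assms] by (simp add: real_L2_def)
  then show ?thesis using assms by (auto simp: real_L2_def power2_sum algebra_simps)
qed

lemma real_L2_bounded:
  assumes "finite_measure M" "h \<in> borel_measurable M" "\<And>x. \<bar>h x\<bar> \<le> c"
  shows "h \<in> real_L2 M"
proof -
  interpret finite_measure M by fact
  have "\<bar>h x\<bar>\<^sup>2 \<le> c\<^sup>2" for x by (intro power_mono assms) auto
  then have "integrable M (\<lambda>x. (h x)\<^sup>2)"
    using assms by (intro integrable_const_bound[where B = "c\<^sup>2"]) auto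
  then show ?thesis using assms by (simp add: real_L2_def)
qed

lemma real_L2_zero: "(\<lambda>_. 0) \<in> real_L2 M"
  by (simp add: real_L2_def)

lemma real_L2_integrable:
  assumes "finite_measure M" "h \<in> real_L2 M" shows "integrable M h"
  using finite_measure.square_integrable_imp_integrable[OF assms(1)] assms(2) by (auto simp: real_L2_def)

lemma L2_ops: "hadd (L2 P G) = hadd (L2 P G')" "hscale (L2 P G) = hscale (L2 P G')"
  "hinner (L2 P G) = hinner (L2 P G')"
  by (simp_all add: L2_def)

text \<open>\<open>total\<close> is required for all square integrable \<open>u\<close> on P, not
  only for functionals of \<open>F A\<close>; this is what allows independence to be derived from
  it. Inclusions and measurability hold exactly, whereas the identities among the \<open>E h\<close>
  hold almost surely.\<close>

locale fock_space =
  fixes M :: "'a measure" and P :: "'s measure" and F :: "'a set \<Rightarrow> 's measure"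
    and E :: "('a \<Rightarrow> real) \<Rightarrow> 's \<Rightarrow> real"
  assumes finM: "finite_measure M" and probP: "prob_space P"
    and sub: "A \<in> sets M \<Longrightarrow> subalgebra P (F A)"
    and mono: "\<lbrakk>A \<in> sets M; B \<in> sets M; A \<subseteq> B\<rbrakk> \<Longrightarrow> sets (F A) \<subseteq> sets (F B)"
    and E_meas: "\<lbrakk>A \<in> sets M; h \<in> real_L2 M; \<forall>x\<in>space M - A. h x = 0\<rbrakk> \<Longrightarrow> E h \<in> borel_measurable (F A)"
    and E_int: "\<lbrakk>h \<in> real_L2 M; k \<in> real_L2 M\<rbrakk> \<Longrightarrow> integrable P (\<lambda>\<omega>. E h \<omega> * E k \<omega>)"
    and E_inner: "\<lbrakk>h \<in> real_L2 M; k \<in> real_L2 M\<rbrakk> \<Longrightarrow> (\<integral>\<omega>. E h \<omega> * E k \<omega> \<partial>P) = exp (\<integral>x. h x * k x \<partial>M)"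
    and E_mult: "\<lbrakk>A \<in> sets M; h \<in> real_L2 M; k \<in> real_L2 M; \<forall>x\<in>space M - A. h x = 0; \<forall>x\<in>A. k x = 0\<rbrakk> \<Longrightarrow>
      AE \<omega> in P. E (\<lambda>x. h x + k x) \<omega> = E h \<omega> * E k \<omega>"
    and E_zero: "AE \<omega> in P. E (\<lambda>_. 0) \<omega> = 1"
    and total: "\<lbrakk>A \<in> sets M; u \<in> borel_measurable P; integrable P (\<lambda>\<omega>. (u \<omega>)\<^sup>2);
      \<And>h. \<lbrakk>h \<in> real_L2 M; \<forall>x\<in>space M - A. h x = 0\<rbrakk> \<Longrightarrow> (\<integral>\<omega>. u \<omega> * E h \<omega> \<partial>P) = 0; D \<in> sets (F A)\<rbrakk> \<Longrightarrow>
      (\<integral>\<omega>. u \<omega> * indicator D \<omega> \<partial>P) = 0"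
begin

abbreviation "X \<equiv> space M"
abbreviation "HX \<equiv> L2 P (F (space M))"
abbreviation "C A \<equiv> hcarrier (L2 P (F A))"
abbreviation "cmul \<equiv> class_mult P"
definition "e h = ae_class P (\<lambda>\<omega>. complex_of_real (E h \<omega>))"
abbreviation "one \<equiv> ae_class P (\<lambda>_. 1 :: complex)"
abbreviation "ipr h k \<equiv> \<integral>x. h x * k x \<partial>M"

lemma finP: "finite_measure P" using probP by (simp add: prob_space_def)

sublocale hilbert HX by (rule hilbert_L2[OF finP sub]) simp

lemma hilbert_C: "A \<in> sets M \<Longrightarrow> hilbert (L2 P (F A))" by (rule hilbert_L2[OF finP sub])

lemma F_measurable_mono:
  assumes "A \<in> sets M" "f \<in> measurable (F A) N" shows "f \<in> measurable (F X) N"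
proof (rule measurable_from_subalg[OF _ assms(2)])
  show "subalgebra (F X) (F A)"
    using sub[OF assms(1)] sub[of X] mono[OF assms(1), of X] sets.sets_into_space[OF assms(1)]
    by (simp add: subalgebra_def)
qed

lemma C_sub: "A \<in> sets M \<Longrightarrow> C A \<subseteq> C X"
  by (rule subsetI, erule L2_cases[OF _ sub])
    (auto intro!: L2_memI sub F_measurable_mono simp del: ex_simps)

lemma C_subD [simp]: "A \<in> sets M \<Longrightarrow> u \<in> C A \<Longrightarrow> u \<in> C X" using C_sub by blast

lemma E_meas_P: "h \<in> real_L2 M \<Longrightarrow> E h \<in> borel_measurable P"
  using E_meas[of X h] measurable_from_subalg[OF sub[of X]] by blast

lemma E_sq_int: "h \<in> real_L2 M \<Longrightarrow> (\<lambda>\<omega>. complex_of_real (E h \<omega>)) \<in> sq_int P"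
  using E_int[of h h] E_meas_P[of h] by (auto simp: sq_int_def power2_eq_square[symmetric])

lemma e_in: "\<lbrakk>A \<in> sets M; h \<in> real_L2 M; \<forall>x\<in>X - A. h x = 0\<rbrakk> \<Longrightarrow> e h \<in> C A"
  unfolding e_def using E_meas[of A h] by (intro L2_memI[OF sub] E_sq_int) auto

lemma e_in_X [simp]: "h \<in> real_L2 M \<Longrightarrow> e h \<in> C X"
  by (rule e_in) auto

lemma inner_e_fun:
  assumes "f \<in> sq_int P" "h \<in> real_L2 M"
  shows "ip (ae_class P f) (e h) = (\<integral>\<omega>. f \<omega> * complex_of_real (E h \<omega>) \<partial>P)"
  unfolding e_def using assms by (subst hinner_ae_class) (auto intro: sq_int_measurable E_sq_int)

lemma inner_e: "\<lbrakk>h \<in> real_L2 M; k \<in> real_L2 M\<rbrakk> \<Longrightarrow> ip (e h) (e k) = complex_of_real (exp (ipr h k))"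
  unfolding e_def[of h] by (simp add: inner_e_fun E_sq_int E_inner flip: of_real_mult)

lemma one_eq: "one = e (\<lambda>_. 0)"
  unfolding e_def by (rule ae_class_cong) (use E_zero in eventually_elim, simp)

lemma one_in: "A \<in> sets M \<Longrightarrow> one \<in> C A"
  unfolding one_eq by (rule e_in) (auto simp: real_L2_zero)

lemma real_orth_zero:
  assumes A: "A \<in> sets M" and u: "u \<in> borel_measurable (F A)" "integrable P (\<lambda>\<omega>. (u \<omega>)\<^sup>2)"
    and 0: "\<And>h. \<lbrakk>h \<in> real_L2 M; \<forall>x\<in>X - A. h x = 0\<rbrakk> \<Longrightarrow> (\<integral>\<omega>. u \<omega> * E h \<omega> \<partial>P) = 0"
  shows "AE \<omega> in P. u \<omega> = 0"
proof -
  interpret finite_measure P by (rule finP)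
  have sp: "space (F A) = space P" using sub[OF A] by (simp add: subalgebra_def)
  have uP [measurable]: "u \<in> borel_measurable P" using u measurable_from_subalg[OF sub[OF A]] by blast
  have ui: "integrable P u" using uP u(2) by (rule square_integrable_imp_integrable)
  \<comment> \<open>The sign \<open>c\<close> selects where c u is positive; integrating c u over
    that set gives 0, so the set is null.\<close>
  have half: "AE \<omega> in P. c * u \<omega> \<le> 0" if c: "c = 1 \<or> c = -1" for c
  proof -
    have [measurable]: "u \<in> borel_measurable (F A)" by (rule u)
    have "{\<omega>\<in>space (F A). c * u \<omega> > 0} \<in> sets (F A)" by measurable
    then have D: "{\<omega>\<in>space P. c * u \<omega> > 0} \<in> sets (F A)" by (simp add: sp)
    let ?D = "{\<omega>\<in>space P. c * u \<omega> > 0}"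
    have DP: "?D \<in> sets P" by measurable
    have "(\<integral>\<omega>. c * (u \<omega> * indicator ?D \<omega>) \<partial>P) = 0" using total[OF A uP u(2) 0 D] by simp
    moreover have "integrable P (\<lambda>\<omega>. c * (u \<omega> * indicator ?D \<omega>))"
      using integrable_mult_indicator[OF DP ui] by (simp add: mult.commute)
    ultimately have "AE \<omega> in P. c * (u \<omega> * indicator ?D \<omega>) = 0"
      by (subst (asm) integral_nonneg_eq_0_iff_AE) (auto simp: indicator_def)
    then show ?thesis by (rule AE_mp) (auto intro!: AE_I2 simp: indicator_def split: if_splits)
  qed
  show ?thesis using half[OF disjI1[OF refl]] half[OF disjI2[OF refl]] by eventually_elim auto
qed

text \<open>The exponentials are real, so the real and the imaginary part of the difference are
  orthogonal to them separately.\<close>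

lemma C_ext:
  assumes A: "A \<in> sets M" and u: "u \<in> C A" and v: "v \<in> C A"
    and eq: "\<And>h. \<lbrakk>h \<in> real_L2 M; \<forall>x\<in>X - A. h x = 0\<rbrakk> \<Longrightarrow> ip u (e h) = ip v (e h)"
  shows "u = v"
proof -
  obtain f where f: "u = ae_class P f" "f \<in> borel_measurable (F A)" "f \<in> sq_int P" using u sub[OF A] by (rule L2_cases)
  obtain g where g: "v = ae_class P g" "g \<in> borel_measurable (F A)" "g \<in> sq_int P" using v sub[OF A] by (rule L2_cases)
  define d where "d \<omega> = f \<omega> - g \<omega>" for \<omega>
  have d: "d \<in> borel_measurable (F A)" "d \<in> sq_int P" unfolding d_def using f g by (auto intro: sq_int_diff)
  have dP [measurable]: "d \<in> borel_measurable P" using d by (intro sq_int_measurable)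
  have [measurable]: "d \<in> borel_measurable (F A)" by (rule d)
  have dint: "(\<integral>\<omega>. d \<omega> * complex_of_real (E h \<omega>) \<partial>P) = 0"
    and di: "integrable P (\<lambda>\<omega>. d \<omega> * complex_of_real (E h \<omega>))"
    if h: "h \<in> real_L2 M" "\<forall>x\<in>X - A. h x = 0" for h
  proof -
    show "integrable P (\<lambda>\<omega>. d \<omega> * complex_of_real (E h \<omega>))" by (intro sq_int_mult_integrable d E_sq_int h)
    have "(\<integral>\<omega>. d \<omega> * complex_of_real (E h \<omega>) \<partial>P)
       = (\<integral>\<omega>. f \<omega> * complex_of_real (E h \<omega>) - g \<omega> * complex_of_real (E h \<omega>) \<partial>P)"
      by (simp add: d_def left_diff_distrib)
    also have "\<dots> = ip u (e h) - ip v (e h)"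
      using f g h by (subst Bochner_Integration.integral_diff) (auto simp: inner_e_fun intro!: sq_int_mult_integrable E_sq_int)
    finally show "(\<integral>\<omega>. d \<omega> * complex_of_real (E h \<omega>) \<partial>P) = 0" using eq[OF h] by simp
  qed
  have sq: "integrable P (\<lambda>\<omega>. (Re (d \<omega>))\<^sup>2)" "integrable P (\<lambda>\<omega>. (Im (d \<omega>))\<^sup>2)"
    by (rule Bochner_Integration.integrable_bound[OF sq_int_integrable[OF d(2)]], measurable,
        simp add: cmod_power2)+
  have "AE \<omega> in P. Re (d \<omega>) = 0"
  proof (rule real_orth_zero[OF A _ sq(1)])
    show "(\<integral>\<omega>. Re (d \<omega>) * E h \<omega> \<partial>P) = 0" if "h \<in> real_L2 M" "\<forall>x\<in>X - A. h x = 0" for h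
      using integral_Re[OF di[OF that]] dint[OF that] by simp
  qed measurable
  moreover have "AE \<omega> in P. Im (d \<omega>) = 0"
  proof (rule real_orth_zero[OF A _ sq(2)])
    show "(\<integral>\<omega>. Im (d \<omega>) * E h \<omega> \<partial>P) = 0" if "h \<in> real_L2 M" "\<forall>x\<in>X - A. h x = 0" for h
      using integral_Im[OF di[OF that]] dint[OF that] by simp
  qed measurable
  ultimately have "AE \<omega> in P. f \<omega> = g \<omega>" by eventually_elim (simp add: d_def complex_eq_iff)
  then show ?thesis unfolding f g by (rule ae_class_cong)
qed

lemma X_ext:
  assumes "u \<in> C X" "v \<in> C X" "\<And>h. h \<in> real_L2 M \<Longrightarrow> ip u (e h) = ip v (e h)"
  shows "u = v"
  by (rule C_ext[OF _ assms(1,2)]) (use assms(3) in auto)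

lemma e_cong: "\<lbrakk>h \<in> real_L2 M; k \<in> real_L2 M; AE x in M. h x = k x\<rbrakk> \<Longrightarrow> e h = e k"
proof (rule X_ext)
  fix l assume h: "h \<in> real_L2 M" "k \<in> real_L2 M" "AE x in M. h x = k x" and l: "l \<in> real_L2 M"
  note [measurable] = h(1,2)[THEN real_L2_measurable] l[THEN real_L2_measurable]
  have "ipr h l = ipr k l" by (rule integral_cong_AE) (measurable, use h(3) in eventually_elim, simp)
  then show "ip (e h) (e l) = ip (e k) (e l)" using h l by (simp add: inner_e)
qed auto

section \<open>Independence and the tensor product structure\<close>

lemma E_mean: "h \<in> real_L2 M \<Longrightarrow> (\<integral>\<omega>. E h \<omega> \<partial>P) = 1"
proof -
  assume h: "h \<in> real_L2 M"
  note [measurable] = E_meas_P[OF h] E_meas_P[OF real_L2_zero]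
  have "(\<integral>\<omega>. E h \<omega> \<partial>P) = (\<integral>\<omega>. E h \<omega> * E (\<lambda>_. 0) \<omega> \<partial>P)"
    by (rule integral_cong_AE) (measurable, use E_zero in eventually_elim, simp)
  also have "\<dots> = 1" using E_inner[OF h real_L2_zero] by simp
  finally show ?thesis .
qed

lemma E_integrable: "h \<in> real_L2 M \<Longrightarrow> integrable P (E h)"
proof -
  assume h: "h \<in> real_L2 M"
  note [measurable] = E_meas_P[OF h] E_meas_P[OF real_L2_zero]
  show ?thesis using E_int[OF h real_L2_zero]
    by (rule integrable_cong_AE_imp) (measurable, use E_zero in eventually_elim, simp)
qed

text \<open>Independence follows from totality alone: \<open>E k - 1\<close> is orthogonal to the exponentials living
  on \<open>A\<close>, hence to \<open>indicator S\<close>; then \<open>indicator S - P S\<close> is orthogonal to those living on the complement.\<close>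

lemma independent:
  assumes A: "A \<in> sets M" and S: "S \<in> sets (F A)" and T: "T \<in> sets (F (X - A))"
  shows "measure P (S \<inter> T) = measure P S * measure P T"
proof -
  interpret prob_space P by (rule probP)
  have A': "X - A \<in> sets M" using A by auto
  have SP [measurable]: "S \<in> sets P" using S sub[OF A] by (auto simp: subalgebra_def)
  have TP [measurable]: "T \<in> sets P" using T sub[OF A'] by (auto simp: subalgebra_def)
  have k1: "(\<integral>\<omega>. E k \<omega> * indicator S \<omega> \<partial>P) = measure P S"
    if k: "k \<in> real_L2 M" "\<forall>x\<in>A. k x = 0" for k
  proof -
    note [measurable] = E_meas_P[OF k(1)]
    have "(\<integral>\<omega>. (E k \<omega> - 1) * indicator S \<omega> \<partial>P) = 0"
    proof (rule total[OF A _ _ _ S])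
      show "integrable P (\<lambda>\<omega>. (E k \<omega> - 1)\<^sup>2)"
        using E_int[OF k(1) k(1)] E_integrable[OF k(1)] by (simp add: power2_eq_square algebra_simps)
      fix h assume h: "h \<in> real_L2 M" "\<forall>x\<in>X - A. h x = 0"
      have "ipr k h = 0"
        by (rule integral_eq_zero_AE, rule AE_I2) (use h k in auto)
      then show "(\<integral>\<omega>. (E k \<omega> - 1) * E h \<omega> \<partial>P) = 0"
        using E_int[OF k(1) h(1)] E_integrable[OF h(1)] E_inner[OF k(1) h(1)] E_mean[OF h(1)]
        by (simp add: left_diff_distrib)
    qed measurable
    moreover have "integrable P (\<lambda>\<omega>. E k \<omega> * indicator S \<omega>)"
      using integrable_mult_indicator[OF SP E_integrable[OF k(1)]] by (simp add: mult.commute)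
    moreover have "integrable P (indicat_real S)" by (rule integrable_const_bound[where B = 1]) auto
    ultimately show ?thesis by (simp add: left_diff_distrib)
  qed
  have "(\<integral>\<omega>. (indicator S \<omega> - measure P S) * indicator T \<omega> \<partial>P) = 0"
  proof (rule total[OF A' _ _ _ T])
    show "integrable P (\<lambda>\<omega>. (indicator S \<omega> - measure P S)\<^sup>2)"
      by (rule integrable_const_bound[where B = "1"]) (auto simp: indicator_def power_le_one abs_le_square_iff abs_square_le_1)
    fix k assume k: "k \<in> real_L2 M" "\<forall>x\<in>X - (X - A). k x = 0"
    then have kA: "\<forall>x\<in>A. k x = 0" using sets.sets_into_space[OF A] by auto
    have "integrable P (\<lambda>\<omega>. E k \<omega> * indicator S \<omega>)"
      using integrable_mult_indicator[OF SP E_integrable[OF k(1)]] by (simp add: mult.commute)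
    then show "(\<integral>\<omega>. (indicator S \<omega> - measure P S) * E k \<omega> \<partial>P) = 0"
      using k1[OF k(1) kA] E_mean[OF k(1)] E_integrable[OF k(1)]
      by (simp add: left_diff_distrib mult.commute[of "_ - _"] mult.commute[of "indicator S _"] right_diff_distrib)
  qed measurable
  moreover have "(indicator S \<omega> - measure P S) * indicator T \<omega>
      = indicator (S \<inter> T) \<omega> - measure P S * indicator T \<omega>" for \<omega>
    by (auto simp: indicator_def)
  moreover have "integrable P (indicat_real B)" if "B \<in> sets P" for B
    using that by (intro integrable_const_bound[where B = 1]) auto
  ultimately show ?thesis by simp
qed

lemma product_integral:
  fixes f g :: "'s \<Rightarrow> complex"
  assumes A: "A \<in> sets M" and f: "f \<in> borel_measurable (F A)" "integrable P f"
    and g: "g \<in> borel_measurable (F (X - A))" "integrable P g"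
  shows "integrable P (\<lambda>\<omega>. f \<omega> * g \<omega>)" "(\<integral>\<omega>. f \<omega> * g \<omega> \<partial>P) = (\<integral>\<omega>. f \<omega> \<partial>P) * (\<integral>\<omega>. g \<omega> \<partial>P)"
proof -
  interpret prob_space P by (rule probP)
  have A': "X - A \<in> sets M" using A by auto
  have sp: "sigma_sets (space P) {f -` B \<inter> space P |B. B \<in> sets borel} \<subseteq> sets (F A)"
    if "f \<in> borel_measurable (F A)" "A \<in> sets M" for f :: "'s \<Rightarrow> complex" and A
  proof -
    have "space (F A) = space P" using sub[OF that(2)] by (simp add: subalgebra_def)
    then show ?thesis using sets.sigma_sets_subset[of "{f -` B \<inter> space P |B. B \<in> sets borel}" "F A"]
      measurable_sets[OF that(1)] by auto
  qed
  have "indep_var borel f borel g"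
    unfolding indep_var_eq indep_sets2_eq
  proof (intro conjI ballI)
    have FP: "sets (F A) \<subseteq> sets P" "sets (F (X - A)) \<subseteq> sets P"
      using sub[OF A] sub[OF A'] by (auto simp: subalgebra_def)
    show "f \<in> borel_measurable P" "g \<in> borel_measurable P" using f g by auto
    show "sigma_sets (space P) {f -` B \<inter> space P |B. B \<in> sets borel} \<subseteq> events"
      "sigma_sets (space P) {g -` B \<inter> space P |B. B \<in> sets borel} \<subseteq> events"
      using sp[OF f(1) A] sp[OF g(1) A'] FP by blast+
    fix S T assume "S \<in> sigma_sets (space P) {f -` B \<inter> space P |B. B \<in> sets borel}"
      "T \<in> sigma_sets (space P) {g -` B \<inter> space P |B. B \<in> sets borel}"
    then show "prob (S \<inter> T) = prob S * prob T"
      using sp[OF f(1) A] sp[OF g(1) A'] by (intro independent[OF A]) blast+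
  qed
  then show "integrable P (\<lambda>\<omega>. f \<omega> * g \<omega>)" "(\<integral>\<omega>. f \<omega> * g \<omega> \<partial>P) = (\<integral>\<omega>. f \<omega> \<partial>P) * (\<integral>\<omega>. g \<omega> \<partial>P)"
    using f g by (auto intro: indep_var_integrable indep_var_lebesgue_integral)
qed

lemma product_sq_int:
  assumes A: "A \<in> sets M" and f: "f \<in> borel_measurable (F A)" "f \<in> sq_int P"
    and g: "g \<in> borel_measurable (F (X - A))" "g \<in> sq_int P"
  shows "(\<lambda>\<omega>. f \<omega> * g \<omega>) \<in> sq_int P"
proof -
  note [measurable] = f(1) g(1) f(2)[THEN sq_int_measurable] g(2)[THEN sq_int_measurable]
  have "integrable P (\<lambda>\<omega>. complex_of_real ((cmod (f \<omega>))\<^sup>2) * complex_of_real ((cmod (g \<omega>))\<^sup>2))"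
    using f g by (intro product_integral(1)[OF A] integrable_of_real sq_int_integrable) auto
  then have "integrable P (\<lambda>\<omega>. Re (complex_of_real ((cmod (f \<omega>))\<^sup>2) * complex_of_real ((cmod (g \<omega>))\<^sup>2)))"
    by (rule integrable_Re)
  then show ?thesis by (simp add: sq_int_def norm_mult power_mult_distrib)
qed

lemma mult_in:
  assumes A: "A \<in> sets M" and u: "u \<in> C A" and v: "v \<in> C (X - A)"
  shows "cmul u v \<in> C X"
proof -
  have A': "X - A \<in> sets M" using A by auto
  obtain f where f: "u = ae_class P f" "f \<in> borel_measurable (F A)" "f \<in> sq_int P" using u sub[OF A] by (rule L2_cases)
  obtain g where g: "v = ae_class P g" "g \<in> borel_measurable (F (X - A))" "g \<in> sq_int P" using v sub[OF A'] by (rule L2_cases)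
  note le = F_measurable_mono
  note [measurable] = le[OF A f(2)] le[OF A' g(2)]
  have "cmul u v = ae_class P (\<lambda>\<omega>. f \<omega> * g \<omega>)"
    unfolding f g using f g by (intro class_mult_ae_class sq_int_measurable)
  then show ?thesis using product_sq_int[OF A f(2,3) g(2,3)]
    by (auto intro!: L2_memI sub)
qed

text \<open>By independence, products of functionals over A and over its complement behave like
  elementary tensors. This replaces an explicit tensor product throughout.\<close>

lemma inner_mult:
  assumes A: "A \<in> sets M" and u: "u \<in> C A" "u' \<in> C A" and v: "v \<in> C (X - A)" "v' \<in> C (X - A)"
  shows "ip (cmul u v) (cmul u' v') = ip u u' * ip v v'"
proof -
  have A': "X - A \<in> sets M" using A by auto
  obtain f where f: "u = ae_class P f" "f \<in> borel_measurable (F A)" "f \<in> sq_int P" using u(1) sub[OF A] by (rule L2_cases)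
  obtain g where g: "v = ae_class P g" "g \<in> borel_measurable (F (X - A))" "g \<in> sq_int P" using v(1) sub[OF A'] by (rule L2_cases)
  obtain f' where f': "u' = ae_class P f'" "f' \<in> borel_measurable (F A)" "f' \<in> sq_int P" using u(2) sub[OF A] by (rule L2_cases)
  obtain g' where g': "v' = ae_class P g'" "g' \<in> borel_measurable (F (X - A))" "g' \<in> sq_int P" using v(2) sub[OF A'] by (rule L2_cases)
  note [measurable] = f(2) g(2) f'(2) g'(2) f(3)[THEN sq_int_measurable] g(3)[THEN sq_int_measurable]
    f'(3)[THEN sq_int_measurable] g'(3)[THEN sq_int_measurable]
  have "ip (cmul u v) (cmul u' v') = (\<integral>\<omega>. (f \<omega> * g \<omega>) * cnj (f' \<omega> * g' \<omega>) \<partial>P)"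
    unfolding f g f' g' by (simp add: class_mult_ae_class hinner_ae_class)
  also have "\<dots> = (\<integral>\<omega>. (f \<omega> * cnj (f' \<omega>)) * (g \<omega> * cnj (g' \<omega>)) \<partial>P)"
    by (simp add: mult_ac)
  also have "\<dots> = (\<integral>\<omega>. f \<omega> * cnj (f' \<omega>) \<partial>P) * (\<integral>\<omega>. g \<omega> * cnj (g' \<omega>) \<partial>P)"
    using f f' g g' by (intro product_integral(2)[OF A] sq_int_mult_integrable sq_int_cnj) auto
  also have "\<dots> = ip u u' * ip v v'" unfolding f g f' g' by (simp add: hinner_ae_class)
  finally show ?thesis .
qed

lemma C_fun: "u \<in> C X \<Longrightarrow> \<exists>f. u = ae_class P f \<and> f \<in> borel_measurable P"
  using sub[of X] by (auto elim!: L2_cases intro: sq_int_measurable)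

lemma mult_add_right:
  "\<lbrakk>u \<in> C X; v \<in> C X; v' \<in> C X\<rbrakk> \<Longrightarrow> cmul u (hadd HX v v') = hadd HX (cmul u v) (cmul u v')"
  by (drule C_fun, drule C_fun, drule C_fun) (auto simp: hadd_ae_class class_mult_ae_class distrib_left)

lemma mult_scale_right:
  "\<lbrakk>u \<in> C X; v \<in> C X\<rbrakk> \<Longrightarrow> cmul u (hscale HX c v) = hscale HX c (cmul u v)"
  by (drule C_fun, drule C_fun) (auto simp: hscale_ae_class class_mult_ae_class mult_ac)

lemma mult_scale_left:
  "\<lbrakk>u \<in> C X; v \<in> C X\<rbrakk> \<Longrightarrow> cmul (hscale HX c u) v = hscale HX c (cmul u v)"
  by (drule C_fun, drule C_fun) (auto simp: hscale_ae_class class_mult_ae_class mult_ac)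

lemma mult_one_left: "u \<in> C X \<Longrightarrow> cmul one u = u"
  by (drule C_fun) (auto simp: class_mult_ae_class)

lemma mult_one_right: "u \<in> C X \<Longrightarrow> cmul u one = u"
  by (drule C_fun) (auto simp: class_mult_ae_class)

lemma e_mult:
  assumes "A \<in> sets M" "h \<in> real_L2 M" "k \<in> real_L2 M" "\<forall>x\<in>X - A. h x = 0" "\<forall>x\<in>A. k x = 0"
  shows "e (\<lambda>x. h x + k x) = cmul (e h) (e k)"
proof -
  note [measurable] = E_meas_P[OF assms(2)] E_meas_P[OF assms(3)]
  show ?thesis unfolding e_def
    by (subst class_mult_ae_class, measurable, measurable, rule ae_class_cong)
      (use E_mult[OF assms] in eventually_elim, simp)
qed

lemma e_split:
  assumes A: "A \<in> sets M" and h: "h \<in> real_L2 M"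
  shows "e h = cmul (e (cut A h)) (e (cut (X - A) h))"
proof -
  have c: "cut A h \<in> real_L2 M" "cut (X - A) h \<in> real_L2 M" using A h by (auto intro: real_L2_cut)
  have "cmul (e (cut A h)) (e (cut (X - A) h)) = e (\<lambda>x. cut A h x + cut (X - A) h x)"
    using c A by (intro e_mult[symmetric]) (auto simp: cut_def)
  also have "\<dots> = e h" using h real_L2_add[OF c] by (intro e_cong) (auto simp: cut_def)
  finally show ?thesis by simp
qed

text \<open>This is conditional expectation given \<open>F A\<close>. It exists as an orthogonal
  projection because \<open>L2 P (F A)\<close> is itself complete, hence closed.\<close>

lemma projection_C:
  assumes A: "A \<in> sets M" and u: "u \<in> C X"
  shows "\<exists>p\<in>C A. \<forall>w\<in>C A. ip u w = ip p w"
proof -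
  interpret K: hilbert "L2 P (F A)" by (rule hilbert_C[OF A])
  note ops = L2_ops[of P "F A" "F X"]
  obtain p s where p: "p \<in> C X" "\<And>n::nat. s n \<in> C A" "(\<lambda>n. hnorm HX (diff (s n) p)) \<longlonglongrightarrow> 0"
    "\<And>v. v \<in> C A \<Longrightarrow> ip u v = ip p v"
    by (rule projection[of "C A", OF C_sub[OF A] K.carrier_nonempty _ _ u])
      (use K.add_closed K.scale_closed in \<open>auto simp: ops\<close>)
  have "p \<in> C A" by (rule limit_in_complete_subspace[OF K.hilbert_axioms C_sub[OF A] ops p(2,1,3)])
  then show ?thesis using p(4) by blast
qed

lemma e_cut_in: "\<lbrakk>A \<in> sets M; h \<in> real_L2 M\<rbrakk> \<Longrightarrow> e (cut A h) \<in> C A"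
  by (rule e_in[OF _ real_L2_cut]) (auto simp: cut_def)

lemma inner_mult_e:
  assumes A: "A \<in> sets M" and u: "u \<in> C A" and v: "v \<in> C (X - A)" and h: "h \<in> real_L2 M"
  shows "ip (cmul u v) (e h) = ip u (e (cut A h)) * ip v (e (cut (X - A) h))"
proof -
  have A': "X - A \<in> sets M" using A by auto
  show ?thesis
    by (subst e_split[OF A h], rule inner_mult[OF A u _ v])
      (use A A' h v in \<open>auto intro: e_cut_in\<close>)
qed

lemma inner_one_e: "h \<in> real_L2 M \<Longrightarrow> ip one (e h) = 1"
  unfolding one_eq by (simp add: inner_e real_L2_zero)

text \<open>For u over A, write u as the product of u with 1 and split the exponential. Conversely,
  a transform that only sees \<open>cut A h\<close> is that of the projection of u to
  \<open>C A\<close>, so u equals its projection.\<close>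

lemma mem_C_iff:
  assumes A: "A \<in> sets M" and u: "u \<in> C X"
  shows "u \<in> C A \<longleftrightarrow> (\<forall>h\<in>real_L2 M. ip u (e h) = ip u (e (cut A h)))"
proof
  have A': "X - A \<in> sets M" using A by auto
  assume uA: "u \<in> C A"
  show "\<forall>h\<in>real_L2 M. ip u (e h) = ip u (e (cut A h))"
  proof
    fix h assume h: "h \<in> real_L2 M"
    have "ip u (e h) = ip (cmul u one) (e h)" using u by (simp add: mult_one_right)
    also have "\<dots> = ip u (e (cut A h))"
      using h A A' by (subst inner_mult_e[OF A uA one_in[OF A'] h]) (simp add: inner_one_e real_L2_cut)
    finally show "ip u (e h) = ip u (e (cut A h))" .
  qed
next
  assume eq: "\<forall>h\<in>real_L2 M. ip u (e h) = ip u (e (cut A h))"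
  obtain p where p: "p \<in> C A" "\<And>w. w \<in> C A \<Longrightarrow> ip u w = ip p w" using projection_C[OF A u] by blast
  have A': "X - A \<in> sets M" using A by auto
  have "u = p"
  proof (rule X_ext)
    fix h assume h: "h \<in> real_L2 M"
    have "e (cut A h) \<in> C A" using A h by (rule e_cut_in)
    then have "ip u (e h) = ip p (e (cut A h))" using eq h p(2) by simp
    also have "\<dots> = ip (cmul p one) (e h)"
      using h A A' by (subst inner_mult_e[OF A p(1) one_in[OF A'] h]) (simp add: inner_one_e real_L2_cut)
    also have "\<dots> = ip p (e h)" using p(1) A by (simp add: mult_one_right)
    finally show "ip u (e h) = ip p (e h)" .
  qed (use u p A in auto)
  then show "u \<in> C A" using p by simp
qed

text \<open>Exponentials are real, so conjugating a functional conjugates its transform; a real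
  transform forces a representative to agree with its conjugate almost everywhere.\<close>

lemma real_subspace_iff:
  assumes u: "u \<in> C X"
  shows "u \<in> real_subspace P (F X) \<longleftrightarrow> (\<forall>h\<in>real_L2 M. ip u (e h) \<in> \<real>)"
proof
  obtain f where f: "u = ae_class P f" "f \<in> borel_measurable (F X)" "f \<in> sq_int P"
    using u sub[of X] by (auto elim!: L2_cases)
  { assume "u \<in> real_subspace P (F X)"
    then obtain g where g: "g \<in> u" "\<And>x. x \<in> space P \<Longrightarrow> g x \<in> \<real>" by (auto simp: real_subspace_def)
    have gP: "g \<in> borel_measurable P" "AE x in P. g x = f x" using g f by (auto simp: ae_class_def)
    have g2: "g \<in> sq_int P" by (rule sq_int_AE_cong[OF f(3) gP])
    have ug: "u = ae_class P g" unfolding f by (rule ae_class_cong) (use gP(2) in eventually_elim, simp)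
    show "\<forall>h\<in>real_L2 M. ip u (e h) \<in> \<real>"
    proof
      fix h assume h: "h \<in> real_L2 M"
      have "ip u (e h) = (\<integral>\<omega>. g \<omega> * complex_of_real (E h \<omega>) \<partial>P)"
        unfolding ug by (rule inner_e_fun[OF g2 h])
      also have "\<dots> = (\<integral>\<omega>. complex_of_real (Re (g \<omega>) * E h \<omega>) \<partial>P)"
        by (rule Bochner_Integration.integral_cong) (use g(2) in auto)
      also have "\<dots> \<in> \<real>" by (simp del: of_real_mult)
      finally show "ip u (e h) \<in> \<real>" .
    qed }
  assume r: "\<forall>h\<in>real_L2 M. ip u (e h) \<in> \<real>"
  have fc: "(\<lambda>\<omega>. cnj (f \<omega>)) \<in> sq_int P" "(\<lambda>\<omega>. cnj (f \<omega>)) \<in> borel_measurable (F X)"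
    using f by (auto intro: sq_int_cnj)
  have "ae_class P f = ae_class P (\<lambda>\<omega>. cnj (f \<omega>))"
  proof (rule X_ext)
    fix h assume h: "h \<in> real_L2 M"
    have "ip (ae_class P (\<lambda>\<omega>. cnj (f \<omega>))) (e h) = (\<integral>\<omega>. cnj (f \<omega> * complex_of_real (E h \<omega>)) \<partial>P)"
      by (simp add: inner_e_fun[OF fc(1) h])
    also have "\<dots> = cnj (ip u (e h))" unfolding f by (subst Bochner_Integration.integral_cnj) (simp add: inner_e_fun[OF f(3) h])
    also have "\<dots> = ip u (e h)" using r h by (simp add: Reals_cnj_iff)
    finally show "ip (ae_class P f) (e h) = ip (ae_class P (\<lambda>\<omega>. cnj (f \<omega>))) (e h)" by (simp add: f)
  qed (use f fc in \<open>auto intro!: L2_memI sub\<close>)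
  then have "AE \<omega> in P. f \<omega> = cnj (f \<omega>)"
    using ae_class_eq_iff[of f P] f(3) fc(1) by (auto dest: sq_int_measurable)
  then have "AE \<omega> in P. complex_of_real (Re (f \<omega>)) = f \<omega>"
    by eventually_elim (auto simp: complex_eq_iff)
  then have "(\<lambda>\<omega>. complex_of_real (Re (f \<omega>))) \<in> u"
    unfolding f using sq_int_measurable[OF f(3)] by (auto simp: ae_class_def)
  then show "u \<in> real_subspace P (F X)"
    using u unfolding real_subspace_def by (intro CollectI conjI bexI) auto
qed

end

section \<open>Transport between two systems of exponentials\<close>

lemma linear_isometry_inner:
  assumes H: "hilbert H" and K: "hilbert K" and T: "T \<in> linear_ops H K"
    and iso: "\<And>u. u \<in> hcarrier H \<Longrightarrow> hnorm K (T u) = hnorm H u"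
    and u: "u \<in> hcarrier H" and v: "v \<in> hcarrier H"
  shows "hinner K (T u) (T v) = hinner H u v"
proof -
  interpret H: hilbert H by (rule H)
  interpret K: hilbert K by (rule K)
  have TK [simp]: "T w \<in> hcarrier K" if "w \<in> hcarrier H" for w using T that by (auto simp: linear_ops_def)
  have add: "T (hadd H u v) = hadd K (T u) (T v)" if "u \<in> hcarrier H" "v \<in> hcarrier H" for u v
    using T that by (simp add: linear_ops_def)
  have scale: "T (hscale H c u) = hscale K c (T u)" if "u \<in> hcarrier H" for c u
    using T that by (simp add: linear_ops_def)
  have re: "Re (hinner K (T u) (T v)) = Re (hinner H u v)" if "u \<in> hcarrier H" "v \<in> hcarrier H" for u v
    using iso[of "hadd H u v"] iso[of u] iso[of v] that H.norm_sq_add[OF that]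
      K.norm_sq_add[of "T u" "T v"] by (simp add: add)
  \<comment> \<open>The imaginary part of z is the real part of -\<i> z.\<close>
  have "Im (hinner K (T u) (T v)) = Im (hinner H u v)"
    using re[of "hscale H (-\<i>) u" v] u v by (simp add: scale)
  then show ?thesis using re[OF u v] by (simp add: complex_eq_iff)
qed

lemma linear_isometry_inj:
  assumes H: "hilbert H" and K: "hilbert K" and T: "T \<in> linear_ops H K"
    and iso: "\<And>u. u \<in> hcarrier H \<Longrightarrow> hnorm K (T u) = hnorm H u"
  shows "inj_on T (hcarrier H)"
proof (rule inj_onI)
  interpret H: hilbert H by (rule H)
  interpret K: hilbert K by (rule K)
  fix u v assume u: "u \<in> hcarrier H" and v: "v \<in> hcarrier H" and eq: "T u = T v"
  show "u = v"
  proof (rule H.inner_ext[OF u v])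
    fix w assume w: "w \<in> hcarrier H"
    show "hinner H u w = hinner H v w"
      using linear_isometry_inner[OF assms u w] linear_isometry_inner[OF assms v w] eq by simp
  qed
qed

locale fock_pair = a: fock_space M P F E + b: fock_space M Q G D
  for M :: "'a measure" and P :: "'s measure" and F E and Q :: "'t measure" and G D
begin

text \<open>Linear extension of the correspondence between exponentials, as a relation: a
  combination may have several representations, and only the equality of inner products shows that
  the relation is single-valued.\<close>

inductive span_graph :: "('s \<Rightarrow> complex) set \<Rightarrow> ('t \<Rightarrow> complex) set \<Rightarrow> bool" where
  base: "h \<in> real_L2 M \<Longrightarrow> span_graph (a.e h) (b.e h)"
| add: "span_graph u v \<Longrightarrow> span_graph u' v' \<Longrightarrow> span_graph (hadd a.HX u u') (hadd b.HX v v')"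
| scale: "span_graph u v \<Longrightarrow> span_graph (hscale a.HX c u) (hscale b.HX c v)"

lemma span_graph_in: "span_graph u v \<Longrightarrow> u \<in> a.C a.X \<and> v \<in> b.C a.X"
  by (induction rule: span_graph.induct) auto

lemma span_graph_transform:
  "span_graph u v \<Longrightarrow> k \<in> real_L2 M \<Longrightarrow> a.ip u (a.e k) = b.ip v (b.e k)"
  by (induction rule: span_graph.induct) (auto simp: a.inner_e b.inner_e dest!: span_graph_in)

lemma span_graph_inner:
  assumes "span_graph u v" "span_graph u' v'" shows "a.ip u u' = b.ip v v'"
  using assms(1)
proof (induction rule: span_graph.induct)
  case (base h)
  then show ?case using span_graph_in[OF assms(2)] span_graph_transform[OF assms(2)]
    by (simp add: a.inner_commute[of u' "a.e h"] b.inner_commute[of v' "b.e h"])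
qed (use span_graph_in[OF assms(2)] in \<open>auto dest!: span_graph_in\<close>)

lemma span_graph_norm_diff:
  assumes "span_graph u v" "span_graph u' v'"
  shows "hnorm a.HX (a.diff u u') = hnorm b.HX (b.diff v v')"
proof -
  have "span_graph (a.diff u u') (b.diff v v')" using assms by (intro span_graph.intros)
  then show ?thesis unfolding hnorm_def using span_graph_inner by simp
qed

text \<open>The span of the exponentials is dense, since u and its projection to the closure have
  the same transform. Corresponding combinations on the other side are Cauchy because the relation
  preserves distances, and transform and norm pass to the limit.\<close>

lemma partner:
  assumes u: "u \<in> a.C a.X"
  shows "\<exists>v\<in>b.C a.X. (\<forall>h\<in>real_L2 M. b.ip v (b.e h) = a.ip u (a.e h)) \<and> hnorm b.HX v = hnorm a.HX u"
proof -
  let ?V = "{u. \<exists>v. span_graph u v}"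
  obtain p s where p: "p \<in> a.C a.X" and s: "\<And>n::nat. s n \<in> ?V"
    and lim: "(\<lambda>n. hnorm a.HX (a.diff (s n) p)) \<longlonglongrightarrow> 0" and orth: "\<And>w. w \<in> ?V \<Longrightarrow> a.ip u w = a.ip p w"
  proof (rule a.projection[of ?V u])
    show "?V \<noteq> {}" using span_graph.base[OF real_L2_zero] by blast
  qed (use u span_graph_in in \<open>auto intro: span_graph.intros\<close>)
  have up: "u = p"
    by (rule a.X_ext[OF u p], rule orth) (auto intro: span_graph.base)
  have "\<forall>n. \<exists>v. span_graph (s n) v" using s by blast
  then obtain t where t: "\<And>n. span_graph (s n) (t n)" by metis
  have sC: "s n \<in> a.C a.X" and tC: "t n \<in> b.C a.X" for n using span_graph_in[OF t] by auto
  have "\<exists>v\<in>b.C a.X. (\<lambda>n. hnorm b.HX (b.diff (t n) v)) \<longlonglongrightarrow> 0"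
    using a.convergent_imp_Cauchy[OF sC p lim] by (intro b.complete tC) (simp add: span_graph_norm_diff[OF t t])
  then obtain v where v: "v \<in> b.C a.X" and vlim: "(\<lambda>n. hnorm b.HX (b.diff (t n) v)) \<longlonglongrightarrow> 0" by blast
  have "b.ip v (b.e h) = a.ip u (a.e h)" if h: "h \<in> real_L2 M" for h
  proof (rule LIMSEQ_unique)
    show "(\<lambda>n. b.ip (t n) (b.e h)) \<longlonglongrightarrow> b.ip v (b.e h)" using h by (intro b.inner_tendsto tC v vlim) auto
    show "(\<lambda>n. b.ip (t n) (b.e h)) \<longlonglongrightarrow> a.ip u (a.e h)"
      unfolding up span_graph_transform[OF t h, symmetric] using h by (intro a.inner_tendsto sC p lim) auto
  qed
  moreover have "hnorm b.HX v = hnorm a.HX u"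
  proof (rule LIMSEQ_unique)
    show "(\<lambda>n. hnorm b.HX (t n)) \<longlonglongrightarrow> hnorm b.HX v" by (rule b.norm_tendsto[OF tC v vlim])
    have "hnorm b.HX (t n) = hnorm a.HX (s n)" for n
      unfolding hnorm_def using span_graph_inner[OF t t] by simp
    then show "(\<lambda>n. hnorm b.HX (t n)) \<longlonglongrightarrow> hnorm a.HX u"
      unfolding up using a.norm_tendsto[OF sC p lim] by simp
  qed
  ultimately show ?thesis using v by blast
qed

text \<open>The choice is unambiguous by \<open>b.X_ext\<close>. The norm is included because
  \<open>partner\<close> obtains it from the approximation rather than from the transform;
  \<open>restrict\<close> makes the map extensional, as \<open>linear_ops\<close> demands.\<close>

definition "transport = restrict (\<lambda>u. SOME v. v \<in> b.C a.X \<and> (\<forall>h\<in>real_L2 M. b.ip v (b.e h) = a.ip u (a.e h)) \<and>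
    hnorm b.HX v = hnorm a.HX u) (a.C a.X)"

lemma transport:
  assumes u: "u \<in> a.C a.X"
  shows "transport u \<in> b.C a.X" "h \<in> real_L2 M \<Longrightarrow> b.ip (transport u) (b.e h) = a.ip u (a.e h)"
    "hnorm b.HX (transport u) = hnorm a.HX u"
proof -
  have "\<exists>v. v \<in> b.C a.X \<and> (\<forall>h\<in>real_L2 M. b.ip v (b.e h) = a.ip u (a.e h)) \<and> hnorm b.HX v = hnorm a.HX u"
    using partner[OF u] by blast
  from someI_ex[OF this] show "transport u \<in> b.C a.X" "h \<in> real_L2 M \<Longrightarrow> b.ip (transport u) (b.e h) = a.ip u (a.e h)"
    "hnorm b.HX (transport u) = hnorm a.HX u"
    using u by (auto simp: transport_def)
qed

text \<open>Linearity, surjectivity, the unit and compatibility with products are all reduced by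
  this to a comparison of transforms.\<close>

lemma transport_eqI:
  assumes "u \<in> a.C a.X" "v \<in> b.C a.X" "\<And>h. h \<in> real_L2 M \<Longrightarrow> b.ip v (b.e h) = a.ip u (a.e h)"
  shows "transport u = v"
  by (rule b.X_ext[OF transport(1)[OF assms(1)] assms(2)]) (simp add: transport(2)[OF assms(1)] assms(3))

lemma transport_e: "h \<in> real_L2 M \<Longrightarrow> transport (a.e h) = b.e h"
  by (rule transport_eqI) (auto simp: a.inner_e b.inner_e)

lemma transport_linear: "transport \<in> linear_ops a.HX b.HX"
proof -
  have "transport \<in> a.C a.X \<rightarrow>\<^sub>E b.C a.X" using transport(1) by (auto simp: transport_def)
  then show ?thesis unfolding linear_ops_def
    by (intro CollectI conjI ballI allI transport_eqI) (auto simp: transport)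
qed

text \<open>Restates compatibility with the factorizations on the level of functionals: subspaces
  over A and products across complementary sets, with no operator algebras. In this form it passes
  easily to the inverse.\<close>

definition mult_iso :: "(('s \<Rightarrow> complex) set \<Rightarrow> ('t \<Rightarrow> complex) set) \<Rightarrow> bool" where
  "mult_iso T \<longleftrightarrow> T \<in> linear_ops a.HX b.HX \<and> (\<forall>u\<in>a.C a.X. hnorm b.HX (T u) = hnorm a.HX u) \<and>
     T ` a.C a.X = b.C a.X \<and> (\<forall>A\<in>sets M. \<forall>u\<in>a.C a.X. u \<in> a.C A \<longleftrightarrow> T u \<in> b.C A) \<and>
     (\<forall>A\<in>sets M. \<forall>u\<in>a.C A. \<forall>v\<in>a.C (a.X - A). T (class_mult P u v) = class_mult Q (T u) (T v))"

lemma mult_isoD: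
  assumes "mult_iso T"
  shows "T \<in> linear_ops a.HX b.HX" "u \<in> a.C a.X \<Longrightarrow> hnorm b.HX (T u) = hnorm a.HX u"
    "T ` a.C a.X = b.C a.X" "\<lbrakk>A \<in> sets M; u \<in> a.C a.X\<rbrakk> \<Longrightarrow> u \<in> a.C A \<longleftrightarrow> T u \<in> b.C A"
    "\<lbrakk>A \<in> sets M; u \<in> a.C A; v \<in> a.C (a.X - A)\<rbrakk> \<Longrightarrow> T (class_mult P u v) = class_mult Q (T u) (T v)"
proof -
  note d = assms[unfolded mult_iso_def]
  note c = d[THEN conjunct1] d[THEN conjunct2, THEN conjunct1] d[THEN conjunct2, THEN conjunct2, THEN conjunct1]
    d[THEN conjunct2, THEN conjunct2, THEN conjunct2, THEN conjunct1]
    d[THEN conjunct2, THEN conjunct2, THEN conjunct2, THEN conjunct2]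
  show "T \<in> linear_ops a.HX b.HX" by (rule c(1))
  show "u \<in> a.C a.X \<Longrightarrow> hnorm b.HX (T u) = hnorm a.HX u" by (rule bspec[OF c(2)])
  show "T ` a.C a.X = b.C a.X" by (rule c(3))
  show "\<lbrakk>A \<in> sets M; u \<in> a.C a.X\<rbrakk> \<Longrightarrow> u \<in> a.C A \<longleftrightarrow> T u \<in> b.C A" by (rule bspec[OF bspec[OF c(4)]])
  show "\<lbrakk>A \<in> sets M; u \<in> a.C A; v \<in> a.C (a.X - A)\<rbrakk> \<Longrightarrow> T (class_mult P u v) = class_mult Q (T u) (T v)"
    by (rule bspec[OF bspec[OF bspec[OF c(5)]]])
qed

end

text \<open>Exchanges the roles of the two processes, so that results about one direction apply to
  the inverse map.\<close>

sublocale fock_pair \<subseteq> swap: fock_pair M Q G D P F E ..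

section \<open>Structure preserved by the transport map\<close>

context fock_pair begin

lemma transport_onto: "transport ` a.C a.X = b.C a.X"
proof (intro equalityI subsetI)
  fix v assume v: "v \<in> b.C a.X"
  obtain u where "u \<in> a.C a.X" "\<forall>h\<in>real_L2 M. a.ip u (a.e h) = b.ip v (b.e h)"
    using swap.partner[OF v] by blast
  then have "transport u = v" using v by (intro transport_eqI) auto
  then show "v \<in> transport ` a.C a.X" using \<open>u \<in> a.C a.X\<close> by blast
qed (auto simp: transport(1))

lemma transport_mem:
  assumes A: "A \<in> sets M" and u: "u \<in> a.C a.X" shows "u \<in> a.C A \<longleftrightarrow> transport u \<in> b.C A"
  unfolding a.mem_C_iff[OF A u] b.mem_C_iff[OF A transport(1)[OF u]]
  using transport(2)[OF u] A by (simp add: real_L2_cut)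

lemma transport_mult:
  assumes A: "A \<in> sets M" and u: "u \<in> a.C A" and v: "v \<in> a.C (a.X - A)"
  shows "transport (class_mult P u v) = class_mult Q (transport u) (transport v)"
proof (rule transport_eqI)
  have A': "a.X - A \<in> sets M" using A by auto
  note uX = a.C_subD[OF A u] and vX = a.C_subD[OF A' v]
  have Tu: "transport u \<in> b.C A" and Tv: "transport v \<in> b.C (a.X - A)"
    using transport_mem[OF A uX] transport_mem[OF A' vX] u v by auto
  show "class_mult P u v \<in> a.C a.X" by (rule a.mult_in[OF A u v])
  show "class_mult Q (transport u) (transport v) \<in> b.C a.X" by (rule b.mult_in[OF A Tu Tv])
  fix h assume h: "h \<in> real_L2 M"
  show "b.ip (class_mult Q (transport u) (transport v)) (b.e h) = a.ip (class_mult P u v) (a.e h)"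
    using A A' h by (simp add: b.inner_mult_e[OF A Tu Tv h] a.inner_mult_e[OF A u v h] transport(2) uX vX real_L2_cut)
qed

lemma transport_mult_iso: "mult_iso transport"
  unfolding mult_iso_def
  by (intro conjI ballI transport_linear transport(3) transport_onto transport_mem transport_mult)

lemma transport_real: "transport ` real_subspace P (F a.X) = real_subspace Q (G a.X)"
proof -
  have iff: "transport u \<in> real_subspace Q (G a.X) \<longleftrightarrow> u \<in> real_subspace P (F a.X)" if u: "u \<in> a.C a.X" for u
    using transport(2)[OF u] by (simp add: a.real_subspace_iff[OF u] b.real_subspace_iff[OF transport(1)[OF u]])
  have sub: "real_subspace P (F a.X) \<subseteq> a.C a.X" "real_subspace Q (G a.X) \<subseteq> b.C a.X"
    by (auto simp: real_subspace_def)
  show ?thesis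
  proof (intro equalityI subsetI)
    fix v assume "v \<in> transport ` real_subspace P (F a.X)"
    then show "v \<in> real_subspace Q (G a.X)" using iff sub(1) by (elim imageE) (simp add: subsetD)
  next
    fix v assume v: "v \<in> real_subspace Q (G a.X)"
    then have "v \<in> transport ` a.C a.X" using sub(2) transport_onto by (simp add: subsetD)
    then obtain u where u: "u \<in> a.C a.X" "v = transport u" by (elim imageE)
    then show "v \<in> transport ` real_subspace P (F a.X)" using iff[OF u(1)] v by (simp add: imageI)
  qed
qed

lemma transport_one: "transport a.one = b.one"
  by (simp add: a.one_eq b.one_eq transport_e real_L2_zero)

lemma mult_iso_inverse:
  assumes T: "mult_iso T"
  defines "T' \<equiv> restrict (inv_into (a.C a.X) T) (b.C a.X)"
  shows "swap.mult_iso T'" and "u \<in> a.C a.X \<Longrightarrow> T' (T u) = u" and "v \<in> b.C a.X \<Longrightarrow> T (T' v) = v"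
proof -
  note lin = mult_isoD(1)[OF T] and iso = mult_isoD(2)[OF T] and onto = mult_isoD(3)[OF T]
    and mem = mult_isoD(4)[OF T] and mul = mult_isoD(5)[OF T]
  have inj: "inj_on T (a.C a.X)" by (rule linear_isometry_inj[OF a.hilbert_axioms b.hilbert_axioms lin iso])
  have TC: "T u \<in> b.C a.X" if "u \<in> a.C a.X" for u using onto that by blast
  show T'T: "T' (T u) = u" if "u \<in> a.C a.X" for u using inj that TC[OF that] by (simp add: T'_def)
  show TT': "T (T' v) = v" if "v \<in> b.C a.X" for v using that onto by (simp add: T'_def f_inv_into_f)
  have T'C: "T' v \<in> a.C a.X" if "v \<in> b.C a.X" for v using that onto by (simp add: T'_def inv_into_into)
  have eqI: "T' v = u" if "u \<in> a.C a.X" "T u = v" for u v using T'T that by blast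
  have Tadd: "T (hadd a.HX u v) = hadd b.HX (T u) (T v)" if "u \<in> a.C a.X" "v \<in> a.C a.X" for u v
    using lin that by (simp add: linear_ops_def)
  have Tscale: "T (hscale a.HX c u) = hscale b.HX c (T u)" if "u \<in> a.C a.X" for c u
    using lin that by (simp add: linear_ops_def)
  show "swap.mult_iso T'"
    unfolding swap.mult_iso_def
  proof (intro conjI ballI)
    have "T' \<in> b.C a.X \<rightarrow>\<^sub>E a.C a.X" using T'C by (auto simp: T'_def)
    then show "T' \<in> linear_ops b.HX a.HX"
      unfolding linear_ops_def by (intro CollectI conjI ballI allI eqI) (auto simp: T'C TT' Tadd Tscale)
    show "T' ` b.C a.X = a.C a.X" using T'C T'T TC by force
    show "hnorm a.HX (T' v) = hnorm b.HX v" if "v \<in> b.C a.X" for v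
      using iso[OF T'C[OF that]] TT'[OF that] by simp
    show mem': "v \<in> b.C A \<longleftrightarrow> T' v \<in> a.C A" if "A \<in> sets M" "v \<in> b.C a.X" for A v
      using mem[OF that(1) T'C[OF that(2)]] TT'[OF that(2)] by simp
    fix A u v assume A: "A \<in> sets M" and u: "u \<in> b.C A" and v: "v \<in> b.C (a.X - A)"
    have A': "a.X - A \<in> sets M" using A by auto
    note uX = b.C_subD[OF A u] b.C_subD[OF A' v]
    have T'u: "T' u \<in> a.C A" "T' v \<in> a.C (a.X - A)"
      using mem'[OF A uX(1)] mem'[OF A' uX(2)] u v by blast+
    show "T' (class_mult Q u v) = class_mult P (T' u) (T' v)"
      by (rule eqI[OF a.mult_in[OF A T'u]]) (simp add: mul[OF A T'u] TT' uX)
  qed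
qed

text \<open>Both T and its inverse respect products across A and its complement, so conjugating R
  \<otimes> 1 by T only conjugates R by the restriction of T to the functionals over A.\<close>

lemma mult_iso_conjugate_mem:
  assumes T: "mult_iso T" and A: "A \<in> sets M" and S: "S \<in> factorization M P F A"
  shows "conjugate_op a.HX b.HX T S \<in> factorization M Q G A"
proof -
  define T' where "T' = restrict (inv_into (a.C a.X) T) (b.C a.X)"
  have A': "a.X - A \<in> sets M" using A by auto
  note inv = mult_iso_inverse[OF T, folded T'_def]
  note lin = mult_isoD(1)[OF T] and iso = mult_isoD(2)[OF T] and onto = mult_isoD(3)[OF T]
    and mem = mult_isoD(4)[OF T] and mul = mult_isoD(5)[OF T]
  note lin' = swap.mult_isoD(1)[OF inv(1)] and iso' = swap.mult_isoD(2)[OF inv(1)]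
    and onto' = swap.mult_isoD(3)[OF inv(1)] and mem' = swap.mult_isoD(4)[OF inv(1)]
    and mul' = swap.mult_isoD(5)[OF inv(1)]
  have TC: "T u \<in> b.C a.X" if "u \<in> a.C a.X" for u using onto that by blast
  have T'C: "T' u \<in> a.C a.X" if "u \<in> b.C a.X" for u using onto' that by blast
  have Tadd: "T (hadd a.HX u v) = hadd b.HX (T u) (T v)" if "u \<in> a.C a.X" "v \<in> a.C a.X" for u v
    using lin that by (simp add: linear_ops_def)
  have Tscale: "T (hscale a.HX c u) = hscale b.HX c (T u)" if "u \<in> a.C a.X" for c u
    using lin that by (simp add: linear_ops_def)
  have T'add: "T' (hadd b.HX u v) = hadd a.HX (T' u) (T' v)" if "u \<in> b.C a.X" "v \<in> b.C a.X" for u v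
    using lin' that by (simp add: linear_ops_def)
  have T'scale: "T' (hscale b.HX c u) = hscale a.HX c (T' u)" if "u \<in> b.C a.X" for c u
    using lin' that by (simp add: linear_ops_def)
  obtain R where Sb: "S \<in> bounded_ops a.HX" and Rb: "R \<in> bounded_ops (L2 P (F A))"
    and SR: "\<And>u v. u \<in> a.C A \<Longrightarrow> v \<in> a.C (a.X - A) \<Longrightarrow> S (class_mult P u v) = class_mult P (R u) v"
    using S by (auto simp: factorization_def)
  note opsP = L2_ops[of P "F A" "F a.X"] and opsQ = L2_ops[of Q "G A" "G a.X"]
  have nP: "hnorm (L2 P (F A)) = hnorm a.HX" and nQ: "hnorm (L2 Q (G A)) = hnorm b.HX"
    by (auto simp: hnorm_def opsP opsQ)
  have S1: "S u \<in> a.C a.X" "S (hscale a.HX c u) = hscale a.HX c (S u)" if "u \<in> a.C a.X" for u c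
    using Sb that by (auto simp: bounded_ops_def linear_ops_def)
  have S2: "S (hadd a.HX u v) = hadd a.HX (S u) (S v)" if "u \<in> a.C a.X" "v \<in> a.C a.X" for u v
    using Sb that by (simp add: bounded_ops_def linear_ops_def)
  have R1: "R u \<in> a.C A" "R (hscale a.HX c u) = hscale a.HX c (R u)" if "u \<in> a.C A" for u c
    using Rb that by (auto simp: bounded_ops_def linear_ops_def opsP)
  have R2: "R (hadd a.HX u v) = hadd a.HX (R u) (R v)" if "u \<in> a.C A" "v \<in> a.C A" for u v
    using Rb that by (simp add: bounded_ops_def linear_ops_def opsP)
  let ?S = "conjugate_op a.HX b.HX T S"
  \<comment> \<open>The operator on the factor over A that witnesses membership of the
    conjugate.\<close>
  define R' where "R' = restrict (\<lambda>v. T (R (T' v))) (b.C A)"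
  have S_eq: "?S v = T (S (T' v))" if "v \<in> b.C a.X" for v using that by (simp add: conjugate_op_def T'_def)
  have hC: "hadd b.HX u v \<in> b.C A" "hscale b.HX c u \<in> b.C A" if "u \<in> b.C A" "v \<in> b.C A" for u v c
    using hilbert.add_closed[OF b.hilbert_C[OF A] that] hilbert.scale_closed[OF b.hilbert_C[OF A] that(1)] by (auto simp: opsQ)
  have bA: "u \<in> b.C a.X" if "u \<in> b.C A" for u using that A by simp
  have aA: "u \<in> a.C a.X" if "u \<in> a.C A" for u using that A by simp
  have T'A: "T' v \<in> a.C A" if "v \<in> b.C A" for v using mem'[OF A bA[OF that]] that by simp
  have RT': "T (R (T' v)) \<in> b.C A" if "v \<in> b.C A" for v
    using mem[OF A aA[OF R1(1)[OF T'A[OF that]]]] R1(1)[OF T'A[OF that]] by simp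
  show ?thesis unfolding factorization_def
  proof (intro CollectI conjI bexI ballI)
    show "?S \<in> bounded_ops b.HX"
    proof -
      have "?S \<in> linear_ops b.HX b.HX" unfolding linear_ops_def
        by (intro CollectI conjI ballI allI PiE_I)
          (simp_all add: S_eq T'C TC S1 S2 Tadd Tscale T'add T'scale, simp add: conjugate_op_def)
      moreover obtain c where c: "\<And>u. u \<in> a.C a.X \<Longrightarrow> hnorm a.HX (S u) \<le> c * hnorm a.HX u"
        using Sb by (auto simp: bounded_ops_def)
      have "hnorm b.HX (?S v) \<le> c * hnorm b.HX v" if v: "v \<in> b.C a.X" for v
        using c[OF T'C[OF v]] v by (simp add: S_eq iso S1(1) T'C iso' T'C)
      ultimately show ?thesis by (auto simp: bounded_ops_def)
    qed
    show "R' \<in> bounded_ops (L2 Q (G A))"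
    proof -
      have "R' \<in> linear_ops (L2 Q (G A)) (L2 Q (G A))" unfolding linear_ops_def opsQ
        by (auto simp: R'_def RT' hC bA aA T'A T'add T'scale R1 R2 Tadd Tscale)
      moreover obtain c where c: "\<And>u. u \<in> a.C A \<Longrightarrow> hnorm a.HX (R u) \<le> c * hnorm a.HX u"
        using Rb by (auto simp: bounded_ops_def nP)
      have "hnorm b.HX (R' v) \<le> c * hnorm b.HX v" if v: "v \<in> b.C A" for v
        using c[OF T'A[OF v]] v by (simp add: R'_def iso aA R1(1)[OF T'A] iso' bA)
      ultimately show ?thesis by (auto simp: bounded_ops_def nQ)
    qed
    fix u v assume u: "u \<in> b.C A" and v: "v \<in> b.C (a.X - A)"
    have vX: "v \<in> b.C a.X" using v A' by simp
    have T'v: "T' v \<in> a.C (a.X - A)" using mem'[OF A' vX] v by simp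
    show "?S (class_mult Q u v) = class_mult Q (R' u) v"
      using u v by (simp add: S_eq b.mult_in[OF A] mul'[OF A] SR T'A T'v mul[OF A R1(1)[OF T'A]] R'_def inv(3) vX)
  qed
qed

end

section \<open>From multiplicative isometries to special isomorphisms\<close>

context fock_pair begin

text \<open>One inclusion of algebras is \<open>mult_iso_conjugate_mem\<close>; the other is the
  same lemma for the inverse. Conjugating back returns S' itself because operators are
  extensional.\<close>

lemma mult_iso_special:
  assumes T: "mult_iso T"
  shows "special_isomorphism M a.HX (factorization M P F) b.HX (factorization M Q G) T"
proof -
  define T' where "T' = restrict (inv_into (a.C a.X) T) (b.C a.X)"
  note inv = mult_iso_inverse[OF T, folded T'_def]
  have inj': "inj_on T' (b.C a.X)" and onto': "T' ` b.C a.X = a.C a.X"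
    using inv(3) by (auto intro: inj_on_inverseI simp: swap.mult_isoD(3)[OF inv(1)])
  have "conjugate_op a.HX b.HX T ` factorization M P F A = factorization M Q G A" if A: "A \<in> sets M" for A
  proof (intro equalityI subsetI)
    fix S' assume S': "S' \<in> factorization M Q G A"
    let ?S = "conjugate_op b.HX a.HX T' S'"
    have "?S \<in> factorization M P F A" by (rule swap.mult_iso_conjugate_mem[OF inv(1) A S'])
    moreover have "conjugate_op a.HX b.HX T ?S = S'"
    proof (rule ext)
      fix v
      have ext: "S' \<in> b.C a.X \<rightarrow>\<^sub>E b.C a.X" using S' by (auto simp: factorization_def bounded_ops_def linear_ops_def)
      show "conjugate_op a.HX b.HX T ?S v = S' v"
      proof (cases "v \<in> b.C a.X")
        case True
        then have T'v: "inv_into (a.C a.X) T v = T' v" "T' v \<in> a.C a.X" using onto' by (auto simp: T'_def)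
        have S'v: "S' v \<in> b.C a.X" using ext True by auto
        show ?thesis using True T'v inj' S'v by (simp add: conjugate_op_def inv(3))
      next
        case False
        then show ?thesis using ext by (auto simp: conjugate_op_def PiE_def extensional_def)
      qed
    qed
    ultimately show "S' \<in> conjugate_op a.HX b.HX T ` factorization M P F A" by force
  qed (use mult_iso_conjugate_mem[OF T A] in auto)
  then show ?thesis unfolding special_isomorphism_def
    by (intro conjI ballI mult_isoD(1-3)[OF T])
qed

end

section \<open>Products seen by a factorization\<close>

context fock_space begin

definition "proj A z = (SOME p. p \<in> C A \<and> (\<forall>w\<in>C A. ip z w = ip p w))"

lemma proj:
  assumes A: "A \<in> sets M" and z: "z \<in> C X"
  shows "proj A z \<in> C A" "w \<in> C A \<Longrightarrow> ip (proj A z) w = ip z w"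
proof -
  have "\<exists>p. p \<in> C A \<and> (\<forall>w\<in>C A. ip z w = ip p w)" using projection_C[OF A z] by blast
  from someI_ex[OF this] show "proj A z \<in> C A" "w \<in> C A \<Longrightarrow> ip (proj A z) w = ip z w"
    unfolding proj_def by auto
qed

lemma proj_eqI:
  assumes A: "A \<in> sets M" and z: "z \<in> C X" and p: "p \<in> C A" "\<And>w. w \<in> C A \<Longrightarrow> ip z w = ip p w"
  shows "proj A z = p"
  by (rule C_ext[OF A proj(1)[OF A z] p(1)]) (simp add: proj(2)[OF A z] p(2) e_in[OF A])

lemma proj_norm_le:
  assumes A: "A \<in> sets M" and z: "z \<in> C X"
  shows "hnorm HX (proj A z) \<le> hnorm HX z"
proof -
  let ?p = "proj A z"
  have pA: "?p \<in> C A" by (rule proj(1)[OF A z])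
  note p = C_subD[OF A pA]
  have "ip z ?p = complex_of_real ((hnorm HX ?p)\<^sup>2)"
    using proj(2)[OF A z pA] inner_self[OF p] by (simp only:)
  then have "(hnorm HX ?p)\<^sup>2 = cmod (ip z ?p)" by (simp only: norm_of_real abs_power2)
  also have "\<dots> \<le> hnorm HX z * hnorm HX ?p" by (rule Cauchy_Schwarz[OF z p])
  finally have "hnorm HX ?p * hnorm HX ?p \<le> hnorm HX z * hnorm HX ?p" by (simp only: power2_eq_square)
  then show ?thesis using norm_nonneg[OF p] norm_nonneg[OF z]
    by (cases "hnorm HX ?p = 0") (auto simp: mult_le_cancel_right)
qed

text \<open>The rank one operators \<open>x \<mapsto> \<langle>x, 1\<rangle> u\<close> on \<open>H\<^sub>A\<close>, tensored with the identity, send \<open>1\<close> to \<open>u\<close>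
  and \<open>v\<close> to \<open>u v\<close>; they let an isomorphism of factorizations see products.\<close>

lemma rank_one_in_factorization:
  assumes A: "A \<in> sets M" and u: "u \<in> C A"
  shows "\<exists>S\<in>factorization M P F A. \<forall>v\<in>C (X - A). S v = cmul u v"
proof
  have A': "X - A \<in> sets M" using A by auto
  note uX = C_subD[OF A u]
  define S where "S = restrict (\<lambda>z. cmul u (proj (X - A) z)) (C X)"
  define R where "R = restrict (\<lambda>x. hscale HX (ip x one) u) (C A)"
  interpret KA: hilbert "L2 P (F A)" by (rule hilbert_C[OF A])
  interpret KA': hilbert "L2 P (F (X - A))" by (rule hilbert_C[OF A'])
  note ops = L2_ops[of P "F A" "F X"] and ops' = L2_ops[of P "F (X - A)" "F X"]
  note oneX = C_subD[OF A one_in[OF A]]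
  have nA: "hnorm (L2 P (F A)) = hnorm HX" by (auto simp: hnorm_def ops)
  have pX: "proj (X - A) z \<in> C X" if "z \<in> C X" for z using C_subD[OF A' proj(1)[OF A' that]] .
  have padd: "proj (X - A) (hadd HX y z) = hadd HX (proj (X - A) y) (proj (X - A) z)"
    if "y \<in> C X" "z \<in> C X" for y z
  proof (rule proj_eqI[OF A'])
    show "hadd HX (proj (X - A) y) (proj (X - A) z) \<in> C (X - A)"
      using KA'.add_closed[OF proj(1)[OF A' that(1)] proj(1)[OF A' that(2)]] by (simp add: ops')
    fix w assume "w \<in> C (X - A)"
    then show "ip (hadd HX y z) w = ip (hadd HX (proj (X - A) y) (proj (X - A) z)) w"
      using that A' pX by (simp add: proj(2) C_subD[OF A'])
  qed (use that in auto)
  have pscale: "proj (X - A) (hscale HX c z) = hscale HX c (proj (X - A) z)" if "z \<in> C X" for c z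
  proof (rule proj_eqI[OF A'])
    show "hscale HX c (proj (X - A) z) \<in> C (X - A)"
      using KA'.scale_closed[OF proj(1)[OF A' that]] by (simp add: ops')
    fix w assume "w \<in> C (X - A)"
    then show "ip (hscale HX c z) w = ip (hscale HX c (proj (X - A) z)) w"
      using that A' pX by (simp add: proj(2) C_subD[OF A'])
  qed (use that in auto)
  \<comment> \<open>On elementary tensors the projection to the functionals over the complement is
    the functional \<open>ip x one\<close> on the first factor and the identity on the second; this
    is why S has the form R \<otimes> 1.\<close>
  have pprod: "proj (X - A) (cmul x v) = hscale HX (ip x one) v" if x: "x \<in> C A" and v: "v \<in> C (X - A)" for x v
  proof (rule proj_eqI[OF A' mult_in[OF A x v]])
    show "hscale HX (ip x one) v \<in> C (X - A)" using KA'.scale_closed[OF v] by (simp add: ops')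
    fix w assume w: "w \<in> C (X - A)"
    have "ip (cmul x v) w = ip (cmul x v) (cmul one w)" using C_subD[OF A' w] by (simp add: mult_one_left)
    also have "\<dots> = ip x one * ip v w" by (rule inner_mult[OF A x one_in[OF A] v w])
    finally show "ip (cmul x v) w = ip (hscale HX (ip x one) v) w"
      using C_subD[OF A' w] C_subD[OF A' v] by simp
  qed
  have pid: "proj (X - A) v = v" if "v \<in> C (X - A)" for v
    by (rule proj_eqI[OF A' C_subD[OF A' that] that]) simp
  have norm_mul: "hnorm HX (cmul u v) = hnorm HX u * hnorm HX v" if v: "v \<in> C (X - A)" for v
  proof -
    note vX = C_subD[OF A' v]
    have "complex_of_real ((hnorm HX (cmul u v))\<^sup>2) = complex_of_real ((hnorm HX u)\<^sup>2 * (hnorm HX v)\<^sup>2)"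
      using inner_mult[OF A u u v v]
      unfolding inner_self[OF mult_in[OF A u v]] inner_self[OF uX] inner_self[OF vX] by simp
    then have "(hnorm HX (cmul u v))\<^sup>2 = (hnorm HX u * hnorm HX v)\<^sup>2"
      unfolding of_real_eq_iff power_mult_distrib .
    then show ?thesis
      using norm_nonneg[OF uX] norm_nonneg[OF vX] norm_nonneg[OF mult_in[OF A u v]]
      by (simp add: power2_eq_iff_nonneg)
  qed
  have SC: "cmul u (proj (X - A) z) \<in> C X" if "z \<in> C X" for z by (rule mult_in[OF A u proj(1)[OF A' that]])
  show "S \<in> factorization M P F A"
    unfolding factorization_def
  proof (intro CollectI conjI bexI ballI)
    have "S \<in> linear_ops HX HX"
      unfolding linear_ops_def S_def
      by (intro CollectI conjI ballI allI)
        (auto simp del: PiE_restrict simp: SC padd pscale mult_add_right mult_scale_right uX pX restrict_def)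
    moreover have "hnorm HX (S z) \<le> hnorm HX u * hnorm HX z" if z: "z \<in> C X" for z
      using proj_norm_le[OF A' z] z norm_nonneg[OF uX]
      by (simp add: S_def norm_mul[OF proj(1)[OF A' z]] mult_left_mono)
    ultimately show "S \<in> bounded_ops HX" by (auto simp: bounded_ops_def)
    have RC: "hscale HX c u \<in> C A" for c using KA.scale_closed[OF u] by (simp add: ops)
    have addA: "hadd HX x y \<in> C A" if "x \<in> C A" "y \<in> C A" for x y using KA.add_closed[OF that] by (simp add: ops)
    have scaleA: "hscale HX c x \<in> C A" if "x \<in> C A" for c x using KA.scale_closed[OF that] by (simp add: ops)
    have s1: "hscale HX (a + b) u = hadd HX (hscale HX a u) (hscale HX b u)" for a b
      by (rule inner_ext) (use uX in \<open>auto simp: algebra_simps\<close>)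
    have s2: "hscale HX (a * b) u = hscale HX a (hscale HX b u)" for a b
      by (rule inner_ext) (use uX in \<open>auto simp: algebra_simps\<close>)
    have AX: "x \<in> C X" if "x \<in> C A" for x using C_subD[OF A that] .
    have "R \<in> linear_ops (L2 P (F A)) (L2 P (F A))"
      unfolding linear_ops_def R_def ops
      by (intro CollectI conjI ballI allI)
        (auto simp del: PiE_restrict simp: RC addA scaleA AX oneX s1 s2 restrict_def)
    moreover have "hnorm HX (R x) \<le> (hnorm HX one * hnorm HX u) * hnorm HX x" if x: "x \<in> C A" for x
      using mult_right_mono[OF Cauchy_Schwarz[OF AX[OF x] oneX] norm_nonneg[OF uX]] x
      by (simp add: R_def norm_scale[OF uX] mult_ac)
    ultimately show "R \<in> bounded_ops (L2 P (F A))" by (auto simp: bounded_ops_def nA)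
    fix x v assume x: "x \<in> C A" and v: "v \<in> C (X - A)"
    show "S (cmul x v) = cmul (R x) v"
      using mult_in[OF A x v] x v C_subD[OF A' v]
      by (simp add: S_def R_def pprod mult_scale_left mult_scale_right uX)
  qed
  show "\<forall>v\<in>C (X - A). S v = cmul u v"
    using pid C_subD[OF A'] by (auto simp: S_def)
qed

end

context fock_pair begin

text \<open>The conjugate of a rank one operator that maps v to u v has the form R \<otimes> 1.
  Evaluated at the product of 1 and \<Psi> v it yields (R 1) \<Psi> v, so \<Psi> (u v) is a product
  as soon as \<Psi> v is known to live on the complement.\<close>

lemma special_unital_mult:
  assumes \<Psi>: "special_isomorphism M a.HX (factorization M P F) b.HX (factorization M Q G) \<Psi>"
    and one: "\<Psi> a.one = b.one" and A: "A \<in> sets M" and u: "u \<in> a.C A"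
  shows "\<Psi> u \<in> b.C A" and "v \<in> a.C (a.X - A) \<Longrightarrow> \<Psi> (class_mult P u v) = class_mult Q (\<Psi> u) (\<Psi> v)"
proof -
  have lin: "\<Psi> \<in> linear_ops a.HX b.HX" and iso: "\<And>u. u \<in> a.C a.X \<Longrightarrow> hnorm b.HX (\<Psi> u) = hnorm a.HX u"
    and onto: "\<Psi> ` a.C a.X = b.C a.X"
    and conj: "\<And>A. A \<in> sets M \<Longrightarrow> conjugate_op a.HX b.HX \<Psi> ` factorization M P F A = factorization M Q G A"
    using \<Psi> by (auto simp: special_isomorphism_def)
  have inj: "inj_on \<Psi> (a.C a.X)" by (rule linear_isometry_inj[OF a.hilbert_axioms b.hilbert_axioms lin iso])
  have \<Psi>C: "\<Psi> w \<in> b.C a.X" if "w \<in> a.C a.X" for w using onto that by blast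
  have key: "\<exists>r\<in>b.C A. \<forall>v\<in>a.C (a.X - A). \<Psi> v \<in> b.C (a.X - A) \<longrightarrow> \<Psi> (class_mult P u v) = class_mult Q r (\<Psi> v)"
    if A: "A \<in> sets M" and u: "u \<in> a.C A" for A u
  proof -
    have A': "a.X - A \<in> sets M" using A by auto
    obtain S where S: "S \<in> factorization M P F A" "\<And>v. v \<in> a.C (a.X - A) \<Longrightarrow> S v = class_mult P u v"
      using a.rank_one_in_factorization[OF A u] by blast
    let ?S = "conjugate_op a.HX b.HX \<Psi> S"
    have "?S \<in> factorization M Q G A" using conj[OF A] S(1) by blast
    then obtain R where R: "R \<in> bounded_ops (L2 Q (G A))"
      and SR: "\<And>u v. u \<in> b.C A \<Longrightarrow> v \<in> b.C (a.X - A) \<Longrightarrow> ?S (class_mult Q u v) = class_mult Q (R u) v"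
      by (auto simp: factorization_def)
    have Ro: "R b.one \<in> b.C A" using R b.one_in[OF A] by (auto simp: bounded_ops_def linear_ops_def)
    show ?thesis
    proof (intro bexI ballI impI)
      fix v assume v: "v \<in> a.C (a.X - A)" and \<Psi>v: "\<Psi> v \<in> b.C (a.X - A)"
      note vX = a.C_subD[OF A' v] and \<Psi>vX = b.C_subD[OF A' \<Psi>v]
      have "\<Psi> (class_mult P u v) = ?S (\<Psi> v)"
        using vX \<Psi>vX inj by (simp add: conjugate_op_def S(2)[OF v])
      also have "\<dots> = ?S (class_mult Q b.one (\<Psi> v))" using \<Psi>vX by (simp add: b.mult_one_left)
      also have "\<dots> = class_mult Q (R b.one) (\<Psi> v)" by (rule SR[OF b.one_in[OF A] \<Psi>v])
      finally show "\<Psi> (class_mult P u v) = class_mult Q (R b.one) (\<Psi> v)" .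
    qed (rule Ro)
  qed
  have mem: "\<Psi> u \<in> b.C A \<and> (\<forall>v\<in>a.C (a.X - A). \<Psi> v \<in> b.C (a.X - A) \<longrightarrow>
      \<Psi> (class_mult P u v) = class_mult Q (\<Psi> u) (\<Psi> v))" if A: "A \<in> sets M" and u: "u \<in> a.C A" for A u
  proof -
    have A': "a.X - A \<in> sets M" using A by auto
    obtain r where r: "r \<in> b.C A" "\<And>v. v \<in> a.C (a.X - A) \<Longrightarrow> \<Psi> v \<in> b.C (a.X - A) \<Longrightarrow>
        \<Psi> (class_mult P u v) = class_mult Q r (\<Psi> v)"
      using key[OF A u] by blast
    \<comment> \<open>v = 1 meets the premise on \<Psi> v because the unit is preserved, and it
      identifies r.\<close>
    have "\<Psi> u = r"
      using r(2)[OF a.one_in[OF A']] b.one_in[OF A'] b.mult_one_right[OF b.C_subD[OF A r(1)]]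
        a.mult_one_right[OF a.C_subD[OF A u]] by (simp add: one)
    then show ?thesis using r by blast
  qed
  show "\<Psi> u \<in> b.C A" using mem[OF A u] by blast
  have A': "a.X - A \<in> sets M" using A by auto
  assume v: "v \<in> a.C (a.X - A)"
  \<comment> \<open>Applied to the complement, the membership part puts \<Psi> v into the
    complementary space and so discharges the premise left open in \<open>key\<close>.\<close>
  show "\<Psi> (class_mult P u v) = class_mult Q (\<Psi> u) (\<Psi> v)"
    using mem[OF A u] mem[OF A' v] v by blast
qed

end

section \<open>Non-atomic measures and bounded densities\<close>

text \<open>A proper part B of positive measure or its remainder A - B has at most half the measure
  of A; halving is iterated.\<close>

lemma nonatomic_small_subset:
  assumes M: "finite_measure M" "nonatomic M" and A: "A \<in> sets M" "measure M A > 0" and e: "e > 0"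
  shows "\<exists>B\<in>sets M. B \<subseteq> A \<and> 0 < measure M B \<and> measure M B \<le> e"
proof -
  interpret finite_measure M by (rule M(1))
  have half: "\<exists>B\<in>sets M. B \<subseteq> A \<and> 0 < measure M B \<and> measure M B \<le> measure M A / 2"
    if A: "A \<in> sets M" "measure M A > 0" for A
  proof -
    obtain B where B: "B \<in> sets M" "B \<subseteq> A" "0 < measure M B" "measure M B < measure M A"
      using M(2)[unfolded nonatomic_def, rule_format, OF A(1)] A(2)
      by (auto simp: emeasure_eq_measure ennreal_less_iff)
    have d: "measure M (A - B) = measure M A - measure M B" using A B by (intro finite_measure_Diff) auto
    show ?thesis
    proof (cases "measure M B \<le> measure M A / 2")
      case False
      then show ?thesis using A B d by (intro bexI[of _ "A - B"]) auto
    qed (use B in auto)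
  qed
  have "\<exists>B\<in>sets M. B \<subseteq> A \<and> 0 < measure M B \<and> measure M B \<le> measure M A * (1/2)^n" for n
  proof (induction n)
    case 0
    then show ?case using A by auto
  next
    case (Suc n)
    then obtain B where B: "B \<in> sets M" "B \<subseteq> A" "0 < measure M B" "measure M B \<le> measure M A * (1/2)^n" by blast
    obtain B' where "B' \<in> sets M" "B' \<subseteq> B" "0 < measure M B'" "measure M B' \<le> measure M B / 2" using half[OF B(1,3)] by blast
    then show ?case using B by (intro bexI[of _ B']) auto
  qed
  moreover obtain n where "(1/2::real)^n < e / measure M A"
    using real_arch_pow_inv[of "e / measure M A" "1/2"] A e by auto
  then have "measure M A * (1/2)^n < e" using A(2) by (simp add: field_simps)
  ultimately show ?thesis by (meson less_imp_le order_trans)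
qed

text \<open>Finite disjoint unions of measurable sets of measure at most e, set up as an induction
  principle: additive or multiplicative set functions can be estimated on small pieces without
  indexing a partition.\<close>

inductive finely :: "'a measure \<Rightarrow> real \<Rightarrow> 'a set \<Rightarrow> bool" for M e where
  small: "A \<in> sets M \<Longrightarrow> measure M A \<le> e \<Longrightarrow> finely M e A"
| union: "finely M e A \<Longrightarrow> finely M e B \<Longrightarrow> A \<inter> B = {} \<Longrightarrow> finely M e (A \<union> B)"

lemma finely_sets: "finely M e A \<Longrightarrow> A \<in> sets M"
  by (induction rule: finely.induct) auto

lemma finely_Int:
  assumes "finite_measure M" "finely M e A" "B \<in> sets M" shows "finely M e (A \<inter> B)"
  using assms(2)
proof (induction rule: finely.induct)
  case (small A)
  interpret finite_measure M by fact
  have "measure M (A \<inter> B) \<le> measure M A" using small assms by (intro finite_measure_mono) auto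
  then show ?case using small assms by (intro finely.small) auto
next
  case (union A A')
  then have "finely M e ((A \<inter> B) \<union> (A' \<inter> B))" by (intro finely.union) auto
  then show ?case by (simp add: Int_Un_distrib2)
qed

lemma finely_Un:
  assumes "finite_measure M" "finely M e A" "finely M e B" shows "finely M e (A \<union> B)"
proof -
  have "finely M e (B \<inter> (space M - A))" using assms finely_sets[OF assms(2)] by (intro finely_Int) auto
  moreover have "B \<inter> (space M - A) = B - A" using sets.sets_into_space[OF finely_sets[OF assms(3)]] by auto
  ultimately have "finely M e (A \<union> (B - A))" using assms by (intro finely.union) auto
  then show ?thesis by simp
qed

text \<open>Exhaustion: take sets of this kind whose measures approach the supremum s. What their
  union leaves out is null, since otherwise a small piece of it could be added and s would be
  exceeded.\<close>

lemma nonatomic_finely: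
  assumes M: "finite_measure M" "nonatomic M" and e: "e > 0" and A: "A \<in> sets M"
  shows "finely M e A"
proof -
  interpret finite_measure M by (rule M(1))
  let ?S = "measure M ` {G. finely M e G}"
  define s where "s = Sup ?S"
  have bdd: "bdd_above ?S" by (rule bdd_aboveI[of _ "measure M (space M)"]) (auto intro: bounded_measure)
  have le_s: "measure M G \<le> s" if "finely M e G" for G unfolding s_def using that bdd by (intro cSup_upper) auto
  have f0: "finely M e {}" using e by (intro finely.small) auto
  have "\<exists>G. finely M e G \<and> s - 1 / real (Suc n) < measure M G" for n
    using less_cSupD[of ?S "s - 1 / real (Suc n)"] f0 unfolding s_def by auto
  then obtain G where G: "\<And>n. finely M e (G n)" "\<And>n. s - 1 / real (Suc n) < measure M (G n)" by metis
  define U where "U n = (\<Union>i\<le>n. G i)" for n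
  have U: "finely M e (U n)" for n
  proof (induction n)
    case (Suc n)
    have "U (Suc n) = U n \<union> G (Suc n)" by (auto simp: U_def atMost_Suc)
    then show ?case using finely_Un[OF M(1) Suc G(1)] by simp
  qed (simp add: U_def G)
  have Us [measurable]: "U n \<in> sets M" for n using finely_sets[OF U] .
  have Ub: "s - 1 / real (Suc n) < measure M (U n)" for n
    using G(2)[of n] finite_measure_mono[OF _ Us, of "G n" n] by (force simp: U_def)
  define R where "R = space M - (\<Union>n. U n)"
  have R: "R \<in> sets M" by (auto simp: R_def)
  have "measure M R = 0"
  proof (rule ccontr)
    assume "measure M R \<noteq> 0"
    then have "measure M R > 0" by (simp add: zero_less_measure_iff)
    then obtain B where B: "B \<in> sets M" "B \<subseteq> R" "0 < measure M B" "measure M B \<le> e"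
      using nonatomic_small_subset[OF M R _ e] by blast
    \<comment> \<open>\<open>U n \<union> B\<close> is still admissible, so its measure is at most
      s, while that of \<open>U n\<close> already exceeds s - 1/(n+1).\<close>
    have "measure M B < 1 / real (Suc n)" for n
    proof -
      have "U n \<inter> B = {}" using B(2) by (auto simp: R_def)
      then have "measure M (U n \<union> B) = measure M (U n) + measure M B" "finely M e (U n \<union> B)"
        using B by (auto intro!: finite_measure_Union intro: finely.union[OF U finely.small])
      then show ?thesis using le_s[of "U n \<union> B"] Ub[of n] by linarith
    qed
    then show False using B(3) reals_Archimedean[of "measure M B"] by (metis inverse_eq_divide less_asym)
  qed
  have "(\<lambda>n. measure M (U n)) \<longlonglongrightarrow> measure M (\<Union>n. U n)"
  proof (rule finite_Lim_measure_incseq)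
    show "incseq U" by (force simp: incseq_def U_def)
  qed (use Us in auto)
  moreover have "measure M (\<Union>n. U n) = measure M (space M)"
    using finite_measure_compl[of "\<Union>n. U n"] \<open>measure M R = 0\<close> by (simp add: R_def)
  ultimately have "(\<lambda>n. measure M (space M) - measure M (U n)) \<longlonglongrightarrow> 0"
    using tendsto_diff[OF tendsto_const, of _ _ sequentially "measure M (space M)"] by fastforce
  \<comment> \<open>The rest of the space now has measure at most e and serves as one further
    piece.\<close>
  from LIMSEQ_D[OF this e] obtain n where "\<bar>measure M (space M) - measure M (U n)\<bar> < e" by auto
  then have "measure M (space M - U n) \<le> e" using finite_measure_compl[OF Us[of n]] by simp
  then have "finely M e (U n \<union> (space M - U n))" by (intro finely.union[OF U finely.small]) auto
  also have "U n \<union> (space M - U n) = space M" using sets.sets_into_space[OF Us[of n]] by auto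
  finally have "finely M e (space M \<inter> A)" using A by (intro finely_Int M(1))
  then show ?thesis using sets.sets_into_space[OF A] by (simp add: Int_absorb1)
qed

lemma nonatomic_induct:
  assumes "finite_measure M" "nonatomic M" "e > 0" and A: "A \<in> sets M"
    and small: "\<And>A. A \<in> sets M \<Longrightarrow> measure M A \<le> e \<Longrightarrow> R A"
    and union: "\<And>A B. A \<in> sets M \<Longrightarrow> B \<in> sets M \<Longrightarrow> A \<inter> B = {} \<Longrightarrow> R A \<Longrightarrow> R B \<Longrightarrow> R (A \<union> B)"
  shows "R A"
  using nonatomic_finely[OF assms(1-3) A]
proof (induction rule: finely.induct)
  case (union A B)
  then show ?case using assms(6) finely_sets by blast
qed (rule small)

text \<open>Cutting A into pieces of measure at most e^2 bounds the total by c \<nu>(A) e, since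
  each piece contributes its measure times at most c e. Letting e tend to 0 finishes the
  argument.\<close>

lemma additive_small_imp_zero:
  fixes \<tau> :: "'a set \<Rightarrow> real"
  assumes M: "finite_measure M" "nonatomic M" and A: "A \<in> sets M" and d: "d > 0" and c: "c \<ge> 0"
    and add: "\<And>A B. A \<in> sets M \<Longrightarrow> B \<in> sets M \<Longrightarrow> A \<inter> B = {} \<Longrightarrow> \<tau> (A \<union> B) = \<tau> A + \<tau> B"
    and small: "\<And>A. A \<in> sets M \<Longrightarrow> measure M A \<le> d \<Longrightarrow> \<bar>\<tau> A\<bar> \<le> c * (measure M A * sqrt (measure M A))"
  shows "\<tau> A = 0"
proof -
  interpret finite_measure M by (rule M(1))
  have bound: "\<bar>\<tau> A\<bar> \<le> (c * measure M A) * e" if e: "0 < e" "e\<^sup>2 \<le> d" for e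
  proof -
    have "\<bar>\<tau> A\<bar> \<le> c * (measure M A * e)"
    proof (rule nonatomic_induct[OF M, of "e\<^sup>2" A])
      fix A assume A: "A \<in> sets M" "measure M A \<le> e\<^sup>2"
      have "sqrt (measure M A) \<le> e" using A(2) e by (simp add: real_le_lsqrt)
      then have "c * (measure M A * sqrt (measure M A)) \<le> c * (measure M A * e)"
        using c by (intro mult_left_mono) auto
      then show "\<bar>\<tau> A\<bar> \<le> c * (measure M A * e)" using small[OF A(1)] A e by simp
    next
      fix A B assume "A \<in> sets M" "B \<in> sets M" "A \<inter> B = {}" "\<bar>\<tau> A\<bar> \<le> c * (measure M A * e)" "\<bar>\<tau> B\<bar> \<le> c * (measure M B * e)"
      then show "\<bar>\<tau> (A \<union> B)\<bar> \<le> c * (measure M (A \<union> B) * e)"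
        by (simp add: add finite_measure_Union algebra_simps)
    qed (use e A in auto)
    then show ?thesis by (simp add: mult.assoc)
  qed
  have "\<bar>\<tau> A\<bar> \<le> (c * measure M A) * 0"
  proof (rule tendsto_lowerbound)
    show "((\<lambda>e. (c * measure M A) * e) \<longlongrightarrow> (c * measure M A) * 0) (at_right 0)"
      by (intro tendsto_intros)
    show "\<forall>\<^sub>F e in at_right 0. \<bar>\<tau> A\<bar> \<le> (c * measure M A) * e"
    proof (rule eventually_at_rightI[of 0 "sqrt d"])
      fix e assume "e \<in> {0<..<sqrt d}"
      then have "0 < e" "e\<^sup>2 \<le> d"
        using power_mono[of e "sqrt d" 2] d by auto
      then show "\<bar>\<tau> A\<bar> \<le> (c * measure M A) * e" by (rule bound)
    qed (use d in simp)
  qed simp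
  then show ?thesis by simp
qed

section \<open>Elementary estimates, simple approximation and densities\<close>

lemma exp_minus_one_bound: "x \<ge> 0 \<Longrightarrow> exp x - 1 \<le> x * exp x" for x :: real
  using exp_ge_add_one_self[of "-x"] by (simp add: exp_minus field_simps)

lemma exp_second_order_bound: "\<bar>exp x - 1 - x\<bar> \<le> x\<^sup>2 * exp \<bar>x\<bar>" for x :: real
proof -
  have "exp x - 1 - x \<le> x\<^sup>2 * exp \<bar>x\<bar>"
  proof (cases "x \<ge> 0")
    case True
    have "exp x - 1 - x \<le> x * (exp x - 1)" using exp_minus_one_bound[OF True] by (simp add: algebra_simps)
    also have "\<dots> \<le> x * (x * exp x)" using exp_minus_one_bound[OF True] True by (intro mult_left_mono)
    finally show ?thesis using True by (simp add: power2_eq_square mult.assoc)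
  next
    case False
    have "exp x * (1 - x) \<le> 1" using exp_ge_add_one_self[of "-x"] by (simp add: exp_minus field_simps)
    then have "exp x - 1 - x \<le> - x * (1 - exp x)" by (simp add: algebra_simps)
    also have "1 - exp x \<le> - x" using exp_ge_add_one_self[of x] by linarith
    then have "- x * (1 - exp x) \<le> - x * (- x)" using False by (intro mult_left_mono) auto
    also have "\<dots> \<le> x\<^sup>2 * exp \<bar>x\<bar>" by (simp add: power2_eq_square mult_le_cancel_left1)
    finally show ?thesis .
  qed
  then show ?thesis using exp_ge_add_one_self[of x] by linarith
qed

text \<open>Convergence is stated through inner products, because distances between exponentials
  depend on h only through these; \<open>e_tendsto\<close> consumes exactly this form.\<close>

lemma real_L2_simple_approx:
  assumes h: "h \<in> real_L2 M"
  obtains s :: "nat \<Rightarrow> 'a \<Rightarrow> real" where "\<And>n. simple_function M (s n)" "\<And>n. s n \<in> real_L2 M"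
    "\<And>g. g \<in> real_L2 M \<Longrightarrow> (\<lambda>n. \<integral>x. s n x * g x \<partial>M) \<longlonglongrightarrow> (\<integral>x. h x * g x \<partial>M)"
    "(\<lambda>n. \<integral>x. s n x * s n x \<partial>M) \<longlonglongrightarrow> (\<integral>x. h x * h x \<partial>M)"
proof -
  note [measurable] = real_L2_measurable[OF h]
  obtain s where s: "\<And>n. simple_function M (s n)" and lim: "\<And>x. x \<in> space M \<Longrightarrow> (\<lambda>n. s n x) \<longlonglongrightarrow> h x"
    and b: "\<And>n x. x \<in> space M \<Longrightarrow> dist (s n x) 0 \<le> 2 * dist (h x) 0"
    using borel_measurable_implies_sequence_metric[of h M 0] by (metis (no_types) \<open>h \<in> borel_measurable M\<close>)
  have sm [measurable]: "s n \<in> borel_measurable M" for n by (rule borel_measurable_simple_function[OF s])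
  have b': "\<bar>s n x\<bar> \<le> 2 * \<bar>h x\<bar>" if "x \<in> space M" for n x using b[OF that] by simp
  have sq: "(s n x)\<^sup>2 \<le> 4 * (h x)\<^sup>2" if "x \<in> space M" for n x
    using power_mono[OF b'[OF that, of n], of 2] by (simp add: power_mult_distrib)
  have sL: "s n \<in> real_L2 M" for n
  proof -
    have "integrable M (\<lambda>x. (s n x)\<^sup>2)"
    proof (rule Bochner_Integration.integrable_bound)
      show "integrable M (\<lambda>x. 4 * (h x)\<^sup>2)" using h by (simp add: real_L2_def)
      show "AE x in M. norm ((s n x)\<^sup>2) \<le> norm (4 * (h x)\<^sup>2)" using sq by auto
    qed measurable
    then show ?thesis by (simp add: real_L2_def)
  qed
  show ?thesis
  proof (rule that[OF s sL])
    fix g assume g: "g \<in> real_L2 M"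
    note [measurable] = real_L2_measurable[OF g]
    show "(\<lambda>n. \<integral>x. s n x * g x \<partial>M) \<longlonglongrightarrow> (\<integral>x. h x * g x \<partial>M)"
    proof (rule integral_dominated_convergence)
      show "integrable M (\<lambda>x. 2 * \<bar>h x * g x\<bar>)" using real_L2_mult_integrable[OF h g] by simp
      show "AE x in M. (\<lambda>n. s n x * g x) \<longlonglongrightarrow> h x * g x" using lim by (auto intro!: tendsto_intros)
      show "AE x in M. norm (s n x * g x) \<le> 2 * \<bar>h x * g x\<bar>" for n
        using mult_right_mono[OF b' abs_ge_zero] by (auto simp: abs_mult mult.assoc)
    qed measurable
  next
    show "(\<lambda>n. \<integral>x. s n x * s n x \<partial>M) \<longlonglongrightarrow> (\<integral>x. h x * h x \<partial>M)"
    proof (rule integral_dominated_convergence)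
      show "integrable M (\<lambda>x. 4 * \<bar>h x * h x\<bar>)" using real_L2_mult_integrable[OF h h] by simp
      show "AE x in M. (\<lambda>n. s n x * s n x) \<longlonglongrightarrow> h x * h x" using lim by (auto intro!: tendsto_intros)
      show "AE x in M. norm (s n x * s n x) \<le> 4 * \<bar>h x * h x\<bar>" for n
        using sq by (auto simp: power2_eq_square)
    qed measurable
  qed
qed

text \<open>The shifted set function \<mu> + \<nu> lies between 0 and 2 \<nu>. Domination by \<nu>
  gives continuity at the empty set, hence countable additivity from finite additivity. Its density
  minus 1 is the density of \<mu>.\<close>

lemma Radon_Nikodym_bounded:
  fixes \<mu> :: "'a set \<Rightarrow> real"
  assumes M: "finite_measure M"
    and add: "\<And>A B. A \<in> sets M \<Longrightarrow> B \<in> sets M \<Longrightarrow> A \<inter> B = {} \<Longrightarrow> \<mu> (A \<union> B) = \<mu> A + \<mu> B"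
    and bound: "\<And>A. A \<in> sets M \<Longrightarrow> \<bar>\<mu> A\<bar> \<le> measure M A"
  obtains k where "k \<in> borel_measurable M" "\<And>x. \<bar>k x\<bar> \<le> 1"
    "\<And>A. A \<in> sets M \<Longrightarrow> \<mu> A = (\<integral>x. k x * indicator A x \<partial>M)"
proof -
  interpret finite_measure M by (rule M)
  define m where "m A = ennreal (\<mu> A + measure M A)" for A
  have pos: "0 \<le> \<mu> A + measure M A" and up: "\<mu> A + measure M A \<le> 2 * measure M A" if "A \<in> sets M" for A
    using bound[OF that] by auto
  define N where "N = measure_of (space M) (sets M) m"
  have [simp]: "sets N = sets M" "space N = space M" by (auto simp: N_def)
  have "countably_additive (sets M) m"
  proof (rule sets.empty_continuous_imp_countably_additive)
    show "positive (sets M) m" using bound[of "{}"] by (simp add: positive_def m_def)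
    show "additive (sets M) m"
      by (auto simp: additive_def m_def add finite_measure_Union pos add_ac simp flip: ennreal_plus)
    show "\<forall>A\<in>sets M. m A \<noteq> \<infinity>" by (simp add: m_def)
    fix A :: "nat \<Rightarrow> 'a set" assume A: "range A \<subseteq> sets M" "decseq A" "(\<Inter>i. A i) = {}"
    have l: "(\<lambda>i. measure M (A i)) \<longlonglongrightarrow> 0" using finite_Lim_measure_decseq[OF A(1,2)] A(3) by simp
    have "(\<lambda>i. \<mu> (A i) + measure M (A i)) \<longlonglongrightarrow> 0"
    proof (rule Lim_null_comparison[OF always_eventually])
      show "(\<lambda>i. 2 * measure M (A i)) \<longlonglongrightarrow> 0" using tendsto_mult_right_zero[OF l] .
      show "\<forall>i. norm (\<mu> (A i) + measure M (A i)) \<le> 2 * measure M (A i)"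
        using pos up A(1) by (auto simp: subset_eq)
    qed
    then show "(\<lambda>i. m (A i)) \<longlonglongrightarrow> 0" unfolding m_def using tendsto_ennrealI by fastforce
  qed
  then have Nm: "emeasure N A = m A" if "A \<in> sets M" for A
    unfolding N_def using that bound[of "{}"]
    by (intro emeasure_measure_of_sigma) (auto simp: positive_def m_def sets.sigma_algebra_axioms)
  have ac: "absolutely_continuous M N"
    unfolding absolutely_continuous_def
  proof
    fix A assume A: "A \<in> null_sets M"
    then have "A \<in> sets M" "measure M A = 0" by (auto simp: measure_def)
    then show "A \<in> null_sets N" using Nm up[of A] by (auto simp: null_sets_def m_def intro!: ennreal_neg)
  qed
  obtain f where f [measurable]: "f \<in> borel_measurable M" and dens: "density M f = N"
    using Radon_Nikodym[OF ac] by auto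
  have fA: "(\<integral>\<^sup>+x. f x * indicator A x \<partial>M) = m A" if "A \<in> sets M" for A
    using Nm[OF that] that by (simp add: dens[symmetric] emeasure_density)
  have "(\<integral>\<^sup>+x. f x \<partial>M) = m (space M)" using fA[of "space M"] by (simp cong: nn_integral_cong)
  then have "(\<integral>\<^sup>+x. f x \<partial>M) \<noteq> \<infinity>" by (simp add: m_def)
  then have ffin: "AE x in M. f x \<noteq> \<infinity>" by (intro nn_integral_PInf_AE) auto
  define g where "g x = enn2real (f x)" for x
  have [measurable]: "g \<in> borel_measurable M" unfolding g_def by measurable
  have g0: "0 \<le> g x" for x by (simp add: g_def)
  have gA: "integrable M (\<lambda>x. g x * indicator A x) \<and> (\<integral>x. g x * indicator A x \<partial>M) = \<mu> A + measure M A" if A: "A \<in> sets M" for A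
  proof -
    have [measurable]: "A \<in> sets M" by (rule A)
    have "(\<integral>\<^sup>+x. ennreal (g x * indicator A x) \<partial>M) = (\<integral>\<^sup>+x. f x * indicator A x \<partial>M)"
      by (rule nn_integral_cong_AE, use ffin in eventually_elim)
        (auto simp: g_def indicator_def less_top[symmetric] ennreal_enn2real_if)
    also have "\<dots> = ennreal (\<mu> A + measure M A)" using fA[OF A] by (simp add: m_def)
    finally have nn: "(\<integral>\<^sup>+x. ennreal (g x * indicator A x) \<partial>M) = ennreal (\<mu> A + measure M A)" .
    have "has_bochner_integral M (\<lambda>x. g x * indicator A x) (\<mu> A + measure M A)"
      using nn pos[OF A] g0 by (intro has_bochner_integral_nn_integral) auto
    then show ?thesis by (simp add: has_bochner_integral_iff)
  qed
  have gi: "integrable M g" using gA[of "space M"] by (simp cong: Bochner_Integration.integrable_cong)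
  have indi: "integrable M (indicat_real A)" if "A \<in> sets M" for A
    using that by (intro integrable_const_bound[where B = 1]) auto
  have g2: "AE x in M. g x \<le> 2"
  proof -
    let ?A = "{x\<in>space M. g x > 2}"
    have A: "?A \<in> sets M" by measurable
    have int: "integrable M (\<lambda>x. g x * indicator ?A x - 2 * indicator ?A x)"
      using gA[OF A] indi[OF A] by auto
    have nn: "0 \<le> g x * indicator ?A x - 2 * indicator ?A x" for x by (auto simp: indicator_def)
    have "(\<integral>x. g x * indicator ?A x - 2 * indicator ?A x \<partial>M) = \<mu> ?A + measure M ?A - 2 * measure M ?A"
      using gA[OF A] A indi[OF A] by (subst Bochner_Integration.integral_diff) auto
    also have "\<dots> \<le> 0" using up[OF A] by simp
    finally have "(\<integral>x. g x * indicator ?A x - 2 * indicator ?A x \<partial>M) = 0"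
      using nn by (intro antisym integral_nonneg_AE) auto
    then have "AE x in M. g x * indicator ?A x - 2 * indicator ?A x = 0"
      using integral_nonneg_eq_0_iff_AE[OF int] nn by simp
    then show ?thesis by (rule AE_mp) (auto intro!: AE_I2 simp: indicator_def split: if_splits)
  qed
  \<comment> \<open>g - 1 is at least -1 everywhere but at most 1 only almost everywhere; the
    truncation makes the bound hold at every point.\<close>
  define k where "k x = min 1 (g x - 1)" for x
  have [measurable]: "k \<in> borel_measurable M" unfolding k_def by measurable
  show ?thesis
  proof (rule that)
    show "k \<in> borel_measurable M" by measurable
    show "\<bar>k x\<bar> \<le> 1" for x using g0[of x] by (auto simp: k_def)
    fix A assume A [measurable]: "A \<in> sets M"
    have "(\<integral>x. k x * indicator A x \<partial>M) = (\<integral>x. g x * indicator A x - indicator A x \<partial>M)"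
      by (rule integral_cong_AE) (measurable, use g2 in eventually_elim, auto simp: indicator_def k_def)
    also have "\<dots> = \<mu> A" using gA[OF A] A indi[OF A] by (subst Bochner_Integration.integral_diff) auto
    finally show "\<mu> A = (\<integral>x. k x * indicator A x \<partial>M)" by simp
  qed
qed

section \<open>Rigidity up to signs\<close>

lemma cut_cut: "cut A (cut B h) = cut (A \<inter> B) h"
  by (auto simp: cut_def)

lemma integral_cut_const:
  assumes "A \<in> sets M" "finite_measure M"
  shows "(\<integral>x. cut A (\<lambda>_. s) x * cut A (\<lambda>_. t) x \<partial>M) = s * t * measure M A"
proof -
  have "(\<integral>x. cut A (\<lambda>_. s) x * cut A (\<lambda>_. t) x \<partial>M) = (\<integral>x. s * t * indicator A x \<partial>M)"
    by (rule Bochner_Integration.integral_cong) (auto simp: cut_def)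
  then show ?thesis using assms by simp
qed

lemma real_L2_mult_bounded:
  assumes k [measurable]: "k \<in> borel_measurable M" and k1: "\<And>x. \<bar>k x\<bar> \<le> 1" and h: "h \<in> real_L2 M"
  shows "(\<lambda>x. k x * h x) \<in> real_L2 M"
proof -
  note [measurable] = real_L2_measurable[OF h]
  have int: "integrable M (\<lambda>x. (h x)\<^sup>2)" using h by (simp add: real_L2_def)
  have "\<bar>k x * h x\<bar> \<le> \<bar>h x\<bar>" for x
    unfolding abs_mult using k1[of x] by (intro mult_left_le_one_le) auto
  then have le: "(k x * h x)\<^sup>2 \<le> (h x)\<^sup>2" for x by (simp only: abs_le_square_iff)
  have "integrable M (\<lambda>x. (k x * h x)\<^sup>2)"
  proof (rule Bochner_Integration.integrable_bound[OF int])
    show "AE x in M. norm ((k x * h x)\<^sup>2) \<le> norm ((h x)\<^sup>2)"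
      by (intro AE_I2) (simp only: real_norm_def abs_power2 le)
  qed measurable
  then show ?thesis by (auto simp: real_L2_def)
qed

lemma real_L2_const: "finite_measure M \<Longrightarrow> (\<lambda>_. c) \<in> real_L2 M"
  by (rule real_L2_bounded[where c = "\<bar>c\<bar>"]) auto

context fock_space begin

abbreviation "es s A \<equiv> e (cut A (\<lambda>_. s))"

lemma es_in: "A \<in> sets M \<Longrightarrow> es s A \<in> C A"
  by (rule e_cut_in) (auto intro: real_L2_const finM)

lemma inner_es: "A \<in> sets M \<Longrightarrow> ip (es s A) (es t A) = complex_of_real (exp (s * t * measure M A))"
  by (simp add: inner_e real_L2_cut real_L2_const finM integral_cut_const)

lemma inner_es_one: "A \<in> sets M \<Longrightarrow> ip (es s A) one = 1" "A \<in> sets M \<Longrightarrow> ip one (es s A) = 1"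
  by (simp_all add: one_eq inner_e real_L2_cut real_L2_const finM real_L2_zero)

lemma inner_one_one: "ip one one = 1"
  by (simp add: one_eq inner_e real_L2_zero)

text \<open>\<open>ed s A\<close> is of first order in \<open>\<nu>(A)\<close>, and \<open>er s A\<close>, the deviation of \<open>ed s A\<close> from linearity
  in \<open>s\<close>, is of second order (in squared norm).\<close>

definition "ed s A = diff (es s A) one"
definition "er s A = hadd HX (ed s A) (hscale HX (- complex_of_real s) (ed 1 A))"

lemma ed_in [simp]: "A \<in> sets M \<Longrightarrow> ed s A \<in> C X" "A \<in> sets M \<Longrightarrow> er s A \<in> C X"
  using one_in[of X] by (auto simp: ed_def er_def es_in)

lemma inner_ed:
  assumes "A \<in> sets M" shows "ip (ed s A) (ed t A) = complex_of_real (exp (s * t * measure M A) - 1)"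
  using assms one_in[of X] by (simp add: ed_def es_in inner_es inner_es_one inner_one_one)

lemma norm_ed_sq: "A \<in> sets M \<Longrightarrow> (hnorm HX (ed s A))\<^sup>2 = exp (s\<^sup>2 * measure M A) - 1"
  by (simp add: norm_sq inner_ed) (simp add: power2_eq_square)

lemma norm_er_sq:
  assumes "A \<in> sets M"
  shows "(hnorm HX (er s A))\<^sup>2 = (exp (s\<^sup>2 * measure M A) - 1) - 2 * s * (exp (s * measure M A) - 1)
    + s\<^sup>2 * (exp (measure M A) - 1)"
  using assms unfolding er_def by (simp add: norm_sq inner_ed) (simp add: power2_eq_square algebra_simps)

lemma norm_ed_le:
  assumes A: "A \<in> sets M" "measure M A \<le> 1"
  shows "hnorm HX (ed s A) \<le> sqrt (s\<^sup>2 * exp (s\<^sup>2)) * sqrt (measure M A)"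
proof (rule power2_le_imp_le)
  have "(hnorm HX (ed s A))\<^sup>2 \<le> (s\<^sup>2 * measure M A) * exp (s\<^sup>2 * measure M A)"
    unfolding norm_ed_sq[OF A(1)] by (rule exp_minus_one_bound) simp
  also have "\<dots> \<le> (s\<^sup>2 * measure M A) * exp (s\<^sup>2)"
    using mult_left_mono[OF A(2), of "s\<^sup>2"] by (intro mult_left_mono) auto
  finally show "(hnorm HX (ed s A))\<^sup>2 \<le> (sqrt (s\<^sup>2 * exp (s\<^sup>2)) * sqrt (measure M A))\<^sup>2"
    by (simp add: power_mult_distrib mult_ac)
qed simp

lemma norm_er_le:
  assumes A: "A \<in> sets M" "measure M A \<le> 1"
  shows "hnorm HX (er s A) \<le> sqrt (s^4 * exp (s\<^sup>2) + 2 * \<bar>s\<bar> * (s\<^sup>2 * exp \<bar>s\<bar>) + s\<^sup>2 * exp 1) * measure M A"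
proof (rule power2_le_imp_le)
  let ?a = "measure M A"
  define \<phi> where "\<phi> x = exp x - 1 - x" for x :: real
  have \<phi>: "\<bar>\<phi> (t * ?a)\<bar> \<le> (t\<^sup>2 * exp \<bar>t\<bar>) * ?a\<^sup>2" for t
  proof -
    have "\<bar>\<phi> (t * ?a)\<bar> \<le> (t * ?a)\<^sup>2 * exp \<bar>t * ?a\<bar>" unfolding \<phi>_def by (rule exp_second_order_bound)
    also have "\<dots> \<le> (t * ?a)\<^sup>2 * exp \<bar>t\<bar>"
      using mult_left_mono[OF A(2), of "\<bar>t\<bar>"] by (intro mult_left_mono) (auto simp: abs_mult)
    finally show ?thesis by (simp add: power_mult_distrib mult_ac)
  qed
  \<comment> \<open>The terms linear in \<open>?a\<close> cancel, as s^2 - 2 s s + s^2 = 0, so only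
    second order remainders of the exponential are left.\<close>
  have "(hnorm HX (er s A))\<^sup>2 = \<phi> (s\<^sup>2 * ?a) - 2 * s * \<phi> (s * ?a) + s\<^sup>2 * \<phi> (1 * ?a)"
    unfolding norm_er_sq[OF A(1)] \<phi>_def by (simp add: algebra_simps power2_eq_square)
  also have "\<dots> \<le> ((s\<^sup>2)\<^sup>2 * exp \<bar>s\<^sup>2\<bar>) * ?a\<^sup>2 + 2 * \<bar>s\<bar> * ((s\<^sup>2 * exp \<bar>s\<bar>) * ?a\<^sup>2) + s\<^sup>2 * ((1\<^sup>2 * exp \<bar>1\<bar>) * ?a\<^sup>2)"
  proof (intro add_mono)
    have m: "\<phi> (s\<^sup>2 * ?a) \<le> ((s\<^sup>2)\<^sup>2 * exp \<bar>s\<^sup>2\<bar>) * ?a\<^sup>2" using \<phi>[of "s\<^sup>2"] by linarith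
    have "- (2 * s * \<phi> (s * ?a)) \<le> \<bar>2 * s * \<phi> (s * ?a)\<bar>" by simp
    also have "\<dots> = 2 * \<bar>s\<bar> * \<bar>\<phi> (s * ?a)\<bar>" by (simp add: abs_mult)
    also have "\<dots> \<le> 2 * \<bar>s\<bar> * ((s\<^sup>2 * exp \<bar>s\<bar>) * ?a\<^sup>2)" by (intro mult_left_mono \<phi>) auto
    finally show "\<phi> (s\<^sup>2 * ?a) - 2 * s * \<phi> (s * ?a) \<le> ((s\<^sup>2)\<^sup>2 * exp \<bar>s\<^sup>2\<bar>) * ?a\<^sup>2 + 2 * \<bar>s\<bar> * ((s\<^sup>2 * exp \<bar>s\<bar>) * ?a\<^sup>2)"
      using m by linarith
    have "\<phi> (1 * ?a) \<le> (1\<^sup>2 * exp \<bar>1\<bar>) * ?a\<^sup>2" using \<phi>[of 1] by linarith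
    then show "s\<^sup>2 * \<phi> (1 * ?a) \<le> s\<^sup>2 * ((1\<^sup>2 * exp \<bar>1\<bar>) * ?a\<^sup>2)" by (intro mult_left_mono) auto
  qed
  also have "\<dots> = (sqrt (s^4 * exp (s\<^sup>2) + 2 * \<bar>s\<bar> * (s\<^sup>2 * exp \<bar>s\<bar>) + s\<^sup>2 * exp 1) * ?a)\<^sup>2"
    by (simp add: power_mult_distrib algebra_simps flip: power_mult)
  finally show "(hnorm HX (er s A))\<^sup>2 \<le> (sqrt (s^4 * exp (s\<^sup>2) + 2 * \<bar>s\<bar> * (s\<^sup>2 * exp \<bar>s\<bar>) + s\<^sup>2 * exp 1) * ?a)\<^sup>2" .
qed simp

lemma e_tendsto:
  assumes "\<And>n::nat. s n \<in> real_L2 M" "h \<in> real_L2 M"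
    and "(\<lambda>n. ipr (s n) h) \<longlonglongrightarrow> ipr h h" "(\<lambda>n. ipr (s n) (s n)) \<longlonglongrightarrow> ipr h h"
  shows "(\<lambda>n. hnorm HX (diff (e (s n)) (e h))) \<longlonglongrightarrow> 0"
proof -
  have eq: "hnorm HX (diff (e (s n)) (e h)) = sqrt (exp (ipr (s n) (s n)) - 2 * exp (ipr (s n) h) + exp (ipr h h))" for n
    using assms(1,2) by (simp add: hnorm_def inner_e mult.commute[of "h _" "s n _"])
  have "(\<lambda>n. sqrt (exp (ipr (s n) (s n)) - 2 * exp (ipr (s n) h) + exp (ipr h h))) \<longlonglongrightarrow>
      sqrt (exp (ipr h h) - 2 * exp (ipr h h) + exp (ipr h h))"
    by (intro tendsto_intros assms)
  then show ?thesis unfolding eq by simp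
qed

end

section \<open>The kernel of an arbitrary unital isomorphism\<close>

locale fock_iso = fock_pair +
  fixes \<Psi>
  assumes nonatomic: "nonatomic M"
    and \<Psi>: "unital_special_real_isomorphism M P F Q G \<Psi>"
begin

lemma \<Psi>_special: "special_isomorphism M a.HX (factorization M P F) b.HX (factorization M Q G) \<Psi>"
  and \<Psi>_one: "\<Psi> a.one = b.one"
  and \<Psi>_real: "\<Psi> ` real_subspace P (F a.X) = real_subspace Q (G a.X)"
  using \<Psi> by (auto simp: unital_special_real_isomorphism_def)

lemma \<Psi>_linear: "\<Psi> \<in> linear_ops a.HX b.HX"
  and \<Psi>_iso: "u \<in> a.C a.X \<Longrightarrow> hnorm b.HX (\<Psi> u) = hnorm a.HX u"
  using \<Psi>_special by (auto simp: special_isomorphism_def)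

lemma \<Psi>_in [simp]: "u \<in> a.C a.X \<Longrightarrow> \<Psi> u \<in> b.C a.X"
  using \<Psi>_linear by (auto simp: linear_ops_def)

lemma \<Psi>_add: "\<lbrakk>u \<in> a.C a.X; v \<in> a.C a.X\<rbrakk> \<Longrightarrow> \<Psi> (hadd a.HX u v) = hadd b.HX (\<Psi> u) (\<Psi> v)"
  and \<Psi>_scale: "u \<in> a.C a.X \<Longrightarrow> \<Psi> (hscale a.HX c u) = hscale b.HX c (\<Psi> u)"
  using \<Psi>_linear by (auto simp: linear_ops_def)

lemma \<Psi>_inner: "\<lbrakk>u \<in> a.C a.X; v \<in> a.C a.X\<rbrakk> \<Longrightarrow> b.ip (\<Psi> u) (\<Psi> v) = a.ip u v"
  by (rule linear_isometry_inner[OF a.hilbert_axioms b.hilbert_axioms \<Psi>_linear \<Psi>_iso])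

lemmas \<Psi>_mem = special_unital_mult(1)[OF \<Psi>_special \<Psi>_one]
lemmas \<Psi>_mult = special_unital_mult(2)[OF \<Psi>_special \<Psi>_one]

text \<open>The inner product is already real, because \<Psi> maps real functionals to real ones
  (\<open>K_eq\<close>); \<open>Re\<close> only changes the type.\<close>

definition "K h k = Re (b.ip (\<Psi> (a.e h)) (b.e k))"

lemma K_eq:
  assumes h: "h \<in> real_L2 M" and k: "k \<in> real_L2 M"
  shows "b.ip (\<Psi> (a.e h)) (b.e k) = complex_of_real (K h k)"
proof -
  have "a.e h \<in> real_subspace P (F a.X)" using h by (simp add: a.real_subspace_iff a.inner_e)
  then have "\<Psi> (a.e h) \<in> real_subspace Q (G a.X)" using \<Psi>_real by blast
  then have "b.ip (\<Psi> (a.e h)) (b.e k) \<in> \<real>" using h k by (simp add: b.real_subspace_iff)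
  then show ?thesis by (simp add: K_def of_real_Re)
qed

lemma K_split:
  assumes A: "A \<in> sets M" and h: "h \<in> real_L2 M" and k: "k \<in> real_L2 M"
  shows "K h k = K (cut A h) (cut A k) * K (cut (a.X - A) h) (cut (a.X - A) k)"
proof -
  have A': "a.X - A \<in> sets M" using A by auto
  note c = real_L2_cut[OF A h] real_L2_cut[OF A' h] real_L2_cut[OF A k] real_L2_cut[OF A' k]
  have "\<Psi> (a.e h) = class_mult Q (\<Psi> (a.e (cut A h))) (\<Psi> (a.e (cut (a.X - A) h)))"
    by (subst a.e_split[OF A h]) (rule \<Psi>_mult[OF A a.e_cut_in[OF A h] a.e_cut_in[OF A' h]])
  then have "complex_of_real (K h k) = complex_of_real (K (cut A h) (cut A k) * K (cut (a.X - A) h) (cut (a.X - A) k))"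
    using b.inner_mult_e[OF A \<Psi>_mem[OF A a.e_cut_in[OF A h]] \<Psi>_mem[OF A' a.e_cut_in[OF A' h]] k]
    by (simp add: K_eq h k c flip: K_eq[OF h k])
  then show ?thesis by (simp only: of_real_eq_iff)
qed

lemma K_disjoint:
  assumes A: "A \<in> sets M" and B: "B \<in> sets M" "A \<inter> B = {}" and h: "h \<in> real_L2 M" and k: "k \<in> real_L2 M"
  shows "K (cut (A \<union> B) h) (cut (A \<union> B) k) = K (cut A h) (cut A k) * K (cut B h) (cut B k)"
proof -
  have "A \<inter> (A \<union> B) = A" "(a.X - A) \<inter> (A \<union> B) = B" using B sets.sets_into_space[OF B(1)] by auto
  then show ?thesis
    using K_split[OF A real_L2_cut[OF _ h, of "A \<union> B"] real_L2_cut[OF _ k, of "A \<union> B"]] A B by (simp add: cut_cut)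
qed

definition "\<kappa> s t A = K (cut A (\<lambda>_. s)) (cut A (\<lambda>_. t))"

lemma \<kappa>_Un: "\<lbrakk>A \<in> sets M; B \<in> sets M; A \<inter> B = {}\<rbrakk> \<Longrightarrow> \<kappa> s t (A \<union> B) = \<kappa> s t A * \<kappa> s t B"
  unfolding \<kappa>_def by (rule K_disjoint) (auto intro: real_L2_const a.finM)

text \<open>\<Psi> is isometric and fixes the unit, so each of the three terms involving the unit is
  1 in absolute value, and together they contribute -1.\<close>

lemma inner_\<Psi>_ed:
  assumes A: "A \<in> sets M"
  shows "b.ip (\<Psi> (a.ed s A)) (b.ed t A) = complex_of_real (\<kappa> s t A - 1)"
proof -
  have c: "cut A (\<lambda>_. s) \<in> real_L2 M" "cut A (\<lambda>_. t) \<in> real_L2 M"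
    using A by (auto intro: real_L2_cut real_L2_const a.finM)
  have o: "a.one \<in> a.C a.X" "b.one \<in> b.C a.X" using a.one_in[of a.X] b.one_in[of a.X] by auto
  have "b.ip (\<Psi> (a.es s A)) b.one = 1"
    using \<Psi>_inner[of "a.es s A" a.one] A o c by (simp add: \<Psi>_one a.inner_es_one)
  then show ?thesis using A o c
    by (simp add: a.ed_def b.ed_def \<Psi>_add \<Psi>_scale \<Psi>_one \<kappa>_def K_eq[symmetric] b.inner_es_one b.inner_one_one)
qed

lemma \<kappa>_first_order:
  assumes A: "A \<in> sets M" "measure M A \<le> 1"
  shows "\<bar>\<kappa> s t A - 1\<bar> \<le> (sqrt (s\<^sup>2 * exp (s\<^sup>2)) * sqrt (t\<^sup>2 * exp (t\<^sup>2))) * measure M A"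
proof -
  have "\<bar>\<kappa> s t A - 1\<bar> = cmod (b.ip (\<Psi> (a.ed s A)) (b.ed t A))" by (simp only: inner_\<Psi>_ed[OF A(1)] norm_of_real)
  also have "\<dots> \<le> hnorm b.HX (\<Psi> (a.ed s A)) * hnorm b.HX (b.ed t A)" using A by (intro b.Cauchy_Schwarz) auto
  also have "\<dots> = hnorm a.HX (a.ed s A) * hnorm b.HX (b.ed t A)" using A by (simp add: \<Psi>_iso)
  also have "\<dots> \<le> (sqrt (s\<^sup>2 * exp (s\<^sup>2)) * sqrt (measure M A)) * (sqrt (t\<^sup>2 * exp (t\<^sup>2)) * sqrt (measure M A))"
    using A by (intro mult_mono a.norm_ed_le b.norm_ed_le) auto
  also have "\<dots> = (sqrt (s\<^sup>2 * exp (s\<^sup>2)) * sqrt (t\<^sup>2 * exp (t\<^sup>2))) * (sqrt (measure M A) * sqrt (measure M A))"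
    by (simp only: mult_ac)
  finally show ?thesis by simp
qed

text \<open>Linearise one argument at a time: the quantity equals the pairing of \<open>er s\<close>
  with \<open>ed t\<close> plus s times the pairing of \<open>ed 1\<close> with \<open>er t\<close>.
  By Cauchy-Schwarz each pairing is of order \<nu>(A) times \<nu>(A)^{1/2}.\<close>

lemma \<kappa>_second_order:
  "\<exists>c\<ge>0. \<forall>A\<in>sets M. measure M A \<le> 1 \<longrightarrow>
    \<bar>(\<kappa> s t A - 1) - s * t * (\<kappa> 1 1 A - 1)\<bar> \<le> c * (measure M A * sqrt (measure M A))"
proof -
  define R where "R s = sqrt (s^4 * exp (s\<^sup>2) + 2 * \<bar>s\<bar> * (s\<^sup>2 * exp \<bar>s\<bar>) + s\<^sup>2 * exp 1)" for s :: real
  define D where "D s = sqrt (s\<^sup>2 * exp (s\<^sup>2))" for s :: real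
  have R0: "R s \<ge> 0" and D0: "D s \<ge> 0" for s by (auto simp: R_def D_def)
  define c where "c = R s * D t + \<bar>s\<bar> * D 1 * R t"
  have c: "c \<ge> 0" using R0 D0 by (simp add: c_def)
  have "\<bar>(\<kappa> s t A - 1) - s * t * (\<kappa> 1 1 A - 1)\<bar> \<le> c * (measure M A * sqrt (measure M A))"
    if A: "A \<in> sets M" "measure M A \<le> 1" for A
  proof -
    note bd [simp] = a.ed_in[OF A(1)] b.ed_in[OF A(1)]
    have "b.ip (\<Psi> (a.er s A)) (b.ed t A) + complex_of_real s * b.ip (\<Psi> (a.ed 1 A)) (b.er t A)
        = complex_of_real ((\<kappa> s t A - 1) - s * (\<kappa> 1 t A - 1)) + s * complex_of_real ((\<kappa> 1 t A - 1) - t * (\<kappa> 1 1 A - 1))"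
      unfolding a.er_def b.er_def
      by (simp add: \<Psi>_add \<Psi>_scale inner_\<Psi>_ed[OF A(1)] del: of_real_diff)
         (simp add: algebra_simps)
    also have "\<dots> = complex_of_real ((\<kappa> s t A - 1) - s * t * (\<kappa> 1 1 A - 1))" by (simp add: algebra_simps)
    finally have "\<bar>(\<kappa> s t A - 1) - s * t * (\<kappa> 1 1 A - 1)\<bar>
        = cmod (b.ip (\<Psi> (a.er s A)) (b.ed t A) + complex_of_real s * b.ip (\<Psi> (a.ed 1 A)) (b.er t A))"
      by (simp only: norm_of_real)
    also have "\<dots> \<le> cmod (b.ip (\<Psi> (a.er s A)) (b.ed t A)) + \<bar>s\<bar> * cmod (b.ip (\<Psi> (a.ed 1 A)) (b.er t A))"
      by (rule norm_triangle_le) (simp add: norm_mult)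
    also have "\<dots> \<le> hnorm b.HX (\<Psi> (a.er s A)) * hnorm b.HX (b.ed t A)
        + \<bar>s\<bar> * (hnorm b.HX (\<Psi> (a.ed 1 A)) * hnorm b.HX (b.er t A))"
      by (intro add_mono mult_left_mono b.Cauchy_Schwarz) auto
    also have "\<dots> = hnorm a.HX (a.er s A) * hnorm b.HX (b.ed t A) + \<bar>s\<bar> * (hnorm a.HX (a.ed 1 A) * hnorm b.HX (b.er t A))"
      by (simp add: \<Psi>_iso)
    also have "\<dots> \<le> (R s * measure M A) * (D t * sqrt (measure M A)) + \<bar>s\<bar> * ((D 1 * sqrt (measure M A)) * (R t * measure M A))"
      unfolding R_def D_def
      using A by (intro add_mono mult_mono a.norm_ed_le b.norm_ed_le a.norm_er_le b.norm_er_le mult_nonneg_nonneg order_refl) auto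
    also have "\<dots> = c * (measure M A * sqrt (measure M A))" unfolding c_def by (simp add: algebra_simps)
    finally show ?thesis .
  qed
  with c show ?thesis by blast
qed

text \<open>On small sets \<kappa> is close to 1, and it is multiplicative over disjoint unions.
  Positivity is what permits taking logarithms.\<close>

lemma \<kappa>_pos:
  assumes A: "A \<in> sets M" shows "\<kappa> s t A > 0"
proof -
  define c where "c = sqrt (s\<^sup>2 * exp (s\<^sup>2)) * sqrt (t\<^sup>2 * exp (t\<^sup>2))"
  have c: "c \<ge> 0" by (simp add: c_def)
  show ?thesis
  \<comment> \<open>At this size the first order bound c \<nu>(A) is below 1, so \<kappa> stays away
    from 0.\<close>
  proof (rule nonatomic_induct[OF a.finM nonatomic, of "min 1 (1 / (2 * (c + 1)))"])
    fix A assume A: "A \<in> sets M" "measure M A \<le> min 1 (1 / (2 * (c + 1)))"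
    then have "\<bar>\<kappa> s t A - 1\<bar> \<le> c * measure M A" unfolding c_def by (intro \<kappa>_first_order) auto
    also have "\<dots> \<le> c * (1 / (2 * (c + 1)))" using A c by (intro mult_left_mono) auto
    also have "\<dots> < 1" using c by (simp add: field_simps)
    finally show "\<kappa> s t A > 0" by linarith
  qed (use A c in \<open>auto simp: \<kappa>_Un\<close>)
qed

lemma ln_\<kappa>_Un: "\<lbrakk>A \<in> sets M; B \<in> sets M; A \<inter> B = {}\<rbrakk> \<Longrightarrow> ln (\<kappa> s t (A \<union> B)) = ln (\<kappa> s t A) + ln (\<kappa> s t B)"
  by (simp only: \<kappa>_Un ln_mult_pos[OF \<kappa>_pos \<kappa>_pos])

definition "\<mu> A = ln (\<kappa> 1 1 A)"

text \<open>The difference of ln \<kappa>(s,t) and s t ln \<kappa>(1,1) is additive. On small sets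
  ln(1 + x) is x up to a quadratic error, and bilinearity up to order 3/2 then makes the difference
  small enough for \<open>additive_small_imp_zero\<close>.\<close>

lemma \<kappa>_eq:
  assumes A: "A \<in> sets M" shows "\<kappa> s t A = exp (s * t * \<mu> A)"
proof -
  define \<tau> where "\<tau> A = ln (\<kappa> s t A) - s * t * \<mu> A" for A
  define c1 where "c1 = sqrt (s\<^sup>2 * exp (s\<^sup>2)) * sqrt (t\<^sup>2 * exp (t\<^sup>2))"
  define c2 where "c2 = sqrt (1\<^sup>2 * exp (1\<^sup>2)) * sqrt (1\<^sup>2 * exp (1\<^sup>2 :: real))"
  obtain c3 where c3: "c3 \<ge> 0" "\<And>A. A \<in> sets M \<Longrightarrow> measure M A \<le> 1 \<Longrightarrow>
      \<bar>(\<kappa> s t A - 1) - s * t * (\<kappa> 1 1 A - 1)\<bar> \<le> c3 * (measure M A * sqrt (measure M A))"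
    using \<kappa>_second_order[of s t] by blast
  have c12: "c1 \<ge> 0" "c2 \<ge> 0" by (auto simp: c1_def c2_def)
  \<comment> \<open>Chosen so that \<kappa> - 1 is at most 1/2 in absolute value for both pairs of
    constants, the range in which |ln(1 + x) - x| \<le> 2 x^2 is available.\<close>
  define d where "d = min 1 (1 / (2 * (c1 + c2 + 1)))"
  have d: "d > 0" "d \<le> 1" using c12 by (auto simp: d_def)
  have "\<tau> A = 0"
  proof (rule additive_small_imp_zero[OF a.finM nonatomic A, of d "c3 + 2 * c1\<^sup>2 + \<bar>s * t\<bar> * (2 * c2\<^sup>2)"])
    fix A B assume "A \<in> sets M" "B \<in> sets M" "A \<inter> B = {}"
    then show "\<tau> (A \<union> B) = \<tau> A + \<tau> B"
      by (simp add: \<tau>_def \<mu>_def ln_\<kappa>_Un algebra_simps)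
  next
    fix A assume A: "A \<in> sets M" "measure M A \<le> d"
    let ?a = "measure M A"
    have a1: "?a \<le> 1" using A(2) d(2) by linarith
    \<comment> \<open>The quadratic errors of the logarithm are absorbed into the order 3/2.\<close>
    have a_sqrt: "?a\<^sup>2 \<le> ?a * sqrt ?a"
      using a1 mult_left_mono[of "sqrt ?a" 1 "sqrt ?a"] by (simp add: power2_eq_square mult_left_mono)
    have small: "\<bar>ln (1 + x) - x\<bar> \<le> 2 * (c * ?a)\<^sup>2" if "\<bar>x\<bar> \<le> c * ?a" "c \<ge> 0" "c \<le> c1 + c2" for x c
    proof -
      have "c * ?a \<le> (c1 + c2) * d" using that A by (intro mult_mono) auto
      also have "\<dots> \<le> (c1 + c2) * (1 / (2 * (c1 + c2 + 1)))" using c12 by (intro mult_left_mono) (auto simp: d_def)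
      also have "\<dots> \<le> 1 / 2" using c12 by (simp add: field_simps)
      finally have "\<bar>x\<bar> \<le> 1 / 2" using that by linarith
      then have "\<bar>ln (1 + x) - x\<bar> \<le> 2 * x\<^sup>2" by (rule abs_ln_one_plus_x_minus_x_bound)
      also have "\<dots> \<le> 2 * (c * ?a)\<^sup>2" using power_mono[OF that(1), of 2] by simp
      finally show ?thesis .
    qed
    have k1: "\<bar>ln (1 + (\<kappa> s t A - 1)) - (\<kappa> s t A - 1)\<bar> \<le> 2 * (c1 * ?a)\<^sup>2"
      using c12 \<kappa>_first_order[OF A(1) a1, of s t] by (intro small) (auto simp: c1_def)
    have k2: "\<bar>ln (1 + (\<kappa> 1 1 A - 1)) - (\<kappa> 1 1 A - 1)\<bar> \<le> 2 * (c2 * ?a)\<^sup>2"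
      using c12 \<kappa>_first_order[OF A(1) a1, of 1 1] by (intro small) (auto simp: c2_def)
    have "\<tau> A = (ln (1 + (\<kappa> s t A - 1)) - (\<kappa> s t A - 1)) + ((\<kappa> s t A - 1) - s * t * (\<kappa> 1 1 A - 1))
        - s * t * (ln (1 + (\<kappa> 1 1 A - 1)) - (\<kappa> 1 1 A - 1))"
      by (simp add: \<tau>_def \<mu>_def algebra_simps)
    then have "\<bar>\<tau> A\<bar> \<le> \<bar>ln (1 + (\<kappa> s t A - 1)) - (\<kappa> s t A - 1)\<bar> + \<bar>(\<kappa> s t A - 1) - s * t * (\<kappa> 1 1 A - 1)\<bar>
        + \<bar>s * t\<bar> * \<bar>ln (1 + (\<kappa> 1 1 A - 1)) - (\<kappa> 1 1 A - 1)\<bar>"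
      unfolding abs_mult[symmetric] by linarith
    also have "\<dots> \<le> 2 * (c1 * ?a)\<^sup>2 + c3 * (?a * sqrt ?a) + \<bar>s * t\<bar> * (2 * (c2 * ?a)\<^sup>2)"
      by (intro add_mono mult_left_mono k1 k2 c3 A a1) auto
    also have "\<dots> = (2 * c1\<^sup>2 + \<bar>s * t\<bar> * (2 * c2\<^sup>2)) * ?a\<^sup>2 + c3 * (?a * sqrt ?a)"
      by (simp add: power_mult_distrib algebra_simps)
    also have "\<dots> \<le> (2 * c1\<^sup>2 + \<bar>s * t\<bar> * (2 * c2\<^sup>2)) * (?a * sqrt ?a) + c3 * (?a * sqrt ?a)"
      by (intro add_mono mult_left_mono a_sqrt) (use c3(1) in auto)
    finally show "\<bar>\<tau> A\<bar> \<le> (c3 + 2 * c1\<^sup>2 + \<bar>s * t\<bar> * (2 * c2\<^sup>2)) * (?a * sqrt ?a)" by (simp add: algebra_simps)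
  qed (use c3 d in auto)
  then show ?thesis using exp_ln[OF \<kappa>_pos[OF A, of s t]] by (simp add: \<tau>_def)
qed

lemma \<mu>_Un: "\<lbrakk>A \<in> sets M; B \<in> sets M; A \<inter> B = {}\<rbrakk> \<Longrightarrow> \<mu> (A \<union> B) = \<mu> A + \<mu> B"
  unfolding \<mu>_def by (rule ln_\<kappa>_Un)

text \<open>Cauchy-Schwarz for the constants s = 1 and t = 1 or -1 gives exp(\<mu>(A)) and
  exp(-\<mu>(A)) both at most exp(\<nu>(A)).\<close>

lemma \<mu>_bound:
  assumes A: "A \<in> sets M" shows "\<bar>\<mu> A\<bar> \<le> measure M A"
proof -
  have "\<kappa> s t A \<le> exp (measure M A)" if "s\<^sup>2 = 1" "t\<^sup>2 = 1" for s t
  proof -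
    have c: "cut A (\<lambda>_. s) \<in> real_L2 M" "cut A (\<lambda>_. t) \<in> real_L2 M"
      using A by (auto intro: real_L2_cut real_L2_const a.finM)
    have n: "hnorm a.HX (a.es s A) = sqrt (exp (measure M A))" "hnorm b.HX (b.es t A) = sqrt (exp (measure M A))"
      using that A by (simp_all add: hnorm_def a.inner_es b.inner_es power2_eq_square)
    have "\<kappa> s t A \<le> \<bar>\<kappa> s t A\<bar>" by simp
    also have "\<dots> = cmod (b.ip (\<Psi> (a.es s A)) (b.es t A))" using c by (simp add: K_eq \<kappa>_def)
    also have "\<dots> \<le> hnorm b.HX (\<Psi> (a.es s A)) * hnorm b.HX (b.es t A)" using c by (intro b.Cauchy_Schwarz) auto
    also have "\<dots> = exp (measure M A)" using c by (simp add: \<Psi>_iso n)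
    finally show ?thesis .
  qed
  from this[of 1 1] this[of 1 "-1"] show ?thesis by (simp add: \<kappa>_eq[OF A])
qed

text \<open>The kernel is K(h,h') = exp(\<integral> k h h') with k the density of \<mu>: first for
  simple functions by multiplicativity, then in general by continuity. This is the transform of the
  exponential of k h.\<close>

theorem sign:
  "\<exists>\<epsilon>\<in>borel_measurable M. (\<forall>x\<in>space M. \<epsilon> x \<in> {-1, 1}) \<and>
    (\<forall>h\<in>real_L2 M. \<Psi> (a.e h) = b.e (\<lambda>x. \<epsilon> x * h x))"
proof -
  obtain k where k [measurable]: "k \<in> borel_measurable M" and k1: "\<And>x. \<bar>k x\<bar> \<le> 1"
    and \<mu>k: "\<And>A. A \<in> sets M \<Longrightarrow> \<mu> A = (\<integral>x. k x * indicator A x \<partial>M)"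
    using Radon_Nikodym_bounded[OF a.finM \<mu>_Un \<mu>_bound] by blast
  interpret finite_measure M by (rule a.finM)
  note kL = real_L2_mult_bounded[OF k k1]
  define J where "J h h' = (\<integral>x. (k x * h x) * h' x \<partial>M)" for h h'
  have simple: "K h h' = exp (J h h')"
    if s: "simple_function M h" "simple_function M h'" and h: "h \<in> real_L2 M" "h' \<in> real_L2 M" for h h'
  proof -
    have Am: "{x\<in>a.X. (h x, h' x) \<in> S} \<in> sets M" if "S \<subseteq> (\<lambda>x. (h x, h' x)) ` a.X" for S
    proof -
      have "simple_function M (\<lambda>x. (h x, h' x))" by (rule simple_function_Pair[OF s])
      then have "(\<lambda>x. (h x, h' x)) -` S \<inter> a.X \<in> sets M"
        by (rule simple_functionD(2))
      moreover have "(\<lambda>x. (h x, h' x)) -` S \<inter> a.X = {x\<in>a.X. (h x, h' x) \<in> S}" by auto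
      ultimately show ?thesis by simp
    qed
    have finS: "finite ((\<lambda>x. (h x, h' x)) ` a.X)"
      using simple_functionD(1)[OF simple_function_Pair[OF s]] .
    \<comment> \<open>Induction over a set of joint values: on the level set of one pair both
      functions are constant and \<open>\<kappa>_eq\<close> applies, and both sides are
      multiplicative over disjoint sets.\<close>
    have *: "K (cut {x\<in>a.X. (h x, h' x) \<in> S} h) (cut {x\<in>a.X. (h x, h' x) \<in> S} h')
        = exp (J (cut {x\<in>a.X. (h x, h' x) \<in> S} h) (cut {x\<in>a.X. (h x, h' x) \<in> S} h'))"
      if "S \<subseteq> (\<lambda>x. (h x, h' x)) ` a.X" for S
      using finite_subset[OF that finS] that
    proof (induction S rule: finite_induct)
      case empty
      have "cut {} (\<lambda>_. 0) = cut {} h" "cut {} (\<lambda>_. 0) = cut {} h'" by (auto simp: cut_def)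
      then have "K (cut {} h) (cut {} h') = \<kappa> 0 0 {}" by (simp add: \<kappa>_def)
      then show ?case by (simp add: \<kappa>_eq) (simp add: J_def cut_def)
    next
      case (insert p S)
      obtain s t where p: "p = (s, t)" by (cases p)
      let ?A = "{x\<in>a.X. (h x, h' x) \<in> S}" and ?B = "{x\<in>a.X. (h x, h' x) \<in> {p}}"
      have U: "{x\<in>a.X. (h x, h' x) \<in> insert p S} = ?A \<union> ?B" and D: "?A \<inter> ?B = {}" using insert(2) by auto
      have A: "?A \<in> sets M" by (rule Am) (use insert.prems in blast)
      have B: "?B \<in> sets M" by (rule Am) (use insert.prems in blast)
      have cB: "cut ?B h = cut ?B (\<lambda>_. s)" "cut ?B h' = cut ?B (\<lambda>_. t)" by (auto simp: cut_def p)
      have "K (cut ?B h) (cut ?B h') = exp (s * t * \<mu> ?B)" unfolding cB using \<kappa>_eq[OF B] by (simp add: \<kappa>_def)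
      also have "s * t * \<mu> ?B = (\<integral>x. s * t * (k x * indicator ?B x) \<partial>M)" unfolding \<mu>k[OF B] by simp
      also have "\<dots> = J (cut ?B h) (cut ?B h')" unfolding J_def cB
        by (rule Bochner_Integration.integral_cong) (auto simp: cut_def)
      finally have KB: "K (cut ?B h) (cut ?B h') = exp (J (cut ?B h) (cut ?B h'))" .
      have int: "integrable M (\<lambda>x. k x * cut C h x * cut C h' x)" if "C \<in> sets M" for C
        by (intro real_L2_mult_integrable kL real_L2_cut that h)
      have "J (cut (?A \<union> ?B) h) (cut (?A \<union> ?B) h')
          = (\<integral>x. k x * cut ?A h x * cut ?A h' x + k x * cut ?B h x * cut ?B h' x \<partial>M)"
        unfolding J_def by (rule Bochner_Integration.integral_cong) (use D in \<open>auto simp: cut_def\<close>)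
      also have "\<dots> = J (cut ?A h) (cut ?A h') + J (cut ?B h) (cut ?B h')"
        unfolding J_def by (rule Bochner_Integration.integral_add[OF int[OF A] int[OF B]])
      finally have JU: "J (cut (?A \<union> ?B) h) (cut (?A \<union> ?B) h') = J (cut ?A h) (cut ?A h') + J (cut ?B h) (cut ?B h')" .
      show ?case
        unfolding U JU K_disjoint[OF A B D h] exp_add KB using insert.IH insert.prems by simp
    qed
    have X: "{x\<in>a.X. (h x, h' x) \<in> (\<lambda>x. (h x, h' x)) ` a.X} = a.X" by auto
    have "a.e (cut a.X h) = a.e h"
      by (rule a.e_cong[OF real_L2_cut[OF sets.top h(1)] h(1)]) (simp add: cut_def)
    moreover have "b.e (cut a.X h') = b.e h'"
      by (rule b.e_cong[OF real_L2_cut[OF sets.top h(2)] h(2)]) (simp add: cut_def)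
    ultimately have "K (cut a.X h) (cut a.X h') = K h h'" by (simp add: K_def)
    moreover have "J (cut a.X h) (cut a.X h') = J h h'"
      unfolding J_def by (rule Bochner_Integration.integral_cong) (auto simp: cut_def)
    ultimately show ?thesis using *[OF order_refl] by (simp only: X)
  qed
  \<comment> \<open>The limits are taken one argument at a time: in \<open>h\<close> by continuity
    of \<Psi>, afterwards in \<open>h'\<close> by continuity of the inner product.\<close>
  have half: "K h h' = exp (J h h')"
    if s': "simple_function M h'" and h: "h \<in> real_L2 M" "h' \<in> real_L2 M" for h h'
  proof -
    obtain s where s: "\<And>n. simple_function M (s n)" "\<And>n. s n \<in> real_L2 M"
      and l: "\<And>g. g \<in> real_L2 M \<Longrightarrow> (\<lambda>n. \<integral>x. s n x * g x \<partial>M) \<longlonglongrightarrow> (\<integral>x. h x * g x \<partial>M)"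
      "(\<lambda>n. \<integral>x. s n x * s n x \<partial>M) \<longlonglongrightarrow> (\<integral>x. h x * h x \<partial>M)"
      by (rule real_L2_simple_approx[OF h(1)]) blast
    have lim: "(\<lambda>n. hnorm a.HX (a.diff (a.e (s n)) (a.e h))) \<longlonglongrightarrow> 0"
      by (rule a.e_tendsto[OF s(2) h(1) l(1)[OF h(1)] l(2)])
    have "hnorm b.HX (b.diff (\<Psi> (a.e (s n))) (\<Psi> (a.e h))) = hnorm a.HX (a.diff (a.e (s n)) (a.e h))" for n
    proof -
      have "b.diff (\<Psi> (a.e (s n))) (\<Psi> (a.e h)) = \<Psi> (a.diff (a.e (s n)) (a.e h))"
        using s h by (simp add: \<Psi>_add \<Psi>_scale)
      then show ?thesis using s h by (simp add: \<Psi>_iso)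
    qed
    with lim have lim': "(\<lambda>n. hnorm b.HX (b.diff (\<Psi> (a.e (s n))) (\<Psi> (a.e h)))) \<longlonglongrightarrow> 0" by simp
    have "(\<lambda>n. b.ip (\<Psi> (a.e (s n))) (b.e h')) \<longlonglongrightarrow> b.ip (\<Psi> (a.e h)) (b.e h')"
      by (rule b.inner_tendsto[OF _ _ lim']) (use s h in auto)
    then have "(\<lambda>n. K (s n) h') \<longlonglongrightarrow> K h h'" using s h by (simp add: K_eq tendsto_of_real_iff)
    moreover have "(\<lambda>n. J (s n) h') \<longlonglongrightarrow> J h h'"
      using l(1)[OF kL[OF h(2)]] by (simp add: J_def mult_ac)
    then have "(\<lambda>n. K (s n) h') \<longlonglongrightarrow> exp (J h h')"
      using simple[OF s(1) s' s(2) h(2)] by (simp add: tendsto_exp)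
    ultimately show ?thesis by (rule LIMSEQ_unique)
  qed
  have full: "K h h' = exp (J h h')" if h: "h \<in> real_L2 M" "h' \<in> real_L2 M" for h h'
  proof -
    obtain s where s: "\<And>n. simple_function M (s n)" "\<And>n. s n \<in> real_L2 M"
      and l: "\<And>g. g \<in> real_L2 M \<Longrightarrow> (\<lambda>n. \<integral>x. s n x * g x \<partial>M) \<longlonglongrightarrow> (\<integral>x. h' x * g x \<partial>M)"
      "(\<lambda>n. \<integral>x. s n x * s n x \<partial>M) \<longlonglongrightarrow> (\<integral>x. h' x * h' x \<partial>M)"
      by (rule real_L2_simple_approx[OF h(2)]) blast
    have lim: "(\<lambda>n. hnorm b.HX (b.diff (b.e (s n)) (b.e h'))) \<longlonglongrightarrow> 0"
      by (rule b.e_tendsto[OF s(2) h(2) l(1)[OF h(2)] l(2)])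
    have "(\<lambda>n. b.ip (b.e (s n)) (\<Psi> (a.e h))) \<longlonglongrightarrow> b.ip (b.e h') (\<Psi> (a.e h))"
      by (rule b.inner_tendsto[OF _ _ lim]) (use s h in auto)
    then have "(\<lambda>n. K h (s n)) \<longlonglongrightarrow> K h h'"
      using s h by (simp add: b.inner_commute[of "\<Psi> (a.e h)" "b.e _"] K_eq tendsto_of_real_iff)
    moreover have "(\<lambda>n. J h (s n)) \<longlonglongrightarrow> J h h'"
      using l(1)[OF kL[OF h(1)]] by (simp add: J_def mult_ac)
    then have "(\<lambda>n. K h (s n)) \<longlonglongrightarrow> exp (J h h')"
      using half[OF s(1) h(1) s(2)] by (simp add: tendsto_exp)
    ultimately show ?thesis by (rule LIMSEQ_unique)
  qed
  have \<Psi>k: "\<Psi> (a.e h) = b.e (\<lambda>x. k x * h x)" if h: "h \<in> real_L2 M" for h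
    by (rule b.X_ext) (use h kL in \<open>auto simp: K_eq full J_def b.inner_e\<close>)
  \<comment> \<open>Isometry on the exponential of the constant 1 gives \<integral> k^2 = \<nu>(X);
    with |k| \<le> 1 this forces k^2 = 1 almost everywhere.\<close>
  let ?o = "\<lambda>_::'a. 1 :: real"
  have o: "?o \<in> real_L2 M" by (rule real_L2_const[OF a.finM])
  have k1L: "k \<in> real_L2 M" using kL[OF o] by simp
  have ik: "integrable M (\<lambda>x. k x * k x)" by (rule real_L2_mult_integrable[OF k1L k1L])
  have "hnorm b.HX (b.e k) = hnorm a.HX (a.e ?o)" using \<Psi>k[OF o] \<Psi>_iso[of "a.e ?o"] o by simp
  then have "(\<integral>x. k x * k x \<partial>M) = measure M a.X" using o k1L by (simp add: hnorm_def a.inner_e b.inner_e)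
  then have I0: "(\<integral>x. 1 - k x * k x \<partial>M) = 0" using ik by simp
  have nn: "0 \<le> 1 - k x * k x" for x
    using power_mono[OF k1[of x], of 2] by (simp add: power2_eq_square abs_mult_self)
  have "integrable M (\<lambda>x. 1 - k x * k x)" using ik by simp
  from integral_nonneg_eq_0_iff_AE[OF this AE_I2[OF nn]] I0 have kk: "AE x in M. 1 - k x * k x = 0" by blast
  \<comment> \<open>k takes the values 1 and -1 only almost everywhere; its sign function takes them
    at every point.\<close>
  define \<epsilon> where "\<epsilon> x = (if k x \<ge> 0 then 1 else -1 :: real)" for x
  have [measurable]: "\<epsilon> \<in> borel_measurable M" unfolding \<epsilon>_def by measurable
  have \<epsilon>k: "AE x in M. k x = \<epsilon> x"
    using kk
  proof eventually_elim
    case (elim x)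
    then have "(k x)\<^sup>2 = 1" by (simp add: power2_eq_square)
    then show ?case by (auto simp: \<epsilon>_def power2_eq_1_iff)
  qed
  show ?thesis
  proof (intro bexI conjI ballI)
    fix h assume h: "h \<in> real_L2 M"
    have "(\<lambda>x. \<epsilon> x * h x) \<in> real_L2 M" by (rule real_L2_mult_bounded[OF _ _ h]) (auto simp: \<epsilon>_def)
    moreover have "AE x in M. k x * h x = \<epsilon> x * h x" using \<epsilon>k by eventually_elim simp
    ultimately have "b.e (\<lambda>x. k x * h x) = b.e (\<lambda>x. \<epsilon> x * h x)" by (intro b.e_cong kL h)
    then show "\<Psi> (a.e h) = b.e (\<lambda>x. \<epsilon> x * h x)" using \<Psi>k[OF h] by simp
  qed (auto simp: \<epsilon>_def)
qed

end

section \<open>White noise\<close>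

lemma std_normal_mgf:
  "integrable std_normal_distribution (\<lambda>x. exp (s * x))"
  "(\<integral>x. exp (s * x) \<partial>std_normal_distribution) = exp (s\<^sup>2 / 2)"
proof -
  \<comment> \<open>Completing the square.\<close>
  have eq: "std_normal_density x * exp (s * x) = exp (s\<^sup>2 / 2) * normal_density s 1 x" for x :: real
    by (simp add: normal_density_def mult_exp_exp) (simp add: power2_eq_square field_simps)
  have "integrable lborel (\<lambda>x. std_normal_density x * exp (s * x))"
    unfolding eq by (intro integrable_mult_right integrable_normal_density) simp
  then show "integrable std_normal_distribution (\<lambda>x. exp (s * x))"
    by (subst integrable_density) auto
  have "(\<integral>x. exp (s * x) \<partial>std_normal_distribution) = (\<integral>x. std_normal_density x * exp (s * x) \<partial>lborel)"
    by (subst integral_density) auto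
  also have "\<dots> = exp (s\<^sup>2 / 2)" unfolding eq by (simp add: integral_normal_density)
  finally show "(\<integral>x. exp (s * x) \<partial>std_normal_distribution) = exp (s\<^sup>2 / 2)" .
qed

locale white_noise =
  fixes M :: "'a measure" and P :: "'s measure" and W :: "('a \<Rightarrow> real) \<Rightarrow> 's \<Rightarrow> real"
  assumes finM: "finite_measure M" and W: "gaussian_white_noise M P W"
begin

abbreviation "sq h \<equiv> \<integral>x. (h x)\<^sup>2 \<partial>M"

lemma probP: "prob_space P"
  and W_meas: "h \<in> real_L2 M \<Longrightarrow> W h \<in> borel_measurable P"
  and W_lin: "\<lbrakk>h \<in> real_L2 M; k \<in> real_L2 M\<rbrakk> \<Longrightarrow> AE \<omega> in P. W (\<lambda>x. a * h x + b * k x) \<omega> = a * W h \<omega> + b * W k \<omega>"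
  and W_char: "h \<in> real_L2 M \<Longrightarrow> (\<integral>\<omega>. iexp (W h \<omega>) \<partial>P) = complex_of_real (exp (- sq h / 2))"
  using W unfolding gaussian_white_noise_def by auto

lemma W_add: "\<lbrakk>h \<in> real_L2 M; k \<in> real_L2 M\<rbrakk> \<Longrightarrow> AE \<omega> in P. W (\<lambda>x. h x + k x) \<omega> = W h \<omega> + W k \<omega>"
  using W_lin[of h k 1 1] by simp

lemma W_scale: "h \<in> real_L2 M \<Longrightarrow> AE \<omega> in P. W (\<lambda>x. t * h x) \<omega> = t * W h \<omega>"
  using W_lin[of h h t 0] by simp

text \<open>The law is described as the image of the standard normal law under scaling, which
  includes the degenerate case of norm 0, where there is no density. Linearity turns the
  characteristic function of W h at t into the prescribed one of t h.\<close>

lemma W_distr: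
  assumes h: "h \<in> real_L2 M"
  shows "distr P borel (W h) = distr std_normal_distribution borel (\<lambda>x. sqrt (sq h) * x)"
proof (rule Levy_uniqueness)
  interpret P: prob_space P by (rule probP)
  interpret S: prob_space std_normal_distribution by (rule real_dist_normal_dist[THEN real_distribution.axioms(1)])
  note [measurable] = W_meas[OF h]
  show "real_distribution (distr P borel (W h))" by (rule P.real_distribution_distr) measurable
  show "real_distribution (distr std_normal_distribution borel (\<lambda>x. sqrt (sq h) * x))"
    by (rule S.real_distribution_distr) simp
  show "char (distr P borel (W h)) = char (distr std_normal_distribution borel (\<lambda>x. sqrt (sq h) * x))"
  proof
    fix t
    have th: "(\<lambda>x. t * h x) \<in> real_L2 M" using h by (rule real_L2_scale)
    note [measurable] = W_meas[OF th]
    have "char (distr P borel (W h)) t = (\<integral>\<omega>. iexp (t * W h \<omega>) \<partial>P)"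
      unfolding char_def by (subst integral_distr) auto
    also have "\<dots> = (\<integral>\<omega>. iexp (W (\<lambda>x. t * h x) \<omega>) \<partial>P)"
      by (rule integral_cong_AE) (measurable, use W_scale[OF h, where t = t] in eventually_elim, simp)
    also have "\<dots> = complex_of_real (exp (- ((sqrt (sq h) * t)\<^sup>2) / 2))"
      by (simp add: W_char[OF th] power_mult_distrib mult.commute)
    also have "\<dots> = char std_normal_distribution (sqrt (sq h) * t)"
      by (simp add: char_std_normal_distribution)
    also have "\<dots> = char (distr std_normal_distribution borel (\<lambda>x. sqrt (sq h) * x)) t"
      unfolding char_def by (subst integral_distr) (auto simp: mult_ac)
    finally show "char (distr P borel (W h)) t = char (distr std_normal_distribution borel (\<lambda>x. sqrt (sq h) * x)) t" .
  qed
qed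

text \<open>White noise is specified by characteristic functions only, which say nothing directly
  about exponential moments; these are computed from the law found in
  \<open>W_distr\<close>.\<close>

lemma W_mgf:
  assumes h: "h \<in> real_L2 M"
  shows "integrable P (\<lambda>\<omega>. exp (W h \<omega>))" "(\<integral>\<omega>. exp (W h \<omega>) \<partial>P) = exp (sq h / 2)"
proof -
  note [measurable] = W_meas[OF h]
  let ?D = "distr std_normal_distribution borel (\<lambda>x. sqrt (sq h) * x)"
  have "integrable ?D exp" using std_normal_mgf(1)[of "sqrt (sq h)"] by (subst integrable_distr_eq) auto
  then have "integrable (distr P borel (W h)) exp" by (simp only: W_distr[OF h])
  then show "integrable P (\<lambda>\<omega>. exp (W h \<omega>))" by (subst (asm) integrable_distr_eq) auto
  have "(\<integral>\<omega>. exp (W h \<omega>) \<partial>P) = (\<integral>x. exp x \<partial>distr P borel (W h))" by (subst integral_distr) auto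
  also have "\<dots> = (\<integral>x. exp x \<partial>?D)" by (simp only: W_distr[OF h])
  also have "\<dots> = (\<integral>x. exp (sqrt (sq h) * x) \<partial>std_normal_distribution)" by (subst integral_distr) auto
  also have "\<dots> = exp (sq h / 2)" by (simp add: std_normal_mgf(2))
  finally show "(\<integral>\<omega>. exp (W h \<omega>) \<partial>P) = exp (sq h / 2)" .
qed

definition "E h \<omega> = exp (W h \<omega> - sq h / 2)"

lemma sq_add:
  assumes "h \<in> real_L2 M" "k \<in> real_L2 M"
  shows "sq (\<lambda>x. h x + k x) = sq h + sq k + 2 * (\<integral>x. h x * k x \<partial>M)"
proof -
  have "sq (\<lambda>x. h x + k x) = (\<integral>x. ((h x)\<^sup>2 + (k x)\<^sup>2) + 2 * (h x * k x) \<partial>M)"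
    by (simp add: power2_sum mult.assoc)
  also have "\<dots> = sq h + sq k + 2 * (\<integral>x. h x * k x \<partial>M)"
    using assms real_L2_mult_integrable[OF assms] by (simp add: real_L2_def)
  finally show ?thesis .
qed

abbreviation "gens A \<equiv> {W h -` B \<inter> space P | h B.
  h \<in> real_L2 M \<and> (\<forall>x\<in>space M - A. h x = 0) \<and> B \<in> sets borel}"

lemma gens_sub: "gens A \<subseteq> sets P"
  using W_meas by (auto intro: measurable_sets)

lemma sets_field: "sets (gaussian_field M P W A) = sigma_sets (space P) (gens A)"
  and space_field: "space (gaussian_field M P W A) = space P"
  using gens_sub[of A, THEN order_trans, OF sets.space_closed]
  by (simp_all add: gaussian_field_def sets_measure_of space_measure_of)

sublocale fock_space M P "gaussian_field M P W" E
proof (rule fock_space.intro)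
  show "finite_measure M" by (rule finM)
  show "prob_space P" by (rule probP)
  show "subalgebra P (gaussian_field M P W A)" for A
    unfolding subalgebra_def using space_field sets_field sets.sigma_sets_subset[OF gens_sub] by simp
  show "sets (gaussian_field M P W A) \<subseteq> sets (gaussian_field M P W B)" if "A \<subseteq> B" for A B
    unfolding sets_field by (rule sigma_sets_mono') (use that in blast)
  show "E h \<in> borel_measurable (gaussian_field M P W A)"
    if h: "h \<in> real_L2 M" "\<forall>x\<in>space M - A. h x = 0" for A h
  proof -
    have "W h \<in> borel_measurable (gaussian_field M P W A)"
    proof (rule measurableI)
      fix B :: "real set" assume "B \<in> sets borel"
      then show "W h -` B \<inter> space (gaussian_field M P W A) \<in> sets (gaussian_field M P W A)"
        unfolding space_field sets_field using h by (intro sigma_sets.Basic) blast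
    qed simp
    then show ?thesis unfolding E_def by measurable
  qed
  have int: "integrable P (\<lambda>\<omega>. E h \<omega> * E k \<omega>) \<and> (\<integral>\<omega>. E h \<omega> * E k \<omega> \<partial>P) = exp (\<integral>x. h x * k x \<partial>M)"
    if h: "h \<in> real_L2 M" and k: "k \<in> real_L2 M" for h k
  proof -
    note hk = real_L2_add[OF h k]
    note [measurable] = W_meas[OF h] W_meas[OF k] W_meas[OF hk]
    \<comment> \<open>By polarisation, half the squared norm of h + k minus those of h and k is the
      inner product.\<close>
    let ?c = "exp (- sq h / 2 - sq k / 2)"
    have [measurable]: "E h \<in> borel_measurable P" "E k \<in> borel_measurable P" unfolding E_def by measurable
    have eq: "AE \<omega> in P. ?c * exp (W (\<lambda>x. h x + k x) \<omega>) = E h \<omega> * E k \<omega>"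
      using W_add[OF h k] by eventually_elim (simp add: E_def flip: exp_add)
    have i: "integrable P (\<lambda>\<omega>. ?c * exp (W (\<lambda>x. h x + k x) \<omega>))" by (intro integrable_mult_right W_mgf(1) hk)
    have "integrable P (\<lambda>\<omega>. E h \<omega> * E k \<omega>)" by (rule integrable_cong_AE_imp[OF i _ eq]) measurable
    moreover have "(\<integral>\<omega>. ?c * exp (W (\<lambda>x. h x + k x) \<omega>) \<partial>P) = (\<integral>\<omega>. E h \<omega> * E k \<omega> \<partial>P)"
      by (rule integral_cong_AE[OF _ _ eq]) measurable
    moreover have "(\<integral>\<omega>. ?c * exp (W (\<lambda>x. h x + k x) \<omega>) \<partial>P) = ?c * exp (sq (\<lambda>x. h x + k x) / 2)"
      by (simp only: integral_mult_right_zero W_mgf(2)[OF hk])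
    moreover have "\<dots> = exp (\<integral>x. h x * k x \<partial>M)"
      unfolding sq_add[OF h k] exp_add[symmetric] by (simp add: field_simps)
    ultimately show ?thesis by simp
  qed
  then show "integrable P (\<lambda>\<omega>. E h \<omega> * E k \<omega>)" "(\<integral>\<omega>. E h \<omega> * E k \<omega> \<partial>P) = exp (\<integral>x. h x * k x \<partial>M)"
    if "h \<in> real_L2 M" "k \<in> real_L2 M" for h k using that by auto
  show "AE \<omega> in P. E (\<lambda>x. h x + k x) \<omega> = E h \<omega> * E k \<omega>"
    if h: "h \<in> real_L2 M" and k: "k \<in> real_L2 M" and s: "\<forall>x\<in>space M - A. h x = 0" "\<forall>x\<in>A. k x = 0" for A h k
  proof -
    have "(\<integral>x. h x * k x \<partial>M) = 0" by (rule integral_eq_zero_AE, rule AE_I2) (use s in auto)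
    then have "sq (\<lambda>x. h x + k x) = sq h + sq k" using sq_add[OF h k] by simp
    then have eq: "sq (\<lambda>x. h x + k x) / 2 = sq h / 2 + sq k / 2" by simp
    show ?thesis using W_add[OF h k]
      by eventually_elim (simp add: E_def eq flip: exp_add)
  qed
  show "AE \<omega> in P. E (\<lambda>_. 0) \<omega> = 1"
    using W_scale[OF real_L2_zero, of 0] by (auto simp: E_def elim!: AE_mp intro!: AE_I2)
  show "(\<integral>\<omega>. u \<omega> * indicator D \<omega> \<partial>P) = 0"
    if u: "u \<in> borel_measurable P" "integrable P (\<lambda>\<omega>. (u \<omega>)\<^sup>2)"
      and orth: "\<And>h. \<lbrakk>h \<in> real_L2 M; \<forall>x\<in>space M - A. h x = 0\<rbrakk> \<Longrightarrow> (\<integral>\<omega>. u \<omega> * E h \<omega> \<partial>P) = 0"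
      and D: "D \<in> sets (gaussian_field M P W A)" for A u D
  proof -
    \<comment> \<open>Linear up to null sets in h, and every generator of the field is an event
      about a single W h: these are the two requirements of
      \<open>exp_zero_imp_zero_on_generated\<close>.\<close>
    let ?Y = "{W h | h. h \<in> real_L2 M \<and> (\<forall>x\<in>space M - A. h x = 0)}"
    interpret exponential_family P ?Y
    proof (rule exponential_family.intro)
      show "finite_measure P" using probP by (simp add: prob_space_def)
      show "?Y \<noteq> {}" using real_L2_zero by blast
      show "Y \<in> borel_measurable P" "integrable P (\<lambda>x. exp (Y x))" if "Y \<in> ?Y" for Y
        using that W_meas W_mgf(1) by auto
      fix Y Z a b assume "Y \<in> ?Y" "Z \<in> ?Y"
      then obtain h k where h: "Y = W h" "h \<in> real_L2 M" "\<forall>x\<in>space M - A. h x = 0"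
        and k: "Z = W k" "k \<in> real_L2 M" "\<forall>x\<in>space M - A. k x = 0" by blast
      have "W (\<lambda>x. a * h x + b * k x) \<in> ?Y"
        using h k real_L2_add[OF real_L2_scale[OF h(2)] real_L2_scale[OF k(2)]] by auto
      then show "\<exists>X\<in>?Y. AE x in P. X x = a * Y x + b * Z x" using W_lin[OF h(2) k(2)] h k by blast
    qed
    show ?thesis
    proof (rule exp_zero_imp_zero_on_generated[OF u, where \<E> = "gens A"])
      fix Y assume "Y \<in> ?Y"
      then obtain h where h: "Y = W h" "h \<in> real_L2 M" "\<forall>x\<in>space M - A. h x = 0" by blast
      have "u \<omega> * exp (Y \<omega>) = exp (sq h / 2) * (u \<omega> * E h \<omega>)" for \<omega>
        by (simp add: E_def h(1) exp_diff)
      then have "(\<integral>x. u x * exp (Y x) \<partial>P) = exp (sq h / 2) * (\<integral>\<omega>. u \<omega> * E h \<omega> \<partial>P)"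
        by (simp only: integral_mult_right_zero)
      then show "(\<integral>x. u x * exp (Y x) \<partial>P) = 0" using orth[OF h(2,3)] by simp
    next
      fix S assume "S \<in> gens A"
      then obtain h B where S: "S = W h -` B \<inter> space P" "h \<in> real_L2 M" "\<forall>x\<in>space M - A. h x = 0" "B \<in> sets borel"
        by blast
      have "AE x in P. x \<in> S \<longleftrightarrow> W h x \<in> B" using S(1) by auto
      then show "\<exists>Y\<in>?Y. \<exists>B\<in>sets borel. AE x in P. x \<in> S \<longleftrightarrow> Y x \<in> B" using S by blast
    next
      show "gens A \<subseteq> sets P" by (rule gens_sub)
      show "D \<in> sigma_sets (space P) (gens A)" using D by (simp only: sets_field)
    qed
  qed
qed

lemma e_eq: "e h = gaussian_exponential M P W h"
  by (simp add: e_def E_def gaussian_exponential_def)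

end

section \<open>The Poisson process\<close>

lemma num_points_finite:
  assumes "finite {x\<in>B. c x \<noteq> 0}"
  shows "num_points c B = ennreal (\<Sum>x\<in>{x\<in>B. c x \<noteq> 0}. real (c x))"
proof -
  have eq: "{x\<in>B. (0::ennreal) < of_nat (c x)} = {x\<in>B. c x \<noteq> 0}" by (simp add: ennreal_of_nat_eq_real_of_nat)
  have "num_points c B = (\<Sum>x\<in>{x\<in>B. c x \<noteq> 0}. of_nat (c x))"
    unfolding num_points_def using assms by (subst nn_integral_count_space) (auto simp: eq)
  also have "\<dots> = (\<Sum>x\<in>{x\<in>B. c x \<noteq> 0}. ennreal (real (c x)))" by (simp add: ennreal_of_nat_eq_real_of_nat)
  also have "\<dots> = ennreal (\<Sum>x\<in>{x\<in>B. c x \<noteq> 0}. real (c x))" by (rule sum_ennreal) simp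
  finally show ?thesis .
qed

lemma num_points_finite_iff: "num_points c B \<noteq> \<infinity> \<longleftrightarrow> finite {x\<in>B. c x \<noteq> 0}"
proof
  assume fin: "num_points c B \<noteq> \<infinity>"
  show "finite {x\<in>B. c x \<noteq> 0}"
  proof (rule ccontr)
    assume inf: "infinite {x\<in>B. c x \<noteq> 0}"
    have "\<infinity> = (\<integral>\<^sup>+x. indicator {x\<in>B. c x \<noteq> 0} x \<partial>count_space B)"
      using inf by (subst nn_integral_indicator) (auto simp: emeasure_count_space_infinite)
    also have "\<dots> \<le> num_points c B" unfolding num_points_def
    proof (rule nn_integral_mono)
      fix x
      have "(1::ennreal) \<le> of_nat (c x)" if "c x \<noteq> 0" using that
        by (metis One_nat_def Suc_leI neq0_conv of_nat_1 of_nat_mono)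
      then show "indicator {x\<in>B. c x \<noteq> 0} x \<le> (of_nat (c x) :: ennreal)" by (auto simp: indicator_def)
    qed
    finally show False using fin by (simp add: top_unique)
  qed
next
  assume "finite {x\<in>B. c x \<noteq> 0}"
  then show "num_points c B \<noteq> \<infinity>" by (simp add: num_points_finite)
qed

text \<open>The number of points as a natural number, usable as an exponent. Since
  \<open>enn2real\<close> sends infinity to 0, it is 0 when there are infinitely many
  points.\<close>

definition count :: "('a \<Rightarrow> nat) \<Rightarrow> 'a set \<Rightarrow> nat" where
  "count c B = nat \<lfloor>enn2real (num_points c B)\<rfloor>"

lemma count_eq: "finite {x\<in>B. c x \<noteq> 0} \<Longrightarrow> count c B = (\<Sum>x\<in>{x\<in>B. c x \<noteq> 0}. c x)"
  by (simp add: count_def num_points_finite sum_nonneg flip: of_nat_sum)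

text \<open>Points with h x = 0 would contribute a factor 1. Leaving them out makes the product
  depend only on the configuration in the support of h, even when the rest is infinite. If
  infinitely many points remain, the value is 1 by the convention for \<open>prod\<close>.\<close>

definition point_prod :: "('a \<Rightarrow> nat) \<Rightarrow> ('a \<Rightarrow> real) \<Rightarrow> real" where
  "point_prod c h = (\<Prod>x\<in>{x. c x \<noteq> 0 \<and> h x \<noteq> 0}. (1 + h x) ^ c x)"

lemma point_prod_eq:
  assumes "finite S" "{x. c x \<noteq> 0 \<and> h x \<noteq> 0} \<subseteq> S"
  shows "point_prod c h = (\<Prod>x\<in>S. (1 + h x) ^ c x)"
  unfolding point_prod_def
proof (rule prod.mono_neutral_left[OF assms], rule ballI)
  fix i assume "i \<in> S - {x. c x \<noteq> 0 \<and> h x \<noteq> 0}"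
  then have "c i = 0 \<or> h i = 0" by blast
  then show "(1 + h i) ^ c i = 1" by auto
qed

text \<open>Points are grouped by the value of \<open>s\<close>, which expresses the product through
  counts on level sets; measurability and distribution of the process are given in terms of such
  counts.\<close>

lemma point_prod_simple:
  assumes s: "simple_function M s" and B: "finite {x\<in>B. c x \<noteq> 0}" "B \<subseteq> space M"
    and z: "{x. c x \<noteq> 0 \<and> s x \<noteq> 0} \<subseteq> B"
  shows "point_prod c s = (\<Prod>a\<in>s ` space M. (1 + a) ^ count c (B \<inter> s -` {a}))"
proof -
  let ?S = "{x\<in>B. c x \<noteq> 0}"
  have "point_prod c s = (\<Prod>x\<in>?S. (1 + s x) ^ c x)" using B z by (intro point_prod_eq) auto
  also have "\<dots> = (\<Prod>a\<in>s ` space M. \<Prod>x\<in>{x\<in>?S. s x = a}. (1 + s x) ^ c x)"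
    using simple_functionD(1)[OF s] B by (intro prod.group[symmetric]) auto
  also have "\<dots> = (\<Prod>a\<in>s ` space M. (1 + a) ^ count c (B \<inter> s -` {a}))"
  proof (rule prod.cong[OF refl])
    fix a
    have eq: "{x\<in>B \<inter> s -` {a}. c x \<noteq> 0} = {x\<in>?S. s x = a}" by auto
    have "(\<Prod>x\<in>{x\<in>?S. s x = a}. (1 + s x) ^ c x) = (\<Prod>x\<in>{x\<in>?S. s x = a}. (1 + a) ^ c x)"
      by (rule prod.cong) auto
    also have "\<dots> = (1 + a) ^ (\<Sum>x\<in>{x\<in>?S. s x = a}. c x)" by (simp add: power_sum)
    also have "(\<Sum>x\<in>{x\<in>?S. s x = a}. c x) = count c (B \<inter> s -` {a})"
    proof -
      have "finite {x\<in>B \<inter> s -` {a}. c x \<noteq> 0}" by (rule rev_finite_subset[OF B(1)]) blast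
      from count_eq[OF this] show ?thesis unfolding eq by (rule sym)
    qed
    finally show "(\<Prod>x\<in>{x\<in>?S. s x = a}. (1 + s x) ^ c x) = (1 + a) ^ count c (B \<inter> s -` {a})" .
  qed
  finally show ?thesis .
qed

lemma point_prod_tendsto:
  assumes fin: "finite {x. c x \<noteq> 0 \<and> h x \<noteq> 0}"
    and lim: "\<And>x. c x \<noteq> 0 \<Longrightarrow> (\<lambda>n. s n x) \<longlonglongrightarrow> h x"
    and z: "\<And>n x. c x \<noteq> 0 \<Longrightarrow> h x = 0 \<Longrightarrow> s n x = 0"
  shows "(\<lambda>n. point_prod c (s n)) \<longlonglongrightarrow> point_prod c h"
proof -
  have "point_prod c (s n) = (\<Prod>x\<in>{x. c x \<noteq> 0 \<and> h x \<noteq> 0}. (1 + s n x) ^ c x)" for n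
    by (rule point_prod_eq[OF fin]) (use z in auto)
  then show ?thesis unfolding point_prod_def[of c h] using lim by (auto intro!: tendsto_intros)
qed

lemma point_prod_finite:
  "finite {x. c x \<noteq> 0} \<Longrightarrow> point_prod c h = (\<Prod>x\<in>{x. c x \<noteq> 0}. (1 + h x) ^ c x)"
  by (rule point_prod_eq) auto

lemma abs_point_prod_le:
  assumes fin: "finite {x. c x \<noteq> 0}" and le: "\<And>x. c x \<noteq> 0 \<Longrightarrow> \<bar>h x\<bar> \<le> g x"
  shows "\<bar>point_prod c h\<bar> \<le> point_prod c g"
  unfolding point_prod_finite[OF fin] abs_prod power_abs
proof (rule prod_mono)
  fix i assume "i \<in> {x. c x \<noteq> 0}"
  then have "\<bar>1 + h i\<bar> \<le> 1 + g i" using le[of i] by auto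
  then show "0 \<le> \<bar>1 + h i\<bar> ^ c i \<and> \<bar>1 + h i\<bar> ^ c i \<le> (1 + g i) ^ c i" by (simp add: power_mono)
qed

lemma point_prod_mult:
  assumes fin: "finite {x. c x \<noteq> 0}"
    and eq: "\<And>x. c x \<noteq> 0 \<Longrightarrow> 1 + g x = (1 + h x) * (1 + k x)"
  shows "point_prod c g = point_prod c h * point_prod c k"
  unfolding point_prod_finite[OF fin] prod.distrib[symmetric]
  by (rule prod.cong[OF refl]) (use eq in \<open>simp add: power_mult_distrib\<close>)

section \<open>Fields and expectations of the Poisson process\<close>

locale poisson_noise =
  fixes M :: "'a measure" and Q :: "'t measure" and N :: "'t \<Rightarrow> 'a \<Rightarrow> nat"
  assumes finM: "finite_measure M" and N: "poisson_process M Q N"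
begin

lemma probQ: "prob_space Q"
  and conf: "\<omega> \<in> space Q \<Longrightarrow> N \<omega> \<in> configurations M"
  and np_meas: "A \<in> sets M \<Longrightarrow> (\<lambda>\<omega>. num_points (N \<omega>) A) \<in> borel_measurable Q"
  and np_distr: "A \<in> sets M \<Longrightarrow> measure Q {\<omega>\<in>space Q. num_points (N \<omega>) A = of_nat k} =
           measure M A ^ k / fact k * exp (- measure M A)"
  using N unfolding poisson_process_def by blast+

lemma np_indep: "\<lbrakk>\<forall>i<n::nat. A i \<in> sets M; disjoint_family_on A {..<n}\<rbrakk> \<Longrightarrow>
    prob_space.indep_vars Q (\<lambda>_. borel) (\<lambda>i \<omega>. num_points (N \<omega>) (A i)) {..<n}"
  using N unfolding poisson_process_def by blast

abbreviation "gens A \<equiv> {(\<lambda>\<omega>. num_points (N \<omega>) B) -` C \<inter> space Q | B C.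
  B \<in> sets M \<and> B \<subseteq> A \<and> C \<in> sets borel}"

lemma gens_sub: "gens A \<subseteq> sets Q"
  using np_meas by (auto intro: measurable_sets)

lemma sets_field: "sets (poisson_field M Q N A) = sigma_sets (space Q) (gens A)"
  and space_field: "space (poisson_field M Q N A) = space Q"
  using gens_sub[of A, THEN order_trans, OF sets.space_closed]
  by (simp_all add: poisson_field_def sets_measure_of space_measure_of)

lemma subalg: "subalgebra Q (poisson_field M Q N A)"
  unfolding subalgebra_def using space_field sets_field sets.sigma_sets_subset[OF gens_sub] by simp

lemma np_meas_field:
  assumes "B \<in> sets M" "B \<subseteq> A"
  shows "(\<lambda>\<omega>. num_points (N \<omega>) B) \<in> borel_measurable (poisson_field M Q N A)"
proof (rule measurableI)
  fix C :: "ennreal set" assume "C \<in> sets borel"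
  then show "(\<lambda>\<omega>. num_points (N \<omega>) B) -` C \<inter> space (poisson_field M Q N A) \<in> sets (poisson_field M Q N A)"
    unfolding space_field sets_field using assms by (intro sigma_sets.Basic) blast
qed simp

lemma count_meas_field:
  assumes "B \<in> sets M" "B \<subseteq> A"
  shows "(\<lambda>\<omega>. count (N \<omega>) B) \<in> measurable (poisson_field M Q N A) (count_space UNIV)"
proof -
  note [measurable] = np_meas_field[OF assms]
  have "(\<lambda>t::real. nat \<lfloor>t\<rfloor>) \<in> measurable borel (count_space UNIV)" by measurable
  then show ?thesis unfolding count_def by measurable
qed

lemma supp_sub: "\<omega> \<in> space Q \<Longrightarrow> N \<omega> x \<noteq> 0 \<Longrightarrow> x \<in> space M"
  using conf by (auto simp: configurations_def)

text \<open>With m = \<nu>(X) finite, the probabilities of the finite values of the total number of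
  points sum to e^m e^{-m} = 1.\<close>

lemma AE_finite: "AE \<omega> in Q. finite {x. N \<omega> x \<noteq> 0}"
proof -
  interpret prob_space Q by (rule probQ)
  let ?m = "measure M (space M)"
  define S where "S k = {\<omega>\<in>space Q. num_points (N \<omega>) (space M) = of_nat k}" for k
  have [measurable]: "S k \<in> sets Q" for k
    unfolding S_def using np_meas[OF sets.top] by measurable
  have "disjoint_family S" by (auto simp: disjoint_family_on_def S_def)
  then have "(\<lambda>k. prob (S k)) sums prob (\<Union>k. S k)" by (intro finite_measure_UNION) auto
  moreover have "(\<lambda>k. ?m ^ k /\<^sub>R fact k * exp (- ?m)) sums (exp ?m * exp (- ?m))"
    by (intro sums_mult2 exp_converges)
  then have "(\<lambda>k. prob (S k)) sums 1"
    by (simp add: S_def np_distr[OF sets.top] scaleR_conv_of_real field_simps flip: exp_add)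
  ultimately have "prob (\<Union>k. S k) = 1" by (rule sums_unique2)
  then have "AE \<omega> in Q. \<omega> \<in> (\<Union>k. S k)" by (rule AE_prob_1)
  then show ?thesis
  proof (rule AE_mp, intro AE_I2 impI)
    fix \<omega> assume \<omega>: "\<omega> \<in> space Q" "\<omega> \<in> (\<Union>k. S k)"
    then have "num_points (N \<omega>) (space M) \<noteq> \<infinity>" by (auto simp: S_def)
    then have "finite {x\<in>space M. N \<omega> x \<noteq> 0}" by (simp only: num_points_finite_iff)
    moreover have "{x\<in>space M. N \<omega> x \<noteq> 0} = {x. N \<omega> x \<noteq> 0}" using supp_sub \<omega>(1) by auto
    ultimately show "finite {x. N \<omega> x \<noteq> 0}" by simp
  qed
qed

text \<open>The approximating simple functions vanish wherever h does, so their products only use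
  counts inside the support of h, a subset of A up to points that no configuration contains.\<close>

lemma point_prod_meas:
  assumes A: "A \<in> sets M" and h: "h \<in> borel_measurable M" "\<forall>x\<in>space M - A. h x = 0"
  shows "(\<lambda>\<omega>. point_prod (N \<omega>) h) \<in> borel_measurable (poisson_field M Q N A)"
proof -
  note [measurable] = h(1)
  define S where "S = {x\<in>space M. h x \<noteq> 0}"
  have S: "S \<in> sets M" "S \<subseteq> A" using h(2) by (auto simp: S_def)
  obtain s where s: "\<And>n. simple_function M (s n)" and lim: "\<And>x. x \<in> space M \<Longrightarrow> (\<lambda>n. s n x) \<longlonglongrightarrow> h x"
    and b: "\<And>n x. x \<in> space M \<Longrightarrow> dist (s n x) 0 \<le> 2 * dist (h x) 0"
    using borel_measurable_implies_sequence_metric[of h M 0] by (metis (no_types) \<open>h \<in> borel_measurable M\<close>)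
  have sz: "s n x = 0" if "x \<in> space M" "h x = 0" for n x using b[OF that(1), of n] that(2) by simp
  let ?F = "poisson_field M Q N A"
  have fin_iff: "num_points (N \<omega>) S \<noteq> \<infinity> \<longleftrightarrow> finite {x. N \<omega> x \<noteq> 0 \<and> h x \<noteq> 0}" if "\<omega> \<in> space Q" for \<omega>
  proof -
    have "{x\<in>S. N \<omega> x \<noteq> 0} = {x. N \<omega> x \<noteq> 0 \<and> h x \<noteq> 0}" using supp_sub[OF that] by (auto simp: S_def)
    then show ?thesis by (simp only: num_points_finite_iff)
  qed
  \<comment> \<open>The field need not contain all null sets, so convergence has to hold at every
    \<omega>; the value 1 matches that of \<open>point_prod\<close> when infinitely many points lie
    in S.\<close>
  define g where "g n \<omega> = (if num_points (N \<omega>) S = \<infinity> then 1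
      else (\<Prod>a\<in>s n ` space M. (1 + a) ^ count (N \<omega>) (S \<inter> s n -` {a})))" for n \<omega>
  have "g n \<in> borel_measurable ?F" for n
  proof -
    have "S \<inter> s n -` {a} \<in> sets M" for a
    proof -
      have "s n -` {a} \<inter> space M \<in> sets M" by (rule simple_functionD(2)[OF s])
      moreover have "S \<inter> s n -` {a} = S \<inter> (s n -` {a} \<inter> space M)" by (auto simp: S_def)
      ultimately show ?thesis using S(1) by simp
    qed
    then have "(\<lambda>\<omega>. (1 + a) ^ count (N \<omega>) (S \<inter> s n -` {a})) \<in> borel_measurable ?F" for a
      using S(2) by (intro measurable_compose[OF count_meas_field]) auto
    moreover note np_meas_field[OF S]
    ultimately show ?thesis unfolding g_def by measurable
  qed
  moreover have "(\<lambda>n. g n \<omega>) \<longlonglongrightarrow> point_prod (N \<omega>) h" if "\<omega> \<in> space ?F" for \<omega>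
  proof -
    have \<omega>: "\<omega> \<in> space Q" using that by (simp add: space_field)
    show ?thesis
    proof (cases "num_points (N \<omega>) S = \<infinity>")
      case True
      then have "infinite {x. N \<omega> x \<noteq> 0 \<and> h x \<noteq> 0}" using fin_iff[OF \<omega>] by blast
      then show ?thesis using True by (simp add: g_def point_prod_def)
    next
      case False
      then have fin: "finite {x. N \<omega> x \<noteq> 0 \<and> h x \<noteq> 0}" using fin_iff[OF \<omega>] by blast
      have "g n \<omega> = point_prod (N \<omega>) (s n)" for n
      proof -
        have "finite {x\<in>S. N \<omega> x \<noteq> 0}" using False by (simp only: num_points_finite_iff)
        moreover have "{x. N \<omega> x \<noteq> 0 \<and> s n x \<noteq> 0} \<subseteq> S" using supp_sub[OF \<omega>] sz by (auto simp: S_def)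
        ultimately have "point_prod (N \<omega>) (s n) = (\<Prod>a\<in>s n ` space M. (1 + a) ^ count (N \<omega>) (S \<inter> s n -` {a}))"
          by (intro point_prod_simple[OF s]) (auto simp: S_def)
        then show ?thesis using False by (simp add: g_def)
      qed
      moreover have "(\<lambda>n. point_prod (N \<omega>) (s n)) \<longlonglongrightarrow> point_prod (N \<omega>) h"
        by (rule point_prod_tendsto[OF fin]) (use lim sz supp_sub[OF \<omega>] in auto)
      ultimately show ?thesis by simp
    qed
  qed
  ultimately show ?thesis by (rule borel_measurable_LIMSEQ_real[rotated])
qed

lemma point_prod_meas_Q: "h \<in> borel_measurable M \<Longrightarrow> (\<lambda>\<omega>. point_prod (N \<omega>) h) \<in> borel_measurable Q"
  using point_prod_meas[of "space M" h] measurable_from_subalg[OF subalg] by blast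

lemma count_distr:
  assumes A: "A \<in> sets M"
  shows "measure Q {\<omega>\<in>space Q. count (N \<omega>) A = k} = measure M A ^ k / fact k * exp (- measure M A)"
proof -
  have [measurable]: "(\<lambda>\<omega>. count (N \<omega>) A) \<in> measurable Q (count_space UNIV)"
    using count_meas_field[OF A order_refl] measurable_from_subalg[OF subalg] by blast
  note [measurable] = np_meas[OF A]
  have "measure Q {\<omega>\<in>space Q. count (N \<omega>) A = k} = measure Q {\<omega>\<in>space Q. num_points (N \<omega>) A = of_nat k}"
  proof (rule measure_eq_AE)
    show "AE \<omega> in Q. (\<omega> \<in> {\<omega>\<in>space Q. count (N \<omega>) A = k}) = (\<omega> \<in> {\<omega>\<in>space Q. num_points (N \<omega>) A = of_nat k})"
      using AE_finite
    proof (rule AE_mp, intro AE_I2 impI)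
      fix \<omega> assume fin: "finite {x. N \<omega> x \<noteq> 0}"
      then have f: "finite {x\<in>A. N \<omega> x \<noteq> 0}" by (rule rev_finite_subset) auto
      have "num_points (N \<omega>) A = of_nat (count (N \<omega>) A)"
        by (simp add: num_points_finite[OF f] count_eq[OF f] ennreal_of_nat_eq_real_of_nat)
      then show "(\<omega> \<in> {\<omega>\<in>space Q. count (N \<omega>) A = k}) = (\<omega> \<in> {\<omega>\<in>space Q. num_points (N \<omega>) A = of_nat k})" by simp
    qed
  qed measurable
  then show ?thesis by (simp add: np_distr[OF A])
qed

text \<open>r may be negative or larger than 1. Sum and integral are exchanged by absolute
  convergence, which is the same computation with |r| in place of r.\<close>

lemma count_pgf:
  assumes A: "A \<in> sets M"
  shows "integrable Q (\<lambda>\<omega>. r ^ count (N \<omega>) A)" "(\<integral>\<omega>. r ^ count (N \<omega>) A \<partial>Q) = exp ((r - 1) * measure M A)"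
proof -
  interpret prob_space Q by (rule probQ)
  have [measurable]: "(\<lambda>\<omega>. count (N \<omega>) A) \<in> measurable Q (count_space UNIV)"
    using count_meas_field[OF A order_refl] measurable_from_subalg[OF subalg] by blast
  define S where "S k = {\<omega>\<in>space Q. count (N \<omega>) A = k}" for k
  have [measurable]: "S k \<in> sets Q" for k unfolding S_def by measurable
  let ?f = "\<lambda>k \<omega>. r ^ k * indicator (S k) \<omega>"
  have sumr: "(\<lambda>k. r ^ k * prob (S k)) sums exp ((r - 1) * measure M A)" for r :: real
  proof -
    have "(\<lambda>k. (r * measure M A) ^ k /\<^sub>R fact k * exp (- measure M A)) sums (exp (r * measure M A) * exp (- measure M A))"
      by (intro sums_mult2 exp_converges)
    then show ?thesis
      by (simp add: S_def count_distr[OF A] power_mult_distrib field_simps flip: exp_add)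
  qed
  have single: "(\<lambda>k. t ^ k * indicator (S k) \<omega>) sums (t ^ count (N \<omega>) A)" if "\<omega> \<in> space Q" for \<omega> and t :: real
  proof -
    have "(\<lambda>k. t ^ k * indicator (S k) \<omega>) = (\<lambda>k. if k = count (N \<omega>) A then t ^ k else 0)"
      using that by (intro ext) (auto simp: S_def indicator_def)
    then show ?thesis using sums_single[of "count (N \<omega>) A" "\<lambda>k. t ^ k"] by simp
  qed
  have i: "integrable Q (?f k)" for k by (intro integrable_mult_right integrable_real_indicator) (auto simp: emeasure_eq_measure)
  have s1: "AE \<omega> in Q. summable (\<lambda>k. norm (?f k \<omega>))"
  proof (rule AE_I2)
    fix \<omega> assume "\<omega> \<in> space Q"
    from sums_summable[OF single[OF this, of "\<bar>r\<bar>"]] show "summable (\<lambda>k. norm (?f k \<omega>))"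
      by (simp add: abs_mult power_abs)
  qed
  have s2: "summable (\<lambda>k. \<integral>\<omega>. norm (?f k \<omega>) \<partial>Q)"
    using sums_summable[OF sumr[of "\<bar>r\<bar>"]] by (simp add: abs_mult power_abs)
  have eq: "(\<Sum>k. ?f k \<omega>) = r ^ count (N \<omega>) A" if "\<omega> \<in> space Q" for \<omega> using single[OF that, of r] by (simp add: sums_iff)
  have "integrable Q (\<lambda>\<omega>. \<Sum>k. ?f k \<omega>)" by (rule integrable_suminf[OF i s1 s2])
  then show "integrable Q (\<lambda>\<omega>. r ^ count (N \<omega>) A)"
    by (rule Bochner_Integration.integrable_cong[THEN iffD1, rotated -1]) (auto simp: eq)
  have "(\<integral>\<omega>. r ^ count (N \<omega>) A \<partial>Q) = (\<integral>\<omega>. (\<Sum>k. ?f k \<omega>) \<partial>Q)"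
    by (rule Bochner_Integration.integral_cong) (auto simp: eq)
  also have "\<dots> = (\<Sum>k. \<integral>\<omega>. ?f k \<omega> \<partial>Q)" by (rule integral_suminf[OF i s1 s2])
  also have "\<dots> = (\<Sum>k. r ^ k * prob (S k))" by simp
  also have "\<dots> = exp ((r - 1) * measure M A)" using sumr by (simp add: sums_iff)
  finally show "(\<integral>\<omega>. r ^ count (N \<omega>) A \<partial>Q) = exp ((r - 1) * measure M A)" .
qed

text \<open>Counts on the level sets of s are independent Poisson variables, so the expectation is
  the product of the factors exp(a \<nu>(s = a)). The values are enumerated by \<open>f\<close>
  because independence is given for families indexed by initial segments of the naturals.\<close>

lemma point_prod_simple_integral:
  assumes s: "simple_function M s"
  shows "integrable Q (\<lambda>\<omega>. point_prod (N \<omega>) s)" "(\<integral>\<omega>. point_prod (N \<omega>) s \<partial>Q) = exp (\<integral>x. s x \<partial>M)"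
proof -
  interpret M: finite_measure M by (rule finM)
  interpret prob_space Q by (rule probQ)
  note [measurable] = borel_measurable_simple_function[OF s]
  have fin: "finite (s ` space M)" by (rule simple_functionD(1)[OF s])
  obtain f where f: "bij_betw f {..<card (s ` space M)} (s ` space M)"
    using ex_bij_betw_nat_finite[OF fin] by (auto simp: atLeast0LessThan)
  let ?n = "card (s ` space M)"
  define A where "A i = space M \<inter> s -` {f i}" for i
  have A: "A i \<in> sets M" for i
    using simple_functionD(2)[OF s, of "{f i}"] by (simp add: A_def Int_commute)
  have "disjoint_family_on A {..<?n}"
    using f by (auto simp: disjoint_family_on_def A_def bij_betw_def inj_on_def)
  then have "indep_vars (\<lambda>_. borel) (\<lambda>i \<omega>. num_points (N \<omega>) (A i)) {..<?n}" using A by (intro np_indep) auto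
  then have ind: "indep_vars (\<lambda>_. borel) (\<lambda>i \<omega>. (1 + f i) ^ nat \<lfloor>enn2real (num_points (N \<omega>) (A i))\<rfloor>) {..<?n}"
  proof (rule indep_vars_compose2)
    show "(\<lambda>t. (1 + f i) ^ nat \<lfloor>enn2real t\<rfloor>) \<in> borel_measurable borel" for i
    proof -
      have "(\<lambda>t::real. nat \<lfloor>t\<rfloor>) \<in> measurable borel (count_space UNIV)" by measurable
      then have "(\<lambda>t. nat \<lfloor>enn2real t\<rfloor>) \<in> measurable borel (count_space UNIV)" by measurable
      then show ?thesis by (rule measurable_compose) simp
    qed
  qed
  note cp = count_pgf[OF A, unfolded count_def]
  have "integrable Q (\<lambda>\<omega>. \<Prod>i\<in>{..<?n}. (1 + f i) ^ nat \<lfloor>enn2real (num_points (N \<omega>) (A i))\<rfloor>)"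
    by (rule indep_vars_integrable[OF _ ind cp(1)]) simp
  then have int: "integrable Q (\<lambda>\<omega>. \<Prod>i<?n. (1 + f i) ^ count (N \<omega>) (A i))" by (simp add: count_def)
  have "(\<integral>\<omega>. (\<Prod>i\<in>{..<?n}. (1 + f i) ^ nat \<lfloor>enn2real (num_points (N \<omega>) (A i))\<rfloor>) \<partial>Q)
      = (\<Prod>i<?n. \<integral>\<omega>. (1 + f i) ^ nat \<lfloor>enn2real (num_points (N \<omega>) (A i))\<rfloor> \<partial>Q)"
    by (rule indep_vars_lebesgue_integral[OF _ ind cp(1)]) simp
  also have "\<dots> = (\<Prod>i<?n. exp (f i * measure M (A i)))" by (simp add: cp(2))
  also have "\<dots> = exp (\<Sum>i<?n. f i * measure M (A i))" by (simp add: exp_sum)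
  also have "(\<Sum>i<?n. f i * measure M (A i)) = (\<Sum>a\<in>s ` space M. a * measure M (space M \<inter> s -` {a}))"
    unfolding A_def by (rule sum.reindex_bij_betw[OF f])
  also have "\<dots> = (\<integral>x. s x \<partial>M)"
  proof -
    have sb: "Bochner_Integration.simple_bochner_integrable M s"
      using s M.emeasure_finite by (auto simp: simple_bochner_integrable.simps)
    have "(\<integral>x. s x \<partial>M) = Bochner_Integration.simple_bochner_integral M s"
      using has_bochner_integral_simple_bochner_integrable[OF sb] by (rule has_bochner_integral_integral_eq)
    also have "\<dots> = (\<Sum>a\<in>s ` space M. a * measure M (space M \<inter> s -` {a}))"
      unfolding simple_bochner_integral_def
      by (rule sum.cong) (auto simp: Int_def vimage_def mult.commute)
    finally show ?thesis by simp
  qed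
  finally have val: "(\<integral>\<omega>. (\<Prod>i<?n. (1 + f i) ^ count (N \<omega>) (A i)) \<partial>Q) = exp (\<integral>x. s x \<partial>M)" by (simp add: count_def)
  have eq: "AE \<omega> in Q. (\<Prod>i<?n. (1 + f i) ^ count (N \<omega>) (A i)) = point_prod (N \<omega>) s"
    using AE_finite
  proof (rule AE_mp, intro AE_I2 impI)
    fix \<omega> assume \<omega>: "\<omega> \<in> space Q" "finite {x. N \<omega> x \<noteq> 0}"
    have "finite {x\<in>space M. N \<omega> x \<noteq> 0}" by (rule rev_finite_subset[OF \<omega>(2)]) auto
    then have "point_prod (N \<omega>) s = (\<Prod>a\<in>s ` space M. (1 + a) ^ count (N \<omega>) (space M \<inter> s -` {a}))"
      using supp_sub[OF \<omega>(1)] by (intro point_prod_simple[OF s]) auto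
    also have "\<dots> = (\<Prod>i<?n. (1 + f i) ^ count (N \<omega>) (A i))"
      unfolding A_def by (rule prod.reindex_bij_betw[OF f, symmetric])
    finally show "(\<Prod>i<?n. (1 + f i) ^ count (N \<omega>) (A i)) = point_prod (N \<omega>) s" by simp
  qed
  have m: "(\<lambda>\<omega>. point_prod (N \<omega>) s) \<in> borel_measurable Q" by (rule point_prod_meas_Q) measurable
  show "integrable Q (\<lambda>\<omega>. point_prod (N \<omega>) s)" by (rule integrable_cong_AE_imp[OF int m eq])
  show "(\<integral>\<omega>. point_prod (N \<omega>) s \<partial>Q) = exp (\<integral>x. s x \<partial>M)"
    unfolding val[symmetric] by (rule integral_cong_AE[OF m borel_measurable_integrable[OF int]]) (use eq in auto)
qed

lemma simple_approx:
  assumes h: "integrable M (h :: 'a \<Rightarrow> real)"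
  obtains s where "\<And>n::nat. simple_function M (s n)" "\<And>x. x \<in> space M \<Longrightarrow> (\<lambda>n. s n x) \<longlonglongrightarrow> h x"
    "\<And>n x. x \<in> space M \<Longrightarrow> \<bar>s n x\<bar> \<le> 2 * \<bar>h x\<bar>" "\<And>n. integrable M (s n)"
proof -
  note [measurable] = borel_measurable_integrable[OF h]
  obtain s where s: "\<And>n. simple_function M (s n)" and lim: "\<And>x. x \<in> space M \<Longrightarrow> (\<lambda>n. s n x) \<longlonglongrightarrow> h x"
    and b: "\<And>n x. x \<in> space M \<Longrightarrow> dist (s n x) 0 \<le> 2 * dist (h x) 0"
    using borel_measurable_implies_sequence_metric[of h M 0] by (metis (no_types) \<open>h \<in> borel_measurable M\<close>)
  have b': "\<bar>s n x\<bar> \<le> 2 * \<bar>h x\<bar>" if "x \<in> space M" for n x using b[OF that] by simp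
  have i: "integrable M (\<lambda>x. 2 * \<bar>h x\<bar>)" using h by simp
  have "integrable M (s n)" for n
    by (rule Bochner_Integration.integrable_bound[OF i borel_measurable_simple_function[OF s]]) (use b' in auto)
  with s lim b' show ?thesis by (rule that)
qed

text \<open>Proved by Fatou, since no dominating function exists yet; the result is what later
  supplies one. The approximants satisfy |s n| \<le> 2 |h|, so their expectations stay below exp(2
  \<integral> |h|).\<close>

lemma point_prod_abs_integrable:
  assumes h: "integrable M (h :: 'a \<Rightarrow> real)"
  shows "integrable Q (\<lambda>\<omega>. point_prod (N \<omega>) (\<lambda>x. \<bar>h x\<bar>))"
proof (rule integrableI_bounded)
  note [measurable] = borel_measurable_integrable[OF h]
  show m: "(\<lambda>\<omega>. point_prod (N \<omega>) (\<lambda>x. \<bar>h x\<bar>)) \<in> borel_measurable Q" by (rule point_prod_meas_Q) measurable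
  have pos: "0 \<le> point_prod c g" if "\<And>x. 0 \<le> g x" for c and g :: "'a \<Rightarrow> real"
    unfolding point_prod_def by (rule prod_nonneg) (use that in \<open>auto simp: add_nonneg_nonneg\<close>)
  obtain s where s: "\<And>n::nat. simple_function M (s n)" "\<And>x. x \<in> space M \<Longrightarrow> (\<lambda>n. s n x) \<longlonglongrightarrow> h x"
    "\<And>n x. x \<in> space M \<Longrightarrow> \<bar>s n x\<bar> \<le> 2 * \<bar>h x\<bar>" "\<And>n. integrable M (s n)"
    by (rule simple_approx[OF h]) blast
  have sa: "simple_function M (\<lambda>x. \<bar>s n x\<bar>)" for n using s(1) by (rule simple_function_compose1)
  have [measurable]: "(\<lambda>\<omega>. point_prod (N \<omega>) (\<lambda>x. \<bar>s n x\<bar>)) \<in> borel_measurable Q" for n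
    using point_prod_simple_integral(1)[OF sa] by (rule borel_measurable_integrable)
  have "(\<integral>\<^sup>+\<omega>. ennreal (norm (point_prod (N \<omega>) (\<lambda>x. \<bar>h x\<bar>))) \<partial>Q)
      = (\<integral>\<^sup>+\<omega>. liminf (\<lambda>n. ennreal (point_prod (N \<omega>) (\<lambda>x. \<bar>s n x\<bar>))) \<partial>Q)"
  proof (rule nn_integral_cong_AE, rule AE_mp[OF AE_finite], intro AE_I2 impI)
    fix \<omega> assume \<omega>: "\<omega> \<in> space Q" "finite {x. N \<omega> x \<noteq> 0}"
    have "(\<lambda>n. point_prod (N \<omega>) (\<lambda>x. \<bar>s n x\<bar>)) \<longlonglongrightarrow> point_prod (N \<omega>) (\<lambda>x. \<bar>h x\<bar>)"
    proof (rule point_prod_tendsto)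
      show "finite {x. N \<omega> x \<noteq> 0 \<and> \<bar>h x\<bar> \<noteq> 0}" by (rule rev_finite_subset[OF \<omega>(2)]) auto
      show "(\<lambda>n. \<bar>s n x\<bar>) \<longlonglongrightarrow> \<bar>h x\<bar>" if "N \<omega> x \<noteq> 0" for x
        using s(2)[OF supp_sub[OF \<omega>(1) that]] by (rule tendsto_rabs)
      show "\<bar>s n x\<bar> = 0" if "N \<omega> x \<noteq> 0" "\<bar>h x\<bar> = 0" for n x
        using s(3)[OF supp_sub[OF \<omega>(1) that(1)], of n] that(2) by simp
    qed
    then have "(\<lambda>n. ennreal (point_prod (N \<omega>) (\<lambda>x. \<bar>s n x\<bar>))) \<longlonglongrightarrow> ennreal (point_prod (N \<omega>) (\<lambda>x. \<bar>h x\<bar>))"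
      by (rule tendsto_ennrealI)
    from lim_imp_Liminf[OF _ this]
    show "ennreal (norm (point_prod (N \<omega>) (\<lambda>x. \<bar>h x\<bar>))) = liminf (\<lambda>n. ennreal (point_prod (N \<omega>) (\<lambda>x. \<bar>s n x\<bar>)))"
      by (simp add: pos)
  qed
  also have "\<dots> \<le> liminf (\<lambda>n. \<integral>\<^sup>+\<omega>. ennreal (point_prod (N \<omega>) (\<lambda>x. \<bar>s n x\<bar>)) \<partial>Q)"
    by (rule nn_integral_liminf) measurable
  also have "\<dots> \<le> liminf (\<lambda>n::nat. ennreal (exp (\<integral>x. 2 * \<bar>h x\<bar> \<partial>M)))"
  proof (rule Liminf_mono, rule always_eventually, rule allI)
    fix n
    have "(\<integral>\<^sup>+\<omega>. ennreal (point_prod (N \<omega>) (\<lambda>x. \<bar>s n x\<bar>)) \<partial>Q) = ennreal (exp (\<integral>x. \<bar>s n x\<bar> \<partial>M))"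
      by (subst nn_integral_eq_integral[OF point_prod_simple_integral(1)[OF sa]])
        (simp_all add: pos point_prod_simple_integral(2)[OF sa])
    also have "(\<integral>x. \<bar>s n x\<bar> \<partial>M) \<le> (\<integral>x. 2 * \<bar>h x\<bar> \<partial>M)"
      by (rule integral_mono) (use s(3,4) h in auto)
    then have "ennreal (exp (\<integral>x. \<bar>s n x\<bar> \<partial>M)) \<le> ennreal (exp (\<integral>x. 2 * \<bar>h x\<bar> \<partial>M))"
      by (intro ennreal_leI) (simp only: exp_le_cancel_iff)
    finally show "(\<integral>\<^sup>+\<omega>. ennreal (point_prod (N \<omega>) (\<lambda>x. \<bar>s n x\<bar>)) \<partial>Q) \<le> ennreal (exp (\<integral>x. 2 * \<bar>h x\<bar> \<partial>M))" .
  qed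
  also have "\<dots> < \<infinity>" by (simp add: Liminf_const)
  finally show "(\<integral>\<^sup>+\<omega>. ennreal (norm (point_prod (N \<omega>) (\<lambda>x. \<bar>h x\<bar>))) \<partial>Q) < \<infinity>" .
qed

text \<open>Campbell's formula for the expectation of the product of 1 + h over the points.
  Dominated convergence from simple functions, with the product of 1 + |2 h| as dominating
  function.\<close>

lemma point_prod_integral:
  assumes h: "integrable M (h :: 'a \<Rightarrow> real)"
  shows "integrable Q (\<lambda>\<omega>. point_prod (N \<omega>) h)" "(\<integral>\<omega>. point_prod (N \<omega>) h \<partial>Q) = exp (\<integral>x. h x \<partial>M)"
proof -
  note [measurable] = borel_measurable_integrable[OF h]
  obtain s where s: "\<And>n::nat. simple_function M (s n)" "\<And>x. x \<in> space M \<Longrightarrow> (\<lambda>n. s n x) \<longlonglongrightarrow> h x"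
    "\<And>n x. x \<in> space M \<Longrightarrow> \<bar>s n x\<bar> \<le> 2 * \<bar>h x\<bar>" "\<And>n. integrable M (s n)"
    by (rule simple_approx[OF h]) blast
  have m: "(\<lambda>\<omega>. point_prod (N \<omega>) h) \<in> borel_measurable Q" by (rule point_prod_meas_Q) measurable
  have sm: "(\<lambda>\<omega>. point_prod (N \<omega>) (s n)) \<in> borel_measurable Q" for n
    by (rule borel_measurable_integrable[OF point_prod_simple_integral(1)[OF s(1)]])
  have i: "integrable M (\<lambda>x. 2 * h x)" using h by simp
  have dom: "integrable Q (\<lambda>\<omega>. point_prod (N \<omega>) (\<lambda>x. \<bar>2 * h x\<bar>))" by (rule point_prod_abs_integrable[OF i])
  have lim: "AE \<omega> in Q. (\<lambda>n. point_prod (N \<omega>) (s n)) \<longlonglongrightarrow> point_prod (N \<omega>) h"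
  proof (rule AE_mp[OF AE_finite], intro AE_I2 impI)
    fix \<omega> assume \<omega>: "\<omega> \<in> space Q" "finite {x. N \<omega> x \<noteq> 0}"
    show "(\<lambda>n. point_prod (N \<omega>) (s n)) \<longlonglongrightarrow> point_prod (N \<omega>) h"
    proof (rule point_prod_tendsto)
      show "finite {x. N \<omega> x \<noteq> 0 \<and> h x \<noteq> 0}" by (rule rev_finite_subset[OF \<omega>(2)]) auto
      show "(\<lambda>n. s n x) \<longlonglongrightarrow> h x" if "N \<omega> x \<noteq> 0" for x by (rule s(2)[OF supp_sub[OF \<omega>(1) that]])
      show "s n x = 0" if "N \<omega> x \<noteq> 0" "h x = 0" for n x
        using s(3)[OF supp_sub[OF \<omega>(1) that(1)], of n] that(2) by simp
    qed
  qed
  have bound: "AE \<omega> in Q. norm (point_prod (N \<omega>) (s n)) \<le> point_prod (N \<omega>) (\<lambda>x. \<bar>2 * h x\<bar>)" for n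
  proof (rule AE_mp[OF AE_finite], intro AE_I2 impI)
    fix \<omega> assume \<omega>: "\<omega> \<in> space Q" "finite {x. N \<omega> x \<noteq> 0}"
    show "norm (point_prod (N \<omega>) (s n)) \<le> point_prod (N \<omega>) (\<lambda>x. \<bar>2 * h x\<bar>)"
      unfolding real_norm_def by (rule abs_point_prod_le[OF \<omega>(2)]) (use s(3) supp_sub[OF \<omega>(1)] in \<open>auto simp: abs_mult\<close>)
  qed
  show "integrable Q (\<lambda>\<omega>. point_prod (N \<omega>) h)" by (rule integrable_dominated_convergence[OF m sm dom lim bound])
  have "(\<lambda>n. \<integral>\<omega>. point_prod (N \<omega>) (s n) \<partial>Q) \<longlonglongrightarrow> (\<integral>\<omega>. point_prod (N \<omega>) h \<partial>Q)"
    by (rule integral_dominated_convergence[OF m sm dom lim bound])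
  moreover have "(\<lambda>n. \<integral>x. s n x \<partial>M) \<longlonglongrightarrow> (\<integral>x. h x \<partial>M)"
  proof (rule integral_dominated_convergence)
    show "integrable M (\<lambda>x. 2 * \<bar>h x\<bar>)" using h by simp
  qed (use s(2,3) borel_measurable_integrable[OF s(4)] in auto)
  then have "(\<lambda>n. \<integral>\<omega>. point_prod (N \<omega>) (s n) \<partial>Q) \<longlonglongrightarrow> exp (\<integral>x. h x \<partial>M)"
    unfolding point_prod_simple_integral(2)[OF s(1)] by (rule tendsto_exp)
  ultimately show "(\<integral>\<omega>. point_prod (N \<omega>) h \<partial>Q) = exp (\<integral>x. h x \<partial>M)" by (rule LIMSEQ_unique)
qed

definition "E h \<omega> = point_prod (N \<omega>) h * exp (- (\<integral>x. h x \<partial>M))"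

text \<open>\<open>Y \<phi>\<close> is almost surely the integral of \<open>\<phi>\<close> over the configuration; being a logarithm of
  \<open>point_prod\<close>, it inherits measurability and takes the junk value \<open>0\<close> on infinite configurations.\<close>

definition "Y \<phi> \<omega> = ln (point_prod (N \<omega>) (\<lambda>x. exp (\<phi> x) - 1))"

lemma exp_Y: "exp (Y \<phi> \<omega>) = point_prod (N \<omega>) (\<lambda>x. exp (\<phi> x) - 1)"
  unfolding Y_def by (rule exp_ln) (auto simp: point_prod_def intro!: prod_pos)

lemma Y_eq: "finite {x. N \<omega> x \<noteq> 0} \<Longrightarrow> Y \<phi> \<omega> = (\<Sum>x\<in>{x. N \<omega> x \<noteq> 0}. real (N \<omega> x) * \<phi> x)"
  unfolding Y_def by (subst point_prod_eq[where S = "{x. N \<omega> x \<noteq> 0}"]) (auto simp: exp_of_nat_mult[symmetric] exp_sum[symmetric])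

sublocale fock_space M Q "poisson_field M Q N" E
proof (rule fock_space.intro)
  note int1 = real_L2_integrable[OF finM]
  show "finite_measure M" by (rule finM)
  show "prob_space Q" by (rule probQ)
  show "subalgebra Q (poisson_field M Q N A)" for A by (rule subalg)
  show "sets (poisson_field M Q N A) \<subseteq> sets (poisson_field M Q N B)" if "A \<subseteq> B" for A B
    unfolding sets_field by (rule sigma_sets_mono') (use that in blast)
  show "E h \<in> borel_measurable (poisson_field M Q N A)"
    if A: "A \<in> sets M" and h: "h \<in> real_L2 M" "\<forall>x\<in>space M - A. h x = 0" for A h
    using point_prod_meas[OF A real_L2_measurable[OF h(1)] h(2)] unfolding E_def by measurable
  then have E_meas: "E h \<in> borel_measurable Q" if "h \<in> real_L2 M" for h
    using measurable_from_subalg[OF subalg] that by blast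
  have int: "integrable Q (\<lambda>\<omega>. E h \<omega> * E k \<omega>) \<and> (\<integral>\<omega>. E h \<omega> * E k \<omega> \<partial>Q) = exp (\<integral>x. h x * k x \<partial>M)"
    if h: "h \<in> real_L2 M" and k: "k \<in> real_L2 M" for h k
  proof -
    \<comment> \<open>(1 + h)(1 + k) = 1 + g. The normalising factors cancel the linear part of g,
      leaving \<integral> h k in the exponent: the same kernel as for white noise.\<close>
    let ?g = "\<lambda>x. (h x + k x) + h x * k x"
    let ?c = "exp (- (\<integral>x. h x \<partial>M)) * exp (- (\<integral>x. k x \<partial>M))"
    have hk: "integrable M (\<lambda>x. h x * k x)" by (rule real_L2_mult_integrable[OF h k])
    have g: "integrable M ?g" using int1[OF h] int1[OF k] hk by simp
    have gI: "(\<integral>x. ?g x \<partial>M) = (\<integral>x. h x \<partial>M) + (\<integral>x. k x \<partial>M) + (\<integral>x. h x * k x \<partial>M)"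
      using int1[OF h] int1[OF k] hk by simp
    note [measurable] = E_meas[OF h] E_meas[OF k]
    have eq: "AE \<omega> in Q. ?c * point_prod (N \<omega>) ?g = E h \<omega> * E k \<omega>"
      using AE_finite
    proof eventually_elim
      case (elim \<omega>)
      then have "point_prod (N \<omega>) ?g = point_prod (N \<omega>) h * point_prod (N \<omega>) k"
        by (intro point_prod_mult) (simp_all add: algebra_simps)
      then show ?case by (simp add: E_def)
    qed
    have i: "integrable Q (\<lambda>\<omega>. ?c * point_prod (N \<omega>) ?g)"
      by (intro integrable_mult_right point_prod_integral(1) g)
    have "integrable Q (\<lambda>\<omega>. E h \<omega> * E k \<omega>)" by (rule integrable_cong_AE_imp[OF i _ eq]) measurable
    moreover have "(\<integral>\<omega>. ?c * point_prod (N \<omega>) ?g \<partial>Q) = (\<integral>\<omega>. E h \<omega> * E k \<omega> \<partial>Q)"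
      by (rule integral_cong_AE[OF borel_measurable_integrable[OF i] _ eq]) measurable
    moreover have "(\<integral>\<omega>. ?c * point_prod (N \<omega>) ?g \<partial>Q) = ?c * exp (\<integral>x. ?g x \<partial>M)"
      by (simp only: integral_mult_right_zero point_prod_integral(2)[OF g])
    moreover have "\<dots> = exp (\<integral>x. h x * k x \<partial>M)" unfolding gI exp_add[symmetric] by simp
    ultimately show ?thesis by simp
  qed
  then show "integrable Q (\<lambda>\<omega>. E h \<omega> * E k \<omega>)" "(\<integral>\<omega>. E h \<omega> * E k \<omega> \<partial>Q) = exp (\<integral>x. h x * k x \<partial>M)"
    if "h \<in> real_L2 M" "k \<in> real_L2 M" for h k using that by auto
  show "AE \<omega> in Q. E (\<lambda>x. h x + k x) \<omega> = E h \<omega> * E k \<omega>"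
    if h: "h \<in> real_L2 M" and k: "k \<in> real_L2 M" and s: "\<forall>x\<in>space M - A. h x = 0" "\<forall>x\<in>A. k x = 0" for A h k
    using AE_finite
  proof (rule AE_mp, intro AE_I2 impI)
    fix \<omega> assume \<omega>: "\<omega> \<in> space Q" "finite {x. N \<omega> x \<noteq> 0}"
    have "h x * k x = 0" if "N \<omega> x \<noteq> 0" for x using s supp_sub[OF \<omega>(1) that] by (cases "x \<in> A") auto
    then have "point_prod (N \<omega>) (\<lambda>x. h x + k x) = point_prod (N \<omega>) h * point_prod (N \<omega>) k"
      by (intro point_prod_mult \<omega>) (simp add: distrib_left distrib_right)
    moreover have "exp (- (\<integral>x. h x + k x \<partial>M)) = exp (- (\<integral>x. h x \<partial>M)) * exp (- (\<integral>x. k x \<partial>M))"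
      using int1[OF h] int1[OF k] by (simp add: mult_exp_exp)
    ultimately show "E (\<lambda>x. h x + k x) \<omega> = E h \<omega> * E k \<omega>" by (simp add: E_def)
  qed
  show "AE \<omega> in Q. E (\<lambda>_. 0) \<omega> = 1" by (simp add: E_def point_prod_def)
  show "(\<integral>\<omega>. u \<omega> * indicator D \<omega> \<partial>Q) = 0"
    if u: "u \<in> borel_measurable Q" "integrable Q (\<lambda>\<omega>. (u \<omega>)\<^sup>2)"
      and orth: "\<And>h. \<lbrakk>h \<in> real_L2 M; \<forall>x\<in>space M - A. h x = 0\<rbrakk> \<Longrightarrow> (\<integral>\<omega>. u \<omega> * E h \<omega> \<partial>Q) = 0"
      and D: "D \<in> sets (poisson_field M Q N A)" for A u D
  proof -
    \<comment> \<open>Boundedness makes exp(\<phi>) - 1 square integrable, so that exp(Y \<phi>) is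
      a multiple of one of the exponentials. The parameter \<phi> is used because Y is almost surely
      linear in it, which it is not in h = exp(\<phi>) - 1.\<close>
    define \<Phi> where "\<Phi> = {\<phi> \<in> borel_measurable M. (\<exists>c. \<forall>x. \<bar>\<phi> x\<bar> \<le> c) \<and> (\<forall>x\<in>space M - A. \<phi> x = (0::real))}"
    have eL2: "(\<lambda>x. exp (\<phi> x) - 1) \<in> real_L2 M" if \<phi>: "\<phi> \<in> \<Phi>" for \<phi>
    proof -
      obtain c where c: "\<And>x. \<bar>\<phi> x\<bar> \<le> c" using \<phi> by (auto simp: \<Phi>_def)
      have "\<bar>exp (\<phi> x) - 1\<bar> \<le> exp c" for x
      proof -
        have "exp (\<phi> x) \<le> exp c" "1 \<le> exp c" using c[of x] by auto
        then show ?thesis using exp_gt_zero[of "\<phi> x"] by linarith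
      qed
      then show ?thesis using \<phi> finM by (intro real_L2_bounded) (auto simp: \<Phi>_def)
    qed
    interpret exponential_family Q "Y ` \<Phi>"
    proof (rule exponential_family.intro)
      show "finite_measure Q" using probQ by (simp add: prob_space_def)
      have "(\<lambda>_. 0) \<in> \<Phi>" by (auto simp: \<Phi>_def)
      then show "Y ` \<Phi> \<noteq> {}" by blast
      fix Z assume "Z \<in> Y ` \<Phi>"
      then obtain \<phi> where Z: "Z = Y \<phi>" "\<phi> \<in> \<Phi>" by blast
      show "Z \<in> borel_measurable Q"
        unfolding Z Y_def[abs_def] using point_prod_meas_Q[OF real_L2_measurable[OF eL2[OF Z(2)]]] by measurable
      show "integrable Q (\<lambda>x. exp (Z x))"
        unfolding Z exp_Y by (rule point_prod_integral(1)[OF int1[OF eL2[OF Z(2)]]])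
      fix Z' a b assume "Z' \<in> Y ` \<Phi>"
      then obtain \<psi> where Z': "Z' = Y \<psi>" "\<psi> \<in> \<Phi>" by blast
      have "(\<lambda>x. a * \<phi> x + b * \<psi> x) \<in> \<Phi>"
      proof -
        obtain c d where "\<And>x. \<bar>\<phi> x\<bar> \<le> c" "\<And>x. \<bar>\<psi> x\<bar> \<le> d" using Z Z' by (auto simp: \<Phi>_def)
        then have "\<bar>a * \<phi> x + b * \<psi> x\<bar> \<le> \<bar>a\<bar> * c + \<bar>b\<bar> * d" for x
          by (intro order_trans[OF abs_triangle_ineq] add_mono) (auto simp: abs_mult intro: mult_left_mono)
        then show ?thesis using Z(2) Z'(2) by (auto simp: \<Phi>_def)
      qed
      moreover have "AE x in Q. Y (\<lambda>x. a * \<phi> x + b * \<psi> x) x = a * Y \<phi> x + b * Y \<psi> x"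
        using AE_finite by eventually_elim (simp add: Y_eq sum.distrib sum_distrib_left algebra_simps)
      ultimately show "\<exists>X\<in>Y ` \<Phi>. AE x in Q. X x = a * Z x + b * Z' x" unfolding Z Z' by blast
    qed
    show ?thesis
    proof (rule exp_zero_imp_zero_on_generated[OF u, where \<E> = "gens A"])
      fix Z assume "Z \<in> Y ` \<Phi>"
      then obtain \<phi> where Z: "Z = Y \<phi>" "\<phi> \<in> \<Phi>" by blast
      let ?h = "\<lambda>x. exp (\<phi> x) - 1"
      have "u \<omega> * exp (Z \<omega>) = exp (\<integral>x. ?h x \<partial>M) * (u \<omega> * E ?h \<omega>)" for \<omega>
        unfolding Z exp_Y E_def by (simp add: exp_minus)
      then have "(\<integral>x. u x * exp (Z x) \<partial>Q) = exp (\<integral>x. ?h x \<partial>M) * (\<integral>\<omega>. u \<omega> * E ?h \<omega> \<partial>Q)"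
        by (simp only: integral_mult_right_zero)
      moreover have "(\<integral>\<omega>. u \<omega> * E ?h \<omega> \<partial>Q) = 0" using Z(2) by (intro orth eL2) (auto simp: \<Phi>_def)
      ultimately show "(\<integral>x. u x * exp (Z x) \<partial>Q) = 0" by simp
    next
      fix S assume "S \<in> gens A"
      then obtain B C where S: "S = (\<lambda>\<omega>. num_points (N \<omega>) B) -` C \<inter> space Q" and B: "B \<in> sets M" "B \<subseteq> A"
        and C [measurable]: "C \<in> sets borel" by blast
      \<comment> \<open>For this \<phi>, Y is almost surely the number of points in B, now as a real
        number; the target event is therefore pulled back along \<open>ennreal\<close>.\<close>
      have "indicator B \<in> \<Phi>" using B by (auto simp: \<Phi>_def indicator_def intro!: exI[of _ 1])
      moreover have "ennreal -` C \<in> sets borel" using measurable_sets[OF measurable_ennreal C] by simp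
      moreover have "AE \<omega> in Q. \<omega> \<in> S \<longleftrightarrow> Y (indicator B) \<omega> \<in> ennreal -` C"
      proof (rule AE_mp[OF AE_finite], intro AE_I2 impI)
        fix \<omega> assume \<omega>: "\<omega> \<in> space Q" "finite {x. N \<omega> x \<noteq> 0}"
        have f: "finite {x\<in>B. N \<omega> x \<noteq> 0}" by (rule rev_finite_subset[OF \<omega>(2)]) auto
        have "Y (indicator B) \<omega> = (\<Sum>x\<in>{x\<in>B. N \<omega> x \<noteq> 0}. real (N \<omega> x))"
          unfolding Y_eq[OF \<omega>(2)] by (rule sum.mono_neutral_cong_right[OF \<omega>(2)]) (auto simp: indicator_def)
        then show "\<omega> \<in> S \<longleftrightarrow> Y (indicator B) \<omega> \<in> ennreal -` C"
          using \<omega>(1) by (simp add: S num_points_finite[OF f])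
      qed
      ultimately show "\<exists>Z\<in>Y ` \<Phi>. \<exists>B\<in>sets borel. AE x in Q. x \<in> S \<longleftrightarrow> Z x \<in> B" by blast
    next
      show "gens A \<subseteq> sets Q" by (rule gens_sub)
      show "D \<in> sigma_sets (space Q) (gens A)" using D by (simp only: sets_field)
    qed
  qed
qed

lemma e_eq: "e h = poisson_exponential M Q N h"
  unfolding e_def poisson_exponential_def
proof (rule ae_class_cong, use AE_finite in eventually_elim)
  case (elim \<omega>)
  then have "point_prod (N \<omega>) h = (\<Prod>x\<in>{x. N \<omega> x \<noteq> 0}. (1 + h x) ^ N \<omega> x)"
    by (intro point_prod_eq) auto
  then show ?case by (simp add: E_def)
qed

end

section \<open>The isomorphism\<close>

context fock_space begin

text \<open>The factors are kept as concrete functions, because multiplicativity asks for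
  representatives measurable in the fields \<open>F (A k)\<close>, not merely for a product of
  classes.\<close>

lemma e_disjoint_Union:
  assumes h: "h \<in> real_L2 M" and A: "\<forall>k<n::nat. A k \<in> sets M" "disjoint_family_on A {..<n}"
  shows "e (cut (\<Union>k<n. A k) h) = ae_class P (\<lambda>\<omega>. \<Prod>k<n. complex_of_real (E (cut (A k) h) \<omega>))"
  using A
proof (induction n)
  case 0
  have "cut {} h = (\<lambda>_. 0)" by (auto simp: cut_def)
  then show ?case by (simp add: one_eq)
next
  case (Suc n)
  let ?U = "\<Union>k<n. A k"
  have U: "?U \<in> sets M" by (rule sets.finite_UN) (simp_all add: Suc.prems(1))
  have An: "A n \<in> sets M" using Suc.prems(1) by simp
  have "A k \<inter> A n = {}" if "k < n" for k
    using Suc.prems(2)[unfolded disjoint_family_on_def, rule_format, of k n] that by simp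
  then have D: "?U \<inter> A n = {}" by blast
  have m: "(\<lambda>\<omega>. complex_of_real (E (cut (A k) h) \<omega>)) \<in> borel_measurable P" if "k < Suc n" for k
    using E_meas_P[OF real_L2_cut[OF _ h, of "A k"]] Suc.prems(1) that by simp
  have "cut (\<Union>k<Suc n. A k) h = (\<lambda>x. cut ?U h x + cut (A n) h x)"
    using D by (auto simp: cut_def lessThan_Suc fun_eq_iff)
  then have "e (cut (\<Union>k<Suc n. A k) h) = e (\<lambda>x. cut ?U h x + cut (A n) h x)" by (simp only:)
  also have "\<dots> = cmul (e (cut ?U h)) (e (cut (A n) h))"
    using D by (intro e_mult[OF U real_L2_cut[OF U h] real_L2_cut[OF An h]]) (auto simp: cut_def)
  also have "e (cut ?U h) = ae_class P (\<lambda>\<omega>. \<Prod>k<n. complex_of_real (E (cut (A k) h) \<omega>))"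
  proof (rule Suc.IH)
    show "\<forall>k<n. A k \<in> sets M" using Suc.prems(1) by simp
    show "disjoint_family_on A {..<n}" by (rule disjoint_family_on_mono[OF _ Suc.prems(2)]) auto
  qed
  also have "cmul \<dots> (e (cut (A n) h)) = ae_class P (\<lambda>\<omega>. \<Prod>k<Suc n. complex_of_real (E (cut (A k) h) \<omega>))"
    unfolding e_def using m by (subst class_mult_ae_class) (auto intro!: borel_measurable_prod)
  finally show ?case .
qed

lemma multiplicative_e:
  assumes h: "h \<in> real_L2 M"
  shows "multiplicative M P F (e h)"
  unfolding multiplicative_def
proof (intro conjI allI impI)
  fix n :: nat and A assume A: "(\<forall>k<n. A k \<in> sets M) \<and> disjoint_family_on A {..<n} \<and> (\<Union>k<n. A k) = X"
  have "e h = e (cut X h)"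
    by (rule e_cong[OF h real_L2_cut[OF sets.top h]]) (simp add: cut_def)
  also have "\<dots> = ae_class P (\<lambda>\<omega>. \<Prod>k<n. complex_of_real (E (cut (A k) h) \<omega>))"
    using e_disjoint_Union[OF h, of n A] A by simp
  finally have eq: "e h = ae_class P (\<lambda>\<omega>. \<Prod>k<n. complex_of_real (E (cut (A k) h) \<omega>))" .
  show "\<exists>f. (\<forall>k<n. f k \<in> borel_measurable (F (A k))) \<and> e h = ae_class P (\<lambda>x. \<Prod>k<n. f k x)"
  proof (intro exI conjI allI impI)
    fix k assume "k < n"
    then have Ak: "A k \<in> sets M" using A by blast
    have "E (cut (A k) h) \<in> borel_measurable (F (A k))"
      by (rule E_meas[OF Ak real_L2_cut[OF Ak h]]) (simp add: cut_def)
    then show "(\<lambda>\<omega>. complex_of_real (E (cut (A k) h) \<omega>)) \<in> borel_measurable (F (A k))" by measurable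
  qed (rule eq)
qed (use h in simp)

end

section \<open>Existence and uniqueness of the isomorphism\<close>

context fock_pair begin

lemma transport_unital: "unital_special_real_isomorphism M P F Q G transport"
  unfolding unital_special_real_isomorphism_def
  by (intro conjI mult_iso_special transport_mult_iso transport_real transport_one)

text \<open>An isometry that sends exponentials to exponentials preserves transforms, and these
  determine the image of each functional. Off the carrier the two maps agree because both are
  extensional.\<close>

lemma transport_unique:
  assumes \<Phi>: "unital_special_real_isomorphism M P F Q G \<Phi>"
    and e: "\<And>h. h \<in> real_L2 M \<Longrightarrow> \<Phi> (a.e h) = b.e h"
  shows "\<Phi> = transport"
proof
  have lin: "\<Phi> \<in> linear_ops a.HX b.HX" and iso: "\<And>u. u \<in> a.C a.X \<Longrightarrow> hnorm b.HX (\<Phi> u) = hnorm a.HX u"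
    using \<Phi> by (auto simp: unital_special_real_isomorphism_def special_isomorphism_def)
  have ext: "\<Phi> \<in> a.C a.X \<rightarrow>\<^sub>E b.C a.X" "transport \<in> a.C a.X \<rightarrow>\<^sub>E b.C a.X"
    using lin transport_linear by (auto simp: linear_ops_def)
  fix u
  show "\<Phi> u = transport u"
  proof (cases "u \<in> a.C a.X")
    case True
    have "transport u = \<Phi> u"
    proof (rule transport_eqI[OF True])
      show "\<Phi> u \<in> b.C a.X" using ext(1) True by auto
      fix h assume h: "h \<in> real_L2 M"
      show "b.ip (\<Phi> u) (b.e h) = a.ip u (a.e h)"
        using linear_isometry_inner[OF a.hilbert_axioms b.hilbert_axioms lin iso True a.e_in_X[OF h]]
        by (simp add: e[OF h])
    qed
    then show ?thesis by simp
  next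
    case False
    then show ?thesis using PiE_arb[OF ext(1)] PiE_arb[OF ext(2)] by simp
  qed
qed

end

theorem theorem4:
  fixes M :: "'a measure"
    and P :: "'s measure" and W :: "('a \<Rightarrow> real) \<Rightarrow> 's \<Rightarrow> real"
    and Q :: "'t measure" and N :: "'t \<Rightarrow> 'a \<Rightarrow> nat"
  assumes "finite_lebesgue_space M" and "nonatomic M"
    and "gaussian_white_noise M P W"
    and "poisson_process M Q N"
  shows
    "(\<exists>!\<Phi>. unital_special_real_isomorphism M P (gaussian_field M P W) Q (poisson_field M Q N) \<Phi> \<and>
        (\<forall>h \<in> real_L2 M \<inter> real_L1 M.
           multiplicative M P (gaussian_field M P W) (gaussian_exponential M P W h) \<and>
           multiplicative M Q (poisson_field M Q N) (poisson_exponential M Q N h) \<and>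
           \<Phi> (gaussian_exponential M P W h) = poisson_exponential M Q N h)) \<and>
     (\<forall>\<Psi>. unital_special_real_isomorphism M P (gaussian_field M P W) Q (poisson_field M Q N) \<Psi> \<longrightarrow>
        (\<exists>\<epsilon> \<in> borel_measurable M. (\<forall>x\<in>space M. \<epsilon> x \<in> {-1, 1}) \<and>
           (\<forall>h \<in> real_L2 M \<inter> real_L1 M.
              \<Psi> (gaussian_exponential M P W h) = poisson_exponential M Q N (\<lambda>x. \<epsilon> x * h x))))"
proof -
  have fin: "finite_measure M" using assms(1) by (simp add: finite_lebesgue_space_def)
  interpret g: white_noise M P W by (rule white_noise.intro[OF fin assms(3)])
  interpret p: poisson_noise M Q N by (rule poisson_noise.intro[OF fin assms(4)])
  interpret fp: fock_pair M P "gaussian_field M P W" g.E Q "poisson_field M Q N" p.E ..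
  let ?iso = "unital_special_real_isomorphism M P (gaussian_field M P W) Q (poisson_field M Q N)"
  \<comment> \<open>\<nu> is finite, so square integrable functions are integrable.\<close>
  have L12: "real_L2 M \<inter> real_L1 M = real_L2 M"
    using real_L2_integrable[OF fin] by (auto simp: real_L1_def)
  have e: "fp.transport (gaussian_exponential M P W h) = poisson_exponential M Q N h" if "h \<in> real_L2 M" for h
    using fp.transport_e[OF that] by (simp only: g.e_eq p.e_eq)
  show ?thesis
    unfolding L12
  proof (intro conjI allI impI)
    show "\<exists>!\<Phi>. ?iso \<Phi> \<and> (\<forall>h\<in>real_L2 M.
        multiplicative M P (gaussian_field M P W) (gaussian_exponential M P W h) \<and>
        multiplicative M Q (poisson_field M Q N) (poisson_exponential M Q N h) \<and>
        \<Phi> (gaussian_exponential M P W h) = poisson_exponential M Q N h)"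
    proof (intro ex1I conjI ballI)
      show "?iso fp.transport" by (rule fp.transport_unital)
      show "multiplicative M P (gaussian_field M P W) (gaussian_exponential M P W h)" if "h \<in> real_L2 M" for h
        using g.multiplicative_e[OF that] by (simp only: g.e_eq)
      show "multiplicative M Q (poisson_field M Q N) (poisson_exponential M Q N h)" if "h \<in> real_L2 M" for h
        using p.multiplicative_e[OF that] by (simp only: p.e_eq)
      show "fp.transport (gaussian_exponential M P W h) = poisson_exponential M Q N h" if "h \<in> real_L2 M" for h
        by (rule e[OF that])
      show "\<Phi> = fp.transport" if "?iso \<Phi> \<and> (\<forall>h\<in>real_L2 M.
        multiplicative M P (gaussian_field M P W) (gaussian_exponential M P W h) \<and>
        multiplicative M Q (poisson_field M Q N) (poisson_exponential M Q N h) \<and>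
        \<Phi> (gaussian_exponential M P W h) = poisson_exponential M Q N h)" for \<Phi>
        by (rule fp.transport_unique) (use that in \<open>auto simp: g.e_eq p.e_eq\<close>)
    qed
    fix \<Psi> assume "?iso \<Psi>"
    then interpret iso: fock_iso M P "gaussian_field M P W" g.E Q "poisson_field M Q N" p.E \<Psi>
      by (intro fock_iso.intro fock_iso_axioms.intro fp.fock_pair_axioms assms(2))
    show "\<exists>\<epsilon>\<in>borel_measurable M. (\<forall>x\<in>space M. \<epsilon> x \<in> {-1, 1}) \<and>
      (\<forall>h\<in>real_L2 M. \<Psi> (gaussian_exponential M P W h) = poisson_exponential M Q N (\<lambda>x. \<epsilon> x * h x))"
      using iso.sign by (simp only: g.e_eq p.e_eq)
  qed
qed

end
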